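(* For any $d_0\ge1$, $C>1$, $\varepsilon>0$, there exists $T\ge1$ with the following property. Let $G$ be $GL(d_0,\mathbb R)$ or $SL(d_0,\mathbb R)$. Any periodic cocycle $(A_i)_{i\in\mathbb Z}$ in $G$ bounded by $C$ and with period $\ell\ge T$ admits an $\varepsilon$-path of perturbations $(A_i(t))_{t\in[0,1]}$ in $G$ with the same period $\ell$ such that, writing $\mathcal A(t):=A_\ell(t)\cdots A_1(t)$: - the eigenvalues of $\mathcal A(t)$ have moduli constant in $t\in[0,1]$; - $\mathcal A(1)$ has only real eigenvalues. The same result holds in $G=Sp(d_0,\mathbb R)$ ($d_0$ even) for cocycles that are moreover hyperbolic.
   Context: Matrices carry the operator norm associated with the Euclidean norm. For a subgroup $G\subset GL(d_0,\mathbb R)$, a periodic cocycle in $G$ with period $\ell\ge1$ is the integer $\ell$ together with a sequence $(A_i)_{i\in\mathbb Z}$ in $G$ with $A_{i+\ell}=A_i$ for all $i$. It is hyperbolic if $A_\ell\cdots A_1$ has no eigenvalue on the unit circle, and bounded by $C>1$ if $\max(\|A_i\|,\|A_i^{-1}\|)\le C$ for all $i$. An $\varepsilon$-path of perturbations of $(A_i)$ is a family of periodic cocycles $(A_i(t))_{i\in\mathbb Z}$, $t\in[0,1]$, in $G$, continuous in $t$, with $A_i(0)=A_i$ and $\max\{\|A_i-A_i(t)\|,\|A_i^{-1}-A_i(t)^{-1}\|\}<\varepsilon$ for all $i$ and all $t\in[0,1]$. *)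

theory Defs
  imports
    Complex_Main
    "Jordan_Normal_Form.Matrix"
    "Jordan_Normal_Form.Gauss_Jordan_Elimination"
    "Jordan_Normal_Form.Char_Poly"
begin

definition eucl_norm :: "real vec \<Rightarrow> real" where
  "eucl_norm v = sqrt (v \<bullet> v)"

definition op_norm :: "real mat \<Rightarrow> real" where
  "op_norm A = (SUP v \<in> {v \<in> carrier_vec (dim_col A). eucl_norm v \<le> 1}. eucl_norm (A *\<^sub>v v))"

text \<open>Only meaningful for invertible matrices.\<close>

definition mat_inv :: "real mat \<Rightarrow> real mat" where
  "mat_inv A = the (mat_inverse A)"

definition GL :: "nat \<Rightarrow> real mat set" where
  "GL d = {A \<in> carrier_mat d d. invertible_mat A}"

definition SL :: "nat \<Rightarrow> real mat set" where
  "SL d = {A \<in> carrier_mat d d. det A = 1}"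

definition symplectic_form :: "nat \<Rightarrow> real mat" where
  "symplectic_form n = four_block_mat (0\<^sub>m n n) (1\<^sub>m n) (- 1\<^sub>m n) (0\<^sub>m n n)"

text \<open>The argument of \<open>Sp\<close> is the full dimension; it is only used for even \<open>d\<close>.\<close>

definition Sp :: "nat \<Rightarrow> real mat set" where
  "Sp d = {A \<in> carrier_mat d d.
     transpose_mat A * symplectic_form (d div 2) * A = symplectic_form (d div 2)}"

definition periodic_cocycle :: "real mat set \<Rightarrow> nat \<Rightarrow> (int \<Rightarrow> real mat) \<Rightarrow> bool" where
  "periodic_cocycle G l A \<longleftrightarrow> l \<ge> 1 \<and> (\<forall>i. A i \<in> G) \<and> (\<forall>i. A (i + int l) = A i)"

text \<open>\<open>cocycle_prod d A l\<close> is the ordered product \<open>A l * \<dots> * A 1\<close> of \<open>d \<times> d\<close> matrices.\<close>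

primrec cocycle_prod :: "nat \<Rightarrow> (int \<Rightarrow> real mat) \<Rightarrow> nat \<Rightarrow> real mat" where
  "cocycle_prod d A 0 = 1\<^sub>m d"
| "cocycle_prod d A (Suc l) = A (int (Suc l)) * cocycle_prod d A l"

definition cocycle_bounded :: "real \<Rightarrow> (int \<Rightarrow> real mat) \<Rightarrow> bool" where
  "cocycle_bounded C A \<longleftrightarrow> (\<forall>i. max (op_norm (A i)) (op_norm (mat_inv (A i))) \<le> C)"

definition complex_eigenvalue :: "real mat \<Rightarrow> complex \<Rightarrow> bool" where
  "complex_eigenvalue M z \<longleftrightarrow> eigenvalue (map_mat complex_of_real M) z"

definition hyperbolic_cocycle :: "nat \<Rightarrow> nat \<Rightarrow> (int \<Rightarrow> real mat) \<Rightarrow> bool" where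
  "hyperbolic_cocycle d l A \<longleftrightarrow> (\<forall>z. complex_eigenvalue (cocycle_prod d A l) z \<longrightarrow> cmod z \<noteq> 1)"

text \<open>Moduli of the complex eigenvalues, counted with algebraic multiplicity.\<close>

definition eigenvalue_moduli :: "real mat \<Rightarrow> real multiset" where
  "eigenvalue_moduli M = image_mset cmod (proots (char_poly (map_mat complex_of_real M)))"

text \<open>The first argument of a path \<open>P\<close> is the time \<open>t \<in> [0, 1]\<close>, the second the index \<open>i\<close>;
  values of \<open>P\<close> outside \<open>[0, 1]\<close> are irrelevant.  Continuity in \<open>t\<close> is with respect to
  the operator norm.\<close>

definition perturbation_path ::
  "real mat set \<Rightarrow> nat \<Rightarrow> real \<Rightarrow> (int \<Rightarrow> real mat) \<Rightarrow> (real \<Rightarrow> int \<Rightarrow> real mat) \<Rightarrow> bool" where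
  "perturbation_path G l \<epsilon> A P \<longleftrightarrow>
     (\<forall>t\<in>{0..1}. periodic_cocycle G l (P t)) \<and>
     (\<forall>i. \<forall>s\<in>{0..1}. ((\<lambda>t. op_norm (P t i - P s i)) \<longlongrightarrow> 0) (at s within {0..1})) \<and>
     (\<forall>i. P 0 i = A i) \<and>
     (\<forall>i. \<forall>t\<in>{0..1}.
        max (op_norm (A i - P t i)) (op_norm (mat_inv (A i) - mat_inv (P t i))) < \<epsilon>)"

end

theory Submission
  imports Defs "Jordan_Normal_Form.Schur_Decomposition"
begin

text \<open>
  The perturbed cocycles have the form \<open>S t k * A k\<close> with rotations \<open>S t k\<close> close to the identity.  If they
  are within \<open>\<delta>\<close> of the identity, then \<open>A k\<close> and its inverse move by at most \<open>\<delta> C\<close>, so the task is to find,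
  for long periods, small rotations that make all eigenvalues of the product real without changing
  their moduli.  This is possible as soon as \<open>l \<delta> \<ge> pi\<close>.

  In dimension two, reflections and scaling reduce the problem to factors of determinant \<open>1\<close>.  If the product is elliptic, all factors are rotated
  by the same angle \<open>x\<close>.  While the product remains elliptic its eigenvalues are \<open>exp (\<plusminus> i \<theta>)\<close>, and each of
  the \<open>l\<close> factors pushes \<open>\<theta>\<close> in the same direction with speed at least one
  (\<open>rotated_trace_derivative_bound\<close>).  Hence at some \<open>x \<le> pi / l\<close> the angle \<open>\<theta>\<close> has reached \<open>0\<close> or \<open>pi\<close>
  (\<open>rotation_reaches_real\<close>).  Stopping there, the eigenvalues form a conjugate pair at all times and are
  real at the end, and their modulus is fixed by the determinant (\<open>exists_realifying_rotations_2x2\<close>).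

  In higher dimension a nonreal eigenvalue of the product gives an invariant plane.  Transporting it
  along the cocycle and choosing adapted orthonormal frames makes all factors block triangular
  (\<open>orth_chain\<close>).  Rotations in the plane and in its orthogonal complement then act independently on the
  restriction and on the quotient, and induction applies (\<open>exists_realifying_rotations\<close>).  Rotations have
  determinant \<open>1\<close>, so the perturbed matrices stay in \<open>GL\<close> or \<open>SL\<close>.

  For a hyperbolic symplectic cocycle the stable subspace is Lagrangian
  (\<open>hyperbolic_symplectic_split\<close>), and its images have orthonormal frames that extend to symplectic
  orthonormal frames (\<open>symplectic_completion\<close>).  The stable cocycle is treated by the general linear case.
  The quotient cocycle is the inverse transpose of the stable one, and a rotation is its own inverse transpose,
  so using the same rotations on both parts is a symplectic perturbation
  (\<open>exists_realifying_symplectic_rotations\<close>).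
\<close>

section \<open>Eigenvalues of real matrices\<close>

text \<open>The complex eigenvalues of a real matrix as a multiset: block decompositions then become sums
  of multisets.\<close>

definition eigenvals :: "real mat \<Rightarrow> complex multiset" where
  "eigenvals M = proots (char_poly (map_mat complex_of_real M))"

lemma char_poly_nonzero:
  fixes M :: "'a :: idom mat"
  assumes "M \<in> carrier_mat n n" shows "char_poly M \<noteq> 0"
  using degree_monic_char_poly[OF assms] by auto

lemma eigenvals_real:
  assumes "M \<in> carrier_mat n n"
  shows "eigenvals M = proots (map_poly complex_of_real (char_poly M))"
  unfolding eigenvals_def by (simp add: of_real_hom.char_poly_hom[OF assms])

lemma complex_eigenvalue_iff:
  assumes "M \<in> carrier_mat n n"
  shows "complex_eigenvalue M z \<longleftrightarrow> z \<in># eigenvals M"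
proof -
  have c: "map_mat complex_of_real M \<in> carrier_mat n n" using assms by simp
  show ?thesis
    unfolding complex_eigenvalue_def eigenvals_def eigenvalue_root_char_poly[OF c]
    using char_poly_nonzero[OF c] by simp
qed

lemma eigenvalue_moduli_eigenvals: "eigenvalue_moduli M = image_mset cmod (eigenvals M)"
  unfolding eigenvalue_moduli_def eigenvals_def ..

lemma size_eigenvals:
  assumes "M \<in> carrier_mat n n" shows "size (eigenvals M) = n"
proof -
  have c: "map_mat complex_of_real M \<in> carrier_mat n n" using assms by simp
  show ?thesis unfolding eigenvals_def size_proots_complex using degree_monic_char_poly[OF c] by simp
qed

lemma cnj_eigenvals:
  assumes "M \<in> carrier_mat n n" and "z \<in># eigenvals M"
  shows "cnj z \<in># eigenvals M"
proof -
  have nz: "map_poly complex_of_real (char_poly M) \<noteq> 0"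
    using char_poly_nonzero[OF assms(1)] by simp
  have "poly (map_poly complex_of_real (char_poly M)) z = 0"
    using assms(2) nz unfolding eigenvals_real[OF assms(1)] by simp
  hence "cnj (poly (map_poly complex_of_real (char_poly M)) z) = 0" by simp
  hence "poly (map_poly complex_of_real (char_poly M)) (cnj z) = 0"
    using poly_cnj_real[of "map_poly complex_of_real (char_poly M)" z] by (simp add: coeff_map_poly)
  thus ?thesis using nz unfolding eigenvals_real[OF assms(1)] by simp
qed

lemma char_poly_block_upper:
  fixes B :: "'a :: idom mat"
  assumes "B \<in> carrier_mat p p" "X \<in> carrier_mat p q" "D \<in> carrier_mat q q"
  shows "char_poly (four_block_mat B X (0\<^sub>m q p) D) = char_poly B * char_poly D"
proof -
  have "char_poly_matrix (four_block_mat B X (0\<^sub>m q p) D)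
      = four_block_mat (char_poly_matrix B) (map_mat (\<lambda>a. [:- a:]) X) (0\<^sub>m q p) (char_poly_matrix D)"
    unfolding char_poly_matrix_def
    by (rule eq_matI, insert assms, auto simp: one_poly_def)
  thus ?thesis unfolding char_poly_def
    using det_four_block_mat_lower_left_zero[of "char_poly_matrix B" p "map_mat (\<lambda>a. [:- a:]) X" q
      "0\<^sub>m q p" "char_poly_matrix D"] assms by simp
qed

lemma eigenvals_block_upper:
  assumes "B \<in> carrier_mat p p" "X \<in> carrier_mat p q" "D \<in> carrier_mat q q"
  shows "eigenvals (four_block_mat B X (0\<^sub>m q p) D) = eigenvals B + eigenvals D"
proof -
  have F: "four_block_mat B X (0\<^sub>m q p) D \<in> carrier_mat (p+q) (p+q)"
    using four_block_carrier_mat[OF assms(1,3)] by auto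
  interpret map_poly_hom: map_poly_comm_ring_hom complex_of_real ..
  show ?thesis
    unfolding eigenvals_real[OF F] eigenvals_real[OF assms(1)] eigenvals_real[OF assms(3)]
      char_poly_block_upper[OF assms] map_poly_hom.hom_mult
    by (rule proots_mult) (insert char_poly_nonzero[OF assms(1)] char_poly_nonzero[OF assms(3)], auto)
qed

section \<open>Orthogonal matrices\<close>

definition orth :: "nat \<Rightarrow> real mat set" where
  "orth d = {Q \<in> carrier_mat d d. Q\<^sup>T * Q = 1\<^sub>m d}"

lemma orthD:
  assumes "Q \<in> orth d"
  shows "Q \<in> carrier_mat d d" "Q\<^sup>T \<in> carrier_mat d d" "Q\<^sup>T * Q = 1\<^sub>m d" "Q * Q\<^sup>T = 1\<^sub>m d"
proof -
  show a: "Q \<in> carrier_mat d d" "Q\<^sup>T * Q = 1\<^sub>m d" "Q\<^sup>T \<in> carrier_mat d d"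
    using assms unfolding orth_def by auto
  show "Q * Q\<^sup>T = 1\<^sub>m d" by (rule mat_mult_left_right_inverse[OF a(3,1,2)])
qed

lemma one_orth: "1\<^sub>m d \<in> orth d"
  unfolding orth_def by simp

lemma transpose_orth: "Q \<in> orth d \<Longrightarrow> Q\<^sup>T \<in> orth d"
  using orthD(2,4)[of Q d] by (simp add: orth_def)

lemma mult_orth:
  assumes "P \<in> orth d" "Q \<in> orth d" shows "P * Q \<in> orth d"
proof -
  note p = orthD[OF assms(1)] and q = orthD[OF assms(2)]
  have "(P * Q)\<^sup>T * (P * Q) = Q\<^sup>T * P\<^sup>T * (P * Q)"
    by (simp add: transpose_mult[OF p(1) q(1)])
  also have "\<dots> = Q\<^sup>T * (P\<^sup>T * P) * Q"
    using p(1,2) q(1,2) by (simp add: assoc_mult_mat[of _ d d _ d _ d])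
  also have "\<dots> = 1\<^sub>m d" using p q by simp
  finally show ?thesis using p q unfolding orth_def by simp
qed

lemma det_orth_nonzero: assumes "Q \<in> orth d" shows "det Q \<noteq> 0"
  using det_mult[OF orthD(2,1)[OF assms]] orthD(3)[OF assms] by auto

lemma conj_orth_cancel:
  assumes "Q \<in> orth d" and M: "M \<in> carrier_mat d d"
  shows "Q\<^sup>T * (Q * M) = M" "Q * (Q\<^sup>T * M) = M"
proof -
  note q = orthD[OF assms(1)]
  show "Q\<^sup>T * (Q * M) = M" "Q * (Q\<^sup>T * M) = M"
    using assoc_mult_mat[OF q(2,1) M] assoc_mult_mat[OF q(1,2) M] q M by simp_all
qed

lemma eigenvals_conj_orth:
  assumes Q: "Q \<in> orth d" and M: "M \<in> carrier_mat d d"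
  shows "eigenvals (Q\<^sup>T * M * Q) = eigenvals M"
proof -
  note q = orthD[OF Q]
  have "similar_mat (Q\<^sup>T * M * Q) M"
    by (rule similar_matI[of _ _ "Q\<^sup>T" Q d]) (use q M in auto)
  from char_poly_similar[OF this]
  have eq: "char_poly (Q\<^sup>T * M * Q) = char_poly M" .
  have "Q\<^sup>T * M * Q \<in> carrier_mat d d" using q M by auto
  from eigenvals_real[OF this] eigenvals_real[OF M] eq show ?thesis by simp
qed

lemma norm_mult_orth:
  assumes Q: "Q \<in> orth d" and v: "v \<in> carrier_vec d"
  shows "(Q *\<^sub>v v) \<bullet> (Q *\<^sub>v v) = v \<bullet> v"
proof -
  note q = orthD[OF Q]
  have "(Q *\<^sub>v v) \<bullet> (Q *\<^sub>v v) = (Q\<^sup>T *\<^sub>v (Q *\<^sub>v v)) \<bullet> v"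
    using transpose_vec_mult_scalar[OF q(1) v, of "Q *\<^sub>v v"] q v by auto
  also have "Q\<^sup>T *\<^sub>v (Q *\<^sub>v v) = v"
    using assoc_mult_mat_vec[OF q(2,1) v] q v by simp
  finally show ?thesis .
qed

lemma diag_block_orth:
  assumes "P \<in> orth p" "Q \<in> orth q"
  shows "four_block_mat P (0\<^sub>m p q) (0\<^sub>m q p) Q \<in> orth (p + q)"
proof -
  note P = orthD[OF assms(1)] and Q = orthD[OF assms(2)]
  have "(four_block_mat P (0\<^sub>m p q) (0\<^sub>m q p) Q)\<^sup>T = four_block_mat P\<^sup>T (0\<^sub>m p q) (0\<^sub>m q p) Q\<^sup>T"
    using transpose_four_block_mat[OF P(1) zero_carrier_mat zero_carrier_mat Q(1)] by simp
  thus ?thesis unfolding orth_def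
    using mult_four_block_mat[OF P(2) zero_carrier_mat zero_carrier_mat Q(2) P(1) zero_carrier_mat zero_carrier_mat Q(1)]
      P Q four_block_carrier_mat[OF P(1) Q(1)] by simp
qed

section \<open>QR decomposition and ordered real Schur form\<close>

lemma det_2x2:
  fixes M :: "'a :: comm_ring_1 mat"
  assumes M: "M \<in> carrier_mat 2 2"
  shows "det M = M $$ (0,0) * M $$ (1,1) - M $$ (0,1) * M $$ (1,0)"
proof -
  have "det M = (\<Sum>j<2. M $$ (0,j) * cofactor M 0 j)"
    by (rule laplace_expansion_row[OF M]) simp
  also have "\<dots> = M $$ (0,0) * det (mat_delete M 0 0) - M $$ (0,1) * det (mat_delete M 0 1)"
    by (simp add: cofactor_def numeral_2_eq_2)
  also have "det (mat_delete M 0 0) = M $$ (1,1)"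
    by (subst det_single) (use M in \<open>auto simp: mat_delete_def\<close>)
  also have "det (mat_delete M 0 1) = M $$ (1,0)"
    by (subst det_single) (use M in \<open>auto simp: mat_delete_def\<close>)
  finally show ?thesis .
qed

text \<open>The discriminant of \<open>z\<^sup>2 - tr z + dt\<close> decides: up to and including discriminant zero the roots are
  conjugate, hence both of modulus \<open>sqrt dt\<close>; from discriminant zero on they are real.\<close>

lemma eigenvals_2x2:
  assumes M: "M \<in> carrier_mat 2 2"
  defines "tr \<equiv> M $$ (0,0) + M $$ (1,1)"
  defines "dt \<equiv> M $$ (0,0) * M $$ (1,1) - M $$ (0,1) * M $$ (1,0)"
  shows "tr^2 \<le> 4 * dt \<Longrightarrow> eigenvals M
      = {#Complex (tr/2) (sqrt (4 * dt - tr^2) / 2), Complex (tr/2) (- sqrt (4 * dt - tr^2) / 2)#}" (is "_ \<Longrightarrow> ?A")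
    and "tr^2 \<ge> 4 * dt \<Longrightarrow> z \<in># eigenvals M \<Longrightarrow> z \<in> \<real>"
proof -
  have cp: "map_poly complex_of_real (char_poly M) = [:complex_of_real dt, - complex_of_real tr, 1:]"
  proof -
    have "char_poly M = [:dt, - tr, 1:]"
      unfolding char_poly_def char_poly_matrix_def
      by (subst det_2x2) (use M in \<open>auto simp: tr_def dt_def\<close>)
    thus ?thesis by simp
  qed
  have factor: "eigenvals M = {#a, b#}"
    if "a + b = complex_of_real tr" "a * b = complex_of_real dt" for a b
  proof -
    have "[:complex_of_real dt, - complex_of_real tr, 1:] = [:-a, 1:] * [:-b, 1:]"
      using that by (simp add: algebra_simps)
    thus ?thesis unfolding eigenvals_real[OF M] cp
      by (simp only: proots_mult pCons_eq_0_iff one_neq_zero simp_thms proots_linear_factor) simp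
  qed
  show ?A if "tr^2 \<le> 4 * dt"
    by (rule factor) (use that in \<open>auto simp: complex_eq_iff power2_eq_square field_simps\<close>)
  show "z \<in> \<real>" if "tr^2 \<ge> 4 * dt" "z \<in># eigenvals M"
  proof -
    define x y where "x = (tr + sqrt (tr^2 - 4 * dt))/2" and "y = (tr - sqrt (tr^2 - 4 * dt))/2"
    have "eigenvals M = {#complex_of_real x, complex_of_real y#}"
      by (rule factor) (use that in \<open>auto simp: x_def y_def complex_eq_iff power2_eq_square field_simps\<close>)
    thus ?thesis using that by auto
  qed
qed

lemma mult_block_upper:
  assumes "B \<in> carrier_mat p p" "X \<in> carrier_mat p q" "D \<in> carrier_mat q q"
    and "B' \<in> carrier_mat p p" "X' \<in> carrier_mat p q" "D' \<in> carrier_mat q q"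
  shows "four_block_mat B X (0\<^sub>m q p) D * four_block_mat B' X' (0\<^sub>m q p) D'
     = four_block_mat (B * B') (B * X' + X * D') (0\<^sub>m q p) (D * D')"
proof -
  have "B * B' + X * 0\<^sub>m q p = B * B'" "0\<^sub>m q p * B' + D * 0\<^sub>m q p = 0\<^sub>m q p"
     "0\<^sub>m q p * X' + D * D' = D * D'"
    using assms by simp_all
  thus ?thesis
    using mult_four_block_mat[OF assms(1,2) zero_carrier_mat assms(3,4,5) zero_carrier_mat assms(6)]
    by simp
qed

text \<open>The Householder reflection along \<open>u = v - |v| e\<^sub>0\<close> sends \<open>v\<close> to \<open>|v| e\<^sub>0\<close>.\<close>

lemma exists_orth_reflect_first:
  fixes v :: "real vec"
  assumes v: "v \<in> carrier_vec (Suc n)"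
  shows "\<exists>H \<in> orth (Suc n). \<forall>i. 0 < i \<and> i < Suc n \<longrightarrow> (H\<^sup>T *\<^sub>v v) $ i = 0"
proof -
  define N where "N = Suc n"
  have n0: "0 < N" and v: "v \<in> carrier_vec N" using v unfolding N_def by auto
  define s where "s = sqrt (\<Sum>i<N. (v $ i)^2)"
  define u where "u i = v $ i - (if i = 0 then s else 0)" for i
  define U where "U = (\<Sum>i<N. (u i)^2)"
  \<comment> \<open>division by zero gives \<open>c = 0\<close>, so \<open>H = 1\<close> in the degenerate case \<open>v = |v| e\<^sub>0\<close>\<close>
  define c where "c = 2 / U"
  define H where "H = mat N N (\<lambda>(i,j). (if i = j then 1 else 0) - c * u i * u j)"
  have ss: "s^2 = (\<Sum>i<N. (v $ i)^2)" unfolding s_def by (simp add: sum_nonneg)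
  have c2: "c * c * U = 2 * c" unfolding c_def by (simp add: field_simps)
  have "U = (\<Sum>i<N. (v $ i)^2 + (if i = 0 then s^2 - 2 * s * v $ i else 0))"
    unfolding U_def u_def by (rule sum.cong) (auto simp: power2_eq_square algebra_simps)
  also have "\<dots> = 2 * (s^2 - s * v $ 0)"
    unfolding sum.distrib using n0 by (simp add: ss sum.delta)
  finally have U: "U = 2 * (s^2 - s * v $ 0)" .
  have "(\<Sum>i<N. u i * v $ i) = (\<Sum>i<N. (v $ i)^2 - (if i = 0 then s * v $ i else 0))"
    unfolding u_def by (rule sum.cong) (auto simp: power2_eq_square algebra_simps)
  also have "\<dots> = s^2 - s * v $ 0"
    unfolding sum_subtractf using n0 by (simp add: ss sum.delta)
  finally have W: "(\<Sum>i<N. u i * v $ i) = U / 2" using U by simp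
  have Hc: "H \<in> carrier_mat N N" unfolding H_def by simp
  have HT: "H\<^sup>T = H" unfolding H_def by (rule eq_matI) (auto simp: ac_simps)
  have "H * H = 1\<^sub>m N"
  proof (rule eq_matI)
    fix i j assume ij: "i < dim_row (1\<^sub>m N :: real mat)" "j < dim_col (1\<^sub>m N :: real mat)"
    have "(H * H) $$ (i,j) = (\<Sum>k<N. H $$ (i,k) * H $$ (k,j))"
      using ij Hc by (simp add: scalar_prod_def lessThan_atLeast0)
    also have "\<dots> = (\<Sum>k<N. (if k = i then (if i = j then 1 else 0) - c * u i * u j else 0)
         + ((if k = j then - c * u i * u j else 0) + c * c * u i * u j * (u k)^2))"
      by (rule sum.cong) (use ij in \<open>auto simp: H_def algebra_simps power2_eq_square\<close>)
    also have "\<dots> = (if i = j then 1 else 0) - 2 * c * u i * u j + (c * c * U) * u i * u j"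
      unfolding sum.distrib sum_distrib_left[symmetric] U_def[symmetric]
      using ij by (simp add: algebra_simps)
    also have "\<dots> = 1\<^sub>m N $$ (i,j)" unfolding c2 using ij by simp
    finally show "(H * H) $$ (i,j) = 1\<^sub>m N $$ (i,j)" .
  qed (use Hc in auto)
  hence "H \<in> orth N" using Hc HT unfolding orth_def by simp
  moreover have "(H\<^sup>T *\<^sub>v v) $ i = 0" if i: "0 < i" "i < N" for i
  proof -
    have "(H\<^sup>T *\<^sub>v v) $ i = (\<Sum>k<N. H $$ (i,k) * v $ k)"
      unfolding HT using i v Hc by (simp add: scalar_prod_def lessThan_atLeast0)
    also have "\<dots> = (\<Sum>k<N. (if k = i then v $ i else 0) - c * u i * (u k * v $ k))"
      by (rule sum.cong) (use i in \<open>auto simp: H_def algebra_simps\<close>)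
    also have "\<dots> = v $ i - c * u i * (U / 2)"
      unfolding sum_subtractf sum_distrib_left[symmetric] W using i by simp
    also have "\<dots> = 0"
    proof (cases "U = 0")
      case True
      hence "\<forall>k\<in>{..<N}. (u k)^2 = 0"
        unfolding U_def by (subst (asm) sum_nonneg_eq_0_iff) auto
      hence "v $ i = 0" using i unfolding u_def by auto
      thus ?thesis using i by (simp add: u_def)
    next
      case False
      thus ?thesis using i unfolding c_def by (simp add: u_def)
    qed
    finally show ?thesis .
  qed
  ultimately show ?thesis unfolding N_def by blast
qed

text \<open>Equivalently, \<open>M\<close> preserves the span of the first \<open>p\<close> basis vectors.\<close>

definition block_upper :: "nat \<Rightarrow> nat \<Rightarrow> real mat \<Rightarrow> bool" where
  "block_upper p q M \<longleftrightarrow> (\<exists>B \<in> carrier_mat p p. \<exists>X \<in> carrier_mat p q. \<exists>D \<in> carrier_mat q q.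
     M = four_block_mat B X (0\<^sub>m q p) D)"

lemma block_upperI:
  assumes M: "M \<in> carrier_mat (p + q) (p + q)"
    and 0: "\<And>i j. i < q \<Longrightarrow> j < p \<Longrightarrow> M $$ (p + i, j) = 0"
  shows "block_upper p q M"
  unfolding block_upper_def
proof (intro bexI)
  have 0: "M $$ (i, j) = 0" if "p \<le> i" "i < p + q" "j < p" for i j
    using 0[of "i - p" j] that by simp
  show "M = four_block_mat (mat p p (\<lambda>(i,j). M $$ (i,j))) (mat p q (\<lambda>(i,j). M $$ (i,p+j)))
      (0\<^sub>m q p) (mat q q (\<lambda>(i,j). M $$ (p+i,p+j)))"
    by (rule eq_matI) (use M 0 in auto)
qed auto

lemma block_upperE:
  assumes "block_upper p q M"
  obtains B X D where "B \<in> carrier_mat p p" "X \<in> carrier_mat p q" "D \<in> carrier_mat q q"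
    "M = four_block_mat B X (0\<^sub>m q p) D"
  using assms unfolding block_upper_def by blast

lemma block_upper_four_block:
  "B \<in> carrier_mat p p \<Longrightarrow> X \<in> carrier_mat p q \<Longrightarrow> D \<in> carrier_mat q q \<Longrightarrow>
    block_upper p q (four_block_mat B X (0\<^sub>m q p) D)"
  unfolding block_upper_def by blast

lemma block_upper_mult:
  assumes "block_upper p q M" "block_upper p q N"
  shows "block_upper p q (M * N)"
proof -
  from assms(1) obtain B X D where M: "B \<in> carrier_mat p p" "X \<in> carrier_mat p q" "D \<in> carrier_mat q q"
    "M = four_block_mat B X (0\<^sub>m q p) D" by (rule block_upperE)
  from assms(2) obtain B' X' D' where N: "B' \<in> carrier_mat p p" "X' \<in> carrier_mat p q" "D' \<in> carrier_mat q q"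
    "N = four_block_mat B' X' (0\<^sub>m q p) D'" by (rule block_upperE)
  have "M * N = four_block_mat (B * B') (B * X' + X * D') (0\<^sub>m q p) (D * D')"
    unfolding M(4) N(4) by (rule mult_block_upper[OF M(1-3) N(1-3)])
  thus ?thesis unfolding block_upper_def using M N
    by (meson add_carrier_mat mult_carrier_mat)
qed

lemma mult_mat_vec_index_sum:
  assumes "M \<in> carrier_mat n m" "v \<in> carrier_vec m" "i < n"
  shows "(M *\<^sub>v v) $ i = (\<Sum>k<m. M $$ (i,k) * v $ k)"
  using assms by (simp add: scalar_prod_def lessThan_atLeast0)

text \<open>Induction on the dimension: a reflection clears the first column, and the induction hypothesis
  treats the remaining corner.\<close>

lemma qr_decomposition:
  assumes "A \<in> carrier_mat n n"
  shows "\<exists>Q \<in> orth n. upper_triangular (Q\<^sup>T * A)"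
  using assms
proof (induction n arbitrary: A)
  case 0
  show ?case by (rule bexI[OF _ one_orth]) (use 0 in auto)
next
  case (Suc n)
  obtain H where H: "H \<in> orth (Suc n)" and
    H0: "\<And>i. 0 < i \<Longrightarrow> i < Suc n \<Longrightarrow> (H\<^sup>T *\<^sub>v col A 0) $ i = 0"
    using exists_orth_reflect_first[of "col A 0" n] Suc.prems by (metis carrier_matD(1) col_dim)
  note h = orthD[OF H]
  have "block_upper 1 n (H\<^sup>T * A)"
  proof (rule block_upperI)
    show "H\<^sup>T * A \<in> carrier_mat (1 + n) (1 + n)" using h Suc.prems by auto
    show "(H\<^sup>T * A) $$ (1 + i, j) = 0" if "i < n" "j < 1" for i j
      using H0[of "1 + i"] that h Suc.prems by auto
  qed
  then obtain B X D where D: "B \<in> carrier_mat 1 1" "X \<in> carrier_mat 1 n" "D \<in> carrier_mat n n"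
    "H\<^sup>T * A = four_block_mat B X (0\<^sub>m n 1) D" by (rule block_upperE)
  from Suc.IH[OF D(3)] obtain Q where Q: "Q \<in> orth n" and ut: "upper_triangular (Q\<^sup>T * D)" by blast
  define E where "E = four_block_mat (1\<^sub>m 1) (0\<^sub>m 1 n) (0\<^sub>m n 1) Q"
  have E: "E \<in> orth (Suc n)" using diag_block_orth[OF one_orth[of 1] Q] unfolding E_def by simp
  note e = orthD[OF E] and q = orthD[OF Q]
  have ET: "E\<^sup>T = four_block_mat (1\<^sub>m 1) (0\<^sub>m 1 n) (0\<^sub>m n 1) Q\<^sup>T"
    unfolding E_def using transpose_four_block_mat[OF one_carrier_mat zero_carrier_mat zero_carrier_mat q(1)] by simp
  have "(H * E)\<^sup>T * A = E\<^sup>T * (H\<^sup>T * A)"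
    unfolding transpose_mult[OF h(1) e(1)] by (rule assoc_mult_mat[OF e(2) h(2) Suc.prems])
  also have "\<dots> = four_block_mat (1\<^sub>m 1 * B) (1\<^sub>m 1 * X + 0\<^sub>m 1 n * D) (0\<^sub>m n 1) (Q\<^sup>T * D)"
    unfolding ET D(4) by (rule mult_block_upper) (use D q in auto)
  finally have "upper_triangular ((H * E)\<^sup>T * A)"
    using upper_triangular_four_block[of "1\<^sub>m 1 * B" 1 "Q\<^sup>T * D" n] D q ut
    by (simp add: upper_triangular_def)
  thus ?case using mult_orth[OF H E] by blast
qed

lemma upper_triangular_block_upper:
  assumes M: "M \<in> carrier_mat (p + q) (p + q)" and "upper_triangular M"
  shows "block_upper p q M"
  by (rule block_upperI[OF M]) (use assms upper_triangularD in auto)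


lemma scalar_prod_self_zero:
  fixes v :: "real vec"
  assumes v: "v \<in> carrier_vec d" and 0: "v \<bullet> v = 0"
  shows "v = 0\<^sub>v d"
proof (rule eq_vecI)
  fix i assume i: "i < dim_vec (0\<^sub>v d :: real vec)"
  have "(\<Sum>k = 0..<d. (v $ k)^2) = 0" using 0 v by (simp add: scalar_prod_def power2_eq_square)
  hence "\<forall>k\<in>{0..<d}. (v $ k)^2 = 0" by (subst (asm) sum_nonneg_eq_0_iff) auto
  thus "v $ i = 0\<^sub>v d $ i" using i by simp
qed (use v in auto)

text \<open>The real and imaginary parts of a complex eigenvector span an invariant real line or plane, on
  which \<open>M\<close> acts as multiplication by \<open>z\<close> does on the complex plane.\<close>

lemma complex_eigenvector_parts:
  assumes M: "M \<in> carrier_mat d d" and l: "z \<in># eigenvals M"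
  obtains x y where "x \<in> carrier_vec d" "y \<in> carrier_vec d" "x \<noteq> 0\<^sub>v d \<or> y \<noteq> 0\<^sub>v d"
    "M *\<^sub>v x = Re z \<cdot>\<^sub>v x - Im z \<cdot>\<^sub>v y" "M *\<^sub>v y = Im z \<cdot>\<^sub>v x + Re z \<cdot>\<^sub>v y"
proof -
  let ?M = "map_mat complex_of_real M"
  have c: "?M \<in> carrier_mat d d" using M by simp
  have "eigenvalue ?M z" using l complex_eigenvalue_iff[OF M] unfolding complex_eigenvalue_def by simp
  then obtain w where w: "w \<in> carrier_vec d" "w \<noteq> 0\<^sub>v d" "?M *\<^sub>v w = z \<cdot>\<^sub>v w"
    unfolding eigenvalue_def eigenvector_def using c by auto
  define x where "x = map_vec Re w"
  define y where "y = map_vec Im w"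
  have xy: "x \<in> carrier_vec d" "y \<in> carrier_vec d" unfolding x_def y_def using w by auto
  have row: "(\<Sum>k<d. complex_of_real (M $$ (i,k)) * w $ k) = z * w $ i" if i: "i < d" for i
    using arg_cong[OF w(3), of "\<lambda>v. v $ i"] mult_mat_vec_index_sum[OF c w(1) i] w(1) i M by simp
  show thesis
  proof (rule that[OF xy])
    show "x \<noteq> 0\<^sub>v d \<or> y \<noteq> 0\<^sub>v d"
    proof (rule ccontr)
      assume "\<not> ?thesis"
      hence 0: "x = 0\<^sub>v d" "y = 0\<^sub>v d" by auto
      have "w = 0\<^sub>v d"
      proof (rule eq_vecI)
        fix i assume i: "i < dim_vec (0\<^sub>v d :: complex vec)"
        have "Re (w $ i) = 0" "Im (w $ i) = 0"
          using arg_cong[OF 0(1), of "\<lambda>v. v $ i"] arg_cong[OF 0(2), of "\<lambda>v. v $ i"] i w(1)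
          unfolding x_def y_def by auto
        thus "w $ i = 0\<^sub>v d $ i" using i by (simp add: complex_eq_iff)
      qed (use w in auto)
      with w(2) show False by simp
    qed
    show "M *\<^sub>v x = Re z \<cdot>\<^sub>v x - Im z \<cdot>\<^sub>v y"
    proof (rule eq_vecI)
      fix i assume "i < dim_vec (Re z \<cdot>\<^sub>v x - Im z \<cdot>\<^sub>v y)"
      hence i: "i < d" using xy by simp
      show "(M *\<^sub>v x) $ i = (Re z \<cdot>\<^sub>v x - Im z \<cdot>\<^sub>v y) $ i"
        using arg_cong[OF row[OF i], of Re] i w(1) xy
        unfolding mult_mat_vec_index_sum[OF M xy(1) i] by (simp add: x_def y_def)
    qed (use M xy in auto)
    show "M *\<^sub>v y = Im z \<cdot>\<^sub>v x + Re z \<cdot>\<^sub>v y"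
    proof (rule eq_vecI)
      fix i assume "i < dim_vec (Im z \<cdot>\<^sub>v x + Re z \<cdot>\<^sub>v y)"
      hence i: "i < d" using xy by simp
      show "(M *\<^sub>v y) $ i = (Im z \<cdot>\<^sub>v x + Re z \<cdot>\<^sub>v y) $ i"
        using arg_cong[OF row[OF i], of Im] i w(1) xy
        unfolding mult_mat_vec_index_sum[OF M xy(2) i] by (simp add: x_def y_def)
    qed (use M xy in auto)
  qed
qed

lemma conj_orth_vec:
  assumes Q: "Q \<in> orth d" and M: "M \<in> carrier_mat d d" and x: "x \<in> carrier_vec d"
  shows "(Q\<^sup>T * M * Q) *\<^sub>v (Q\<^sup>T *\<^sub>v x) = Q\<^sup>T *\<^sub>v (M *\<^sub>v x)"
proof -
  note q = orthD[OF Q]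
  have Mx: "M *\<^sub>v x \<in> carrier_vec d" and Qx: "Q\<^sup>T *\<^sub>v x \<in> carrier_vec d" using M q x by auto
  have "(Q\<^sup>T * M * Q) *\<^sub>v (Q\<^sup>T *\<^sub>v x) = (Q\<^sup>T * M) *\<^sub>v (Q *\<^sub>v (Q\<^sup>T *\<^sub>v x))"
    by (rule assoc_mult_mat_vec) (use q M Qx in auto)
  also have "Q *\<^sub>v (Q\<^sup>T *\<^sub>v x) = x"
    using assoc_mult_mat_vec[OF q(1,2) x] q x by simp
  also have "(Q\<^sup>T * M) *\<^sub>v x = Q\<^sup>T *\<^sub>v (M *\<^sub>v x)"
    by (rule assoc_mult_mat_vec[OF q(2) M x])
  finally show ?thesis .
qed

text \<open>A reflection moves a real eigenvector to the first axis.\<close>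

lemma split_real_eigenvalue:
  assumes M: "M \<in> carrier_mat d d" and l: "z \<in># eigenvals M" and real: "Im z = 0"
  obtains Q B X D n where "d = 1 + n" "Q \<in> orth d" "Q\<^sup>T * M * Q = four_block_mat B X (0\<^sub>m n 1) D"
    "B \<in> carrier_mat 1 1" "X \<in> carrier_mat 1 n" "D \<in> carrier_mat n n" "eigenvals B = {#z#}"
proof -
  obtain x0 y0 where "x0 \<in> carrier_vec d" "y0 \<in> carrier_vec d" "x0 \<noteq> 0\<^sub>v d \<or> y0 \<noteq> 0\<^sub>v d"
    "M *\<^sub>v x0 = Re z \<cdot>\<^sub>v x0 - Im z \<cdot>\<^sub>v y0" "M *\<^sub>v y0 = Im z \<cdot>\<^sub>v x0 + Re z \<cdot>\<^sub>v y0"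
    by (rule complex_eigenvector_parts[OF M l])
  moreover from this real have "M *\<^sub>v x0 = Re z \<cdot>\<^sub>v x0" "M *\<^sub>v y0 = Re z \<cdot>\<^sub>v y0"
    by (auto intro!: eq_vecI)
  ultimately obtain x where x: "x \<in> carrier_vec d" "x \<noteq> 0\<^sub>v d" "M *\<^sub>v x = Re z \<cdot>\<^sub>v x" by blast
  then obtain n where d: "d = Suc n" by (cases d) auto
  obtain Q where Q: "Q \<in> orth d" and zr: "\<And>i. 0 < i \<Longrightarrow> i < d \<Longrightarrow> (Q\<^sup>T *\<^sub>v x) $ i = 0"
    using exists_orth_reflect_first[of x n] x unfolding d by blast
  note q = orthD[OF Q]
  define r where "r = Q\<^sup>T *\<^sub>v x"
  define G where "G = Q\<^sup>T * M * Q"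
  have r: "r \<in> carrier_vec d" and G: "G \<in> carrier_mat d d" unfolding r_def G_def using q x M by auto
  have r0: "r $ 0 \<noteq> 0"
  proof
    assume "r $ 0 = 0"
    hence "r = 0\<^sub>v d" using r zr unfolding r_def[symmetric]
      by (intro eq_vecI) (auto, metis gr0I)
    hence "r \<bullet> r = 0" by simp
    moreover have "r \<bullet> r = x \<bullet> x" unfolding r_def by (rule norm_mult_orth[OF transpose_orth[OF Q] x(1)])
    ultimately show False using x scalar_prod_self_zero[OF x(1)] by simp
  qed
  have Gr: "G *\<^sub>v r = Re z \<cdot>\<^sub>v r"
    unfolding G_def r_def conj_orth_vec[OF Q M x(1)] x(3) using q x by (simp add: mult_mat_vec)
  have col: "G $$ (i,0) * r $ 0 = Re z * r $ i" if i: "i < d" for i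
  proof -
    have "(G *\<^sub>v r) $ i = (\<Sum>k<d. G $$ (i,k) * r $ k)" by (rule mult_mat_vec_index_sum[OF G r i])
    also have "\<dots> = (\<Sum>k<d. if k = 0 then G $$ (i,0) * r $ 0 else 0)"
      by (rule sum.cong) (use zr in \<open>auto simp: r_def\<close>)
    also have "\<dots> = G $$ (i,0) * r $ 0" using d by simp
    finally show ?thesis using Gr i r by simp
  qed
  have "block_upper 1 n G"
  proof (rule block_upperI)
    show "G \<in> carrier_mat (1 + n) (1 + n)" using G d by simp
    show "G $$ (1 + i, j) = 0" if "i < n" "j < 1" for i j
      using col[of "1 + i"] zr[of "1 + i"] that d r0 unfolding r_def[symmetric] by simp
  qed
  then obtain B X D where D: "B \<in> carrier_mat 1 1" "X \<in> carrier_mat 1 n" "D \<in> carrier_mat n n"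
    "G = four_block_mat B X (0\<^sub>m n 1) D" by (rule block_upperE)
  have "B $$ (0,0) = Re z" using col[of 0] r0 d D by simp
  moreover have "char_poly B = [: - B $$ (0,0), 1:]"
    unfolding char_poly_def by (subst det_single) (use D in \<open>auto simp: char_poly_matrix_def\<close>)
  ultimately have "eigenvals B = {#z#}"
    unfolding eigenvals_real[OF D(1)] using real by (simp add: complex_eq_iff)
  thus thesis using that[of n Q B X D] D Q d unfolding G_def by simp
qed

text \<open>The QR decomposition of the matrix with columns \<open>x, y, 0, \<dots>, 0\<close> rotates the invariant plane spanned by
  the real and imaginary parts \<open>x, y\<close> of an eigenvector to the first coordinate plane.  Trace and
  determinant of the corner block are then \<open>2 Re z\<close> and \<open>|z|\<^sup>2\<close>.\<close>

lemma split_nonreal_eigenvalue: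
  assumes M: "M \<in> carrier_mat d d" and z: "z \<in># eigenvals M" and nonreal: "Im z \<noteq> 0"
  obtains Q B X D n where "d = 2 + n" "Q \<in> orth d" "Q\<^sup>T * M * Q = four_block_mat B X (0\<^sub>m n 2) D"
    "B \<in> carrier_mat 2 2" "X \<in> carrier_mat 2 n" "D \<in> carrier_mat n n" "set_mset (eigenvals B) \<subseteq> {z, cnj z}"
proof -
  define a b where "a = Re z" and "b = Im z"
  have b: "b \<noteq> 0" using nonreal unfolding b_def .
  obtain x y where xy: "x \<in> carrier_vec d" "y \<in> carrier_vec d" "x \<noteq> 0\<^sub>v d \<or> y \<noteq> 0\<^sub>v d"
    and Mx: "M *\<^sub>v x = a \<cdot>\<^sub>v x - b \<cdot>\<^sub>v y" and My: "M *\<^sub>v y = b \<cdot>\<^sub>v x + a \<cdot>\<^sub>v y"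
    unfolding a_def b_def by (rule complex_eigenvector_parts[OF M z])
  have "z \<noteq> cnj z" using nonreal by (simp add: complex_eq_iff)
  have "{#z, cnj z#} \<subseteq># eigenvals M"
    using z cnj_eigenvals[OF M z] \<open>z \<noteq> cnj z\<close>
    by (intro mset_subset_eqI) (auto simp: Suc_le_eq)
  from size_mset_mono[OF this] have "2 \<le> d" unfolding size_eigenvals[OF M] by simp
  then obtain n where d: "d = 2 + n" by (metis le_Suc_ex)
  define N where "N = mat d d (\<lambda>(i,j). if j = 0 then x $ i else if j = 1 then y $ i else 0)"
  have N: "N \<in> carrier_mat d d" unfolding N_def by simp
  obtain Q where Q: "Q \<in> orth d" and ut: "upper_triangular (Q\<^sup>T * N)" using qr_decomposition[OF N] by blast
  note q = orthD[OF Q]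
  define r where "r = Q\<^sup>T *\<^sub>v x"
  define r' where "r' = Q\<^sup>T *\<^sub>v y"
  define G where "G = Q\<^sup>T * M * Q"
  have r: "r \<in> carrier_vec d" and r': "r' \<in> carrier_vec d" and G: "G \<in> carrier_mat d d"
    unfolding r_def r'_def G_def using q xy M by auto
  have cN: "col N 0 = x" "col N 1 = y" unfolding N_def using xy d by (auto intro!: eq_vecI)
  have rN: "r $ i = (Q\<^sup>T * N) $$ (i,0)" "r' $ i = (Q\<^sup>T * N) $$ (i,1)" if "i < d" for i
    using that q N d unfolding r_def r'_def cN[symmetric] by auto
  have rz: "r $ i = 0" if "0 < i" "i < d" for i
    using upper_triangularD[OF ut, of 0 i] that rN q by simp
  have rz': "r' $ i = 0" if "1 < i" "i < d" for i
    using upper_triangularD[OF ut, of 1 i] that rN q by simp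
  have Gr: "G *\<^sub>v r = a \<cdot>\<^sub>v r - b \<cdot>\<^sub>v r'"
    unfolding G_def r_def r'_def conj_orth_vec[OF Q M xy(1)] Mx using q xy
    by (simp add: mult_minus_distrib_mat_vec[of _ d d] mult_mat_vec[of _ d d])
  have Gr': "G *\<^sub>v r' = b \<cdot>\<^sub>v r + a \<cdot>\<^sub>v r'"
    unfolding G_def r_def r'_def conj_orth_vec[OF Q M xy(2)] My using q xy
    by (simp add: mult_add_distrib_mat_vec[of _ d d] mult_mat_vec[of _ d d])
  have col: "G $$ (i,0) * r $ 0 = a * r $ i - b * r' $ i" if i: "i < d" for i
  proof -
    have "(G *\<^sub>v r) $ i = (\<Sum>k<d. G $$ (i,k) * r $ k)" by (rule mult_mat_vec_index_sum[OF G r i])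
    also have "\<dots> = (\<Sum>k<d. if k = 0 then G $$ (i,0) * r $ 0 else 0)"
      by (rule sum.cong) (use rz in auto)
    also have "\<dots> = G $$ (i,0) * r $ 0" using d by simp
    finally show ?thesis using Gr i r r' by simp
  qed
  have col': "G $$ (i,0) * r' $ 0 + G $$ (i,1) * r' $ 1 = b * r $ i + a * r' $ i" if i: "i < d" for i
  proof -
    have "(G *\<^sub>v r') $ i = (\<Sum>k<d. G $$ (i,k) * r' $ k)" by (rule mult_mat_vec_index_sum[OF G r' i])
    also have "\<dots> = (\<Sum>k<d. (if k = 0 then G $$ (i,0) * r' $ 0 else 0) + (if k = 1 then G $$ (i,1) * r' $ 1 else 0))"
    proof (rule sum.cong)
      fix k assume "k \<in> {..<d}"
      thus "G $$ (i,k) * r' $ k = (if k = 0 then G $$ (i,0) * r' $ 0 else 0) + (if k = 1 then G $$ (i,1) * r' $ 1 else 0)"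
        using rz'[of k] by (cases "k = 0"; cases "k = 1") auto
    qed simp
    also have "\<dots> = G $$ (i,0) * r' $ 0 + G $$ (i,1) * r' $ 1" unfolding sum.distrib using d by simp
    finally show ?thesis using Gr' i r r' by simp
  qed
  have r1: "r $ 1 = 0" using rz[of 1] d by simp
  have r0: "r $ 0 \<noteq> 0"
  proof
    assume 0: "r $ 0 = 0"
    have "r $ i = 0" if "i < d" for i using rz[of i] 0 that by (cases "i = 0") auto
    moreover from this have "r' $ i = 0" if "i < d" for i using col[OF that] b that d by simp
    ultimately have "r = 0\<^sub>v d" "r' = 0\<^sub>v d" using r r' by auto
    hence "x \<bullet> x = 0" "y \<bullet> y = 0"
      using norm_mult_orth[OF transpose_orth[OF Q] xy(1)] norm_mult_orth[OF transpose_orth[OF Q] xy(2)]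
      unfolding r_def r'_def by auto
    thus False using xy scalar_prod_self_zero by blast
  qed
  have r'1: "r' $ 1 \<noteq> 0"
  proof
    assume 0: "r' $ 1 = 0"
    define c where "c = r' $ 0 / r $ 0"
    have c: "r' $ 0 = c * r $ 0" unfolding c_def using r0 by simp
    have "G $$ (0,0) * r $ 0 = (a - b * c) * r $ 0" using col[of 0] d c by (simp add: algebra_simps)
    hence g: "G $$ (0,0) = a - b * c" using r0 by simp
    have "G $$ (0,0) * c * r $ 0 = (b + a * c) * r $ 0" using col'[of 0] d c 0 by (simp add: algebra_simps)
    hence "G $$ (0,0) * c = b + a * c" using r0 by simp
    hence "b * (1 + c * c) = 0" unfolding g by (simp add: algebra_simps)
    moreover have "1 + c * c > 0" by (simp add: add_pos_nonneg)
    ultimately show False using b by simp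
  qed
  have G0: "G $$ (i,0) = 0" if "2 \<le> i" "i < d" for i
    using col[of i] rz[of i] rz'[of i] that r0 by simp
  have G1: "G $$ (i,1) = 0" if "2 \<le> i" "i < d" for i
    using col'[of i] G0[of i] rz[of i] rz'[of i] that r'1 by simp
  have "block_upper 2 n G"
  proof (rule block_upperI)
    show "G \<in> carrier_mat (2 + n) (2 + n)" using G d by simp
    show "G $$ (2 + i, j) = 0" if "i < n" "j < 2" for i j
      using G0[of "2 + i"] G1[of "2 + i"] less_2_cases[OF that(2)] that d by auto
  qed
  then obtain B X D where D: "B \<in> carrier_mat 2 2" "X \<in> carrier_mat 2 n" "D \<in> carrier_mat n n"
    "G = four_block_mat B X (0\<^sub>m n 2) D" by (rule block_upperE)
  have BG: "B $$ (i,j) = G $$ (i,j)" if "i < 2" "j < 2" for i j using that D by simp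
  define c e where "c = r' $ 0 / r $ 0" and "e = r' $ 1 / r $ 0"
  have ce: "r' $ 0 = c * r $ 0" "r' $ 1 = e * r $ 0" "e \<noteq> 0" unfolding c_def e_def using r0 r'1 by auto
  have "G $$ (0,0) * r $ 0 = (a - b * c) * r $ 0" using col[of 0] d ce by (simp add: algebra_simps)
  hence g00: "G $$ (0,0) = a - b * c" using r0 by simp
  have "G $$ (1,0) * r $ 0 = (- b * e) * r $ 0" using col[of 1] d ce r1 by (simp add: algebra_simps)
  hence g10: "G $$ (1,0) = - b * e" by (simp only: mult_right_cancel[OF r0])
  have "(G $$ (0,0) * c + G $$ (0,1) * e) * r $ 0 = (b + a * c) * r $ 0"
    using col'[of 0] d ce by (simp add: algebra_simps)
  hence "G $$ (0,0) * c + G $$ (0,1) * e = b + a * c" using r0 by simp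
  hence g01: "G $$ (0,1) * e = b + b * c * c" unfolding g00 by (simp add: algebra_simps)
  have "(G $$ (1,0) * c + G $$ (1,1) * e) * r $ 0 = a * e * r $ 0"
    using col'[of 1] d ce r1 by (simp add: algebra_simps)
  hence "G $$ (1,0) * c + G $$ (1,1) * e = a * e" using r0 by simp
  hence "(G $$ (1,1) - (a + b * c)) * e = 0" unfolding g10 by (simp add: algebra_simps)
  hence g11: "G $$ (1,1) = a + b * c" using ce by simp
  have tr: "B $$ (0,0) + B $$ (1,1) = 2 * a" using g00 g11 BG by simp
  have "G $$ (0,1) * G $$ (1,0) = - b * (G $$ (0,1) * e)" unfolding g10 by simp
  hence gg: "G $$ (0,1) * G $$ (1,0) = - b * (b + b * c * c)" unfolding g01 .
  have "B $$ (0,0) * B $$ (1,1) - B $$ (0,1) * B $$ (1,0)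
      = G $$ (0,0) * G $$ (1,1) - G $$ (0,1) * G $$ (1,0)" by (simp add: BG)
  also have "\<dots> = a^2 + b^2" unfolding gg unfolding g00 g11 by (simp add: power2_eq_square algebra_simps)
  finally have dt: "B $$ (0,0) * B $$ (1,1) - B $$ (0,1) * B $$ (1,0) = a^2 + b^2" .
  have sq: "sqrt (4 * (a^2 + b^2) - (2 * a)^2) = 2 * \<bar>b\<bar>"
    by (simp add: power_mult_distrib real_sqrt_mult)
  have "eigenvals B = {#Complex a \<bar>b\<bar>, Complex a (- \<bar>b\<bar>)#}"
    using eigenvals_2x2(1)[OF D(1)] unfolding tr dt sq by (simp add: power_mult_distrib)
  hence "set_mset (eigenvals B) \<subseteq> {z, cnj z}" unfolding a_def b_def by (auto simp: complex_eq_iff abs_if)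
  thus thesis using that[of n Q B X D] D Q d unfolding G_def by simp
qed

text \<open>The same matrix read with the middle block attached to the first instead of the last block.\<close>

lemma regroup_block_upper:
  fixes B :: "'a :: zero mat"
  assumes "B \<in> carrier_mat p p" "X \<in> carrier_mat p (p' + q)"
    "B' \<in> carrier_mat p' p'" "X' \<in> carrier_mat p' q" "D \<in> carrier_mat q q"
  shows "four_block_mat B X (0\<^sub>m (p' + q) p) (four_block_mat B' X' (0\<^sub>m q p') D)
    = four_block_mat (four_block_mat B (mat p p' (\<lambda>(i,j). X $$ (i,j))) (0\<^sub>m p' p) B')
        (mat (p + p') q (\<lambda>(i,j). if i < p then X $$ (i, p' + j) else X' $$ (i - p, j))) (0\<^sub>m q (p + p')) D"
  by (rule eq_matI) (use assms in auto)

text \<open>The eigenvalues with property \<open>P\<close> can be split off one real line or plane at a time; closure under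
  conjugation is what allows a whole plane to be split off at once.\<close>

lemma ordered_schur:
  assumes cnj: "\<And>z. P z \<Longrightarrow> P (cnj z)" and M: "M \<in> carrier_mat d d"
  shows "\<exists>p q Q B X D. d = p + q \<and> Q \<in> orth d \<and> Q\<^sup>T * M * Q = four_block_mat B X (0\<^sub>m q p) D \<and>
    B \<in> carrier_mat p p \<and> X \<in> carrier_mat p q \<and> D \<in> carrier_mat q q \<and>
    (\<forall>z \<in># eigenvals B. P z) \<and> (\<forall>z \<in># eigenvals D. \<not> P z)"
  using M
proof (induction d arbitrary: M rule: less_induct)
  case (less d)
  note M = less.prems
  show ?case
  proof (cases "\<exists>z \<in># eigenvals M. P z")
    case False
    have z: "eigenvals (0\<^sub>m 0 0) = {#}" using size_eigenvals[of "0\<^sub>m 0 0" 0] by simp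
    have "M = four_block_mat (0\<^sub>m 0 0) (0\<^sub>m 0 d) (0\<^sub>m d 0) M"
      by (rule eq_matI) (use M in auto)
    moreover have "(1\<^sub>m d)\<^sup>T * M * 1\<^sub>m d = M" using M by simp
    ultimately have "(1\<^sub>m d)\<^sup>T * M * 1\<^sub>m d = four_block_mat (0\<^sub>m 0 0) (0\<^sub>m 0 d) (0\<^sub>m d 0) M" by metis
    note eq = this
    show ?thesis
      by (rule exI[of _ 0], rule exI[of _ d], rule exI[of _ "1\<^sub>m d"], rule exI[of _ "0\<^sub>m 0 0"],
          rule exI[of _ "0\<^sub>m 0 d"], rule exI[of _ M])
        (intro conjI eq one_orth, use False M z in auto)
  next
    case True
    then obtain z where z: "z \<in># eigenvals M" "P z" by blast
    have "\<exists>p n Q B X D. 0 < p \<and> d = p + n \<and> Q \<in> orth d \<and> Q\<^sup>T * M * Q = four_block_mat B X (0\<^sub>m n p) D \<and>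
      B \<in> carrier_mat p p \<and> X \<in> carrier_mat p n \<and> D \<in> carrier_mat n n \<and> set_mset (eigenvals B) \<subseteq> {z, cnj z}"
    proof (cases "Im z = 0")
      case True
      obtain Q B X D n where *: "d = 1 + n" "Q \<in> orth d" "Q\<^sup>T * M * Q = four_block_mat B X (0\<^sub>m n 1) D"
        "B \<in> carrier_mat 1 1" "X \<in> carrier_mat 1 n" "D \<in> carrier_mat n n" "eigenvals B = {#z#}"
        by (rule split_real_eigenvalue[OF M z(1) True])
      show ?thesis
        by (rule exI[of _ 1], rule exI[of _ n], rule exI[of _ Q], rule exI[of _ B], rule exI[of _ X], rule exI[of _ D])
          (intro conjI *, simp_all add: *(7))
    next
      case False
      obtain Q B X D n where *: "d = 2 + n" "Q \<in> orth d" "Q\<^sup>T * M * Q = four_block_mat B X (0\<^sub>m n 2) D"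
        "B \<in> carrier_mat 2 2" "X \<in> carrier_mat 2 n" "D \<in> carrier_mat n n" "set_mset (eigenvals B) \<subseteq> {z, cnj z}"
        by (rule split_nonreal_eigenvalue[OF M z(1) False])
      show ?thesis
        by (rule exI[of _ 2], rule exI[of _ n], rule exI[of _ Q], rule exI[of _ B], rule exI[of _ X], rule exI[of _ D])
          (intro conjI *, simp)
    qed
    then obtain p n Q B X D where p: "0 < p" "d = p + n" and Q: "Q \<in> orth d"
      and QMQ: "Q\<^sup>T * M * Q = four_block_mat B X (0\<^sub>m n p) D"
      and c: "B \<in> carrier_mat p p" "X \<in> carrier_mat p n" "D \<in> carrier_mat n n"
      and rB: "set_mset (eigenvals B) \<subseteq> {z, cnj z}" by blast
    from less.IH[of n D] p c obtain p' q Q' B' X' D' where n: "n = p' + q" and Q': "Q' \<in> orth n"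
      and QDQ: "Q'\<^sup>T * D * Q' = four_block_mat B' X' (0\<^sub>m q p') D'"
      and c': "B' \<in> carrier_mat p' p'" "X' \<in> carrier_mat p' q" "D' \<in> carrier_mat q q"
      and rB': "\<forall>z \<in># eigenvals B'. P z" and rD': "\<forall>z \<in># eigenvals D'. \<not> P z" by auto
    define E where "E = four_block_mat (1\<^sub>m p) (0\<^sub>m p n) (0\<^sub>m n p) Q'"
    have E: "E \<in> orth d" unfolding E_def p(2) by (rule diag_block_orth[OF one_orth Q'])
    note q = orthD[OF Q] and e = orthD[OF E] and q' = orthD[OF Q']
    have ET: "E\<^sup>T = four_block_mat (1\<^sub>m p) (0\<^sub>m p n) (0\<^sub>m n p) Q'\<^sup>T"
      unfolding E_def using transpose_four_block_mat[OF one_carrier_mat zero_carrier_mat zero_carrier_mat q'(1)] by simp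
    have "(Q * E)\<^sup>T * M * (Q * E) = E\<^sup>T * (Q\<^sup>T * M * Q) * E"
      unfolding transpose_mult[OF q(1) e(1)] using q e M
      by (simp add: assoc_mult_mat[of _ d d _ d _ d])
    also have "E\<^sup>T * (Q\<^sup>T * M * Q) = four_block_mat (1\<^sub>m p * B) (1\<^sub>m p * X + 0\<^sub>m p n * D) (0\<^sub>m n p) (Q'\<^sup>T * D)"
      unfolding ET QMQ by (rule mult_block_upper) (use c q' in auto)
    also have "\<dots> = four_block_mat B X (0\<^sub>m n p) (Q'\<^sup>T * D)" using c by simp
    also have "\<dots> * E = four_block_mat (B * 1\<^sub>m p) (B * 0\<^sub>m p n + X * Q') (0\<^sub>m n p) (Q'\<^sup>T * D * Q')"
      unfolding E_def by (rule mult_block_upper) (use c q' in auto)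
    also have "\<dots> = four_block_mat B (X * Q') (0\<^sub>m n p) (four_block_mat B' X' (0\<^sub>m q p') D')"
      using c q' unfolding QDQ by simp
    finally have eq: "(Q * E)\<^sup>T * M * (Q * E) = four_block_mat B (X * Q') (0\<^sub>m n p) (four_block_mat B' X' (0\<^sub>m q p') D')" .
    define B2 where "B2 = four_block_mat B (mat p p' (\<lambda>(i,j). (X * Q') $$ (i,j))) (0\<^sub>m p' p) B'"
    define X2 where "X2 = mat (p + p') q (\<lambda>(i,j). if i < p then (X * Q') $$ (i, p' + j) else X' $$ (i - p, j))"
    have XQ: "X * Q' \<in> carrier_mat p (p' + q)" using c q' n by simp
    have eq2: "(Q * E)\<^sup>T * M * (Q * E) = four_block_mat B2 X2 (0\<^sub>m q (p + p')) D'"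
      using eq regroup_block_upper[OF c(1) XQ c'] unfolding B2_def X2_def n by simp
    have B2: "B2 \<in> carrier_mat (p + p') (p + p')" unfolding B2_def by (rule four_block_carrier_mat[OF c(1) c'(1)])
    have X2: "X2 \<in> carrier_mat (p + p') q" unfolding X2_def by simp
    have "eigenvals B2 = eigenvals B + eigenvals B'"
      unfolding B2_def by (rule eigenvals_block_upper) (use c c' in auto)
    hence rB2: "\<forall>w \<in># eigenvals B2. P w" using rB rB' z(2) cnj[OF z(2)] by auto
    have d: "d = p + p' + q" using p n by simp
    show ?thesis
      by (rule exI[of _ "p + p'"], rule exI[of _ q], rule exI[of _ "Q * E"], rule exI[of _ B2],
          rule exI[of _ X2], rule exI[of _ D'])
        (intro conjI d mult_orth[OF Q E] eq2 B2 X2 c'(3) rB2 rD')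
  qed
qed

section \<open>Rotating a planar cocycle\<close>

text \<open>For \<open>M = ((a,b),(c,d))\<close> elliptic in \<open>SL(2)\<close> and the trace-free matrix \<open>Z = ((p,-q),(r,-p))\<close> of determinant \<open>1\<close>,
  the left-hand side is \<open>- tr (M Z)\<close>.  Elliptic elements turning in the same direction have a definite sign
  of this pairing, and the bound is the quantitative form of that fact: multiplied by the positive
  number \<open>4 c q\<close>, the difference of both sides is a sum of two squares.\<close>

lemma elliptic_trace_bound:
  fixes p q r a b c d :: real
  assumes pqr: "q * r - p^2 = 1" "q > 0" and M: "a * d - b * c = 1" "(a + d)^2 < 4" "c > 0"
  shows "c * q - b * r - (a - d) * p \<ge> sqrt (4 - (a + d)^2)"
proof -
  define s e where "s = sqrt (4 - (a + d)^2)" and "e = a - d"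
  have s2: "s^2 = 4 - (a + d)^2" unfolding s_def using M by simp
  have bc: "- 4 * b * c = s^2 + e^2" using M(1) unfolding s2 e_def by (simp add: power2_eq_square algebra_simps)
  have "4 * c * q * (c * q - b * r - e * p - s)
      = 4 * c^2 * q^2 + (- 4 * b * c) * (q * r) - 4 * c * q * e * p - 4 * c * q * s"
    by (simp add: power2_eq_square algebra_simps)
  also have "\<dots> = 4 * c^2 * q^2 + (s^2 + e^2) * (1 + p^2) - 4 * c * q * e * p - 4 * c * q * s"
    using pqr(1) unfolding bc by (simp add: algebra_simps)
  also have "\<dots> = (2 * c * q - (e * p + s))^2 + (s * p - e)^2"
    by (simp add: power2_eq_square algebra_simps)
  finally have "4 * c * q * (c * q - b * r - e * p - s) \<ge> 0" by simp
  hence "c * q - b * r - e * p - s \<ge> 0"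
    using mult_pos_pos[OF M(3) pqr(2)] by (simp add: zero_le_mult_iff)
  thus ?thesis unfolding s_def e_def by simp
qed

definition rot :: "real \<Rightarrow> real mat" where
  "rot x = mat 2 2 (\<lambda>(i,j). if i = j then cos x else if i = 0 then - sin x else sin x)"

lemma rot_carrier [simp]: "rot x \<in> carrier_mat 2 2" "dim_row (rot x) = 2" "dim_col (rot x) = 2"
  unfolding rot_def by auto

lemma index_mult_2x2:
  fixes A B :: "'a :: comm_ring_1 mat"
  assumes "A \<in> carrier_mat 2 2" "B \<in> carrier_mat 2 2" "i < 2" "j < 2"
  shows "(A * B) $$ (i,j) = A $$ (i,0) * B $$ (0,j) + A $$ (i,1) * B $$ (1,j)"
  using assms by (simp add: scalar_prod_def numeral_2_eq_2)

lemma eq_2x2I: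
  assumes "A \<in> carrier_mat 2 2" "B \<in> carrier_mat 2 2"
    "A $$ (0,0) = B $$ (0,0)" "A $$ (0,1) = B $$ (0,1)" "A $$ (1,0) = B $$ (1,0)" "A $$ (1,1) = B $$ (1,1)"
  shows "A = B"
proof (rule eq_matI)
  fix i j assume "i < dim_row B" "j < dim_col B"
  hence "i = 0 \<or> i = 1" "j = 0 \<or> j = 1" using assms(2) by auto
  thus "A $$ (i,j) = B $$ (i,j)" using assms by auto
qed (use assms in auto)

lemma rot_index: "rot x $$ (0,0) = cos x" "rot x $$ (0,1) = - sin x" "rot x $$ (1,0) = sin x" "rot x $$ (1,1) = cos x"
  unfolding rot_def by auto

primrec seq_prod :: "nat \<Rightarrow> (nat \<Rightarrow> real mat) \<Rightarrow> nat \<Rightarrow> real mat" where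
  "seq_prod d A 0 = 1\<^sub>m d"
| "seq_prod d A (Suc k) = A (Suc k) * seq_prod d A k"

lemma seq_prod_carrier: "(\<And>k. A k \<in> carrier_mat d d) \<Longrightarrow> seq_prod d A k \<in> carrier_mat d d"
  by (induction k) (auto intro: mult_carrier_mat)

lemma det_seq_prod:
  assumes "\<And>k. A k \<in> carrier_mat d d" shows "det (seq_prod d A l) = (\<Prod>k\<in>{1..l}. det (A k))"
  by (induction l) (simp_all add: det_mult[OF assms seq_prod_carrier[OF assms]] prod.nat_ivl_Suc' )

context
  fixes B :: "nat \<Rightarrow> real mat"
  assumes B: "\<And>k. B k \<in> carrier_mat 2 2" and detB: "\<And>k. det (B k) = 1"
begin

definition rotated_prod :: "nat \<Rightarrow> real \<Rightarrow> real mat" where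
  "rotated_prod k x = seq_prod 2 (\<lambda>i. rot x * B i) k"

lemma rotated_prod_carrier: "rotated_prod k x \<in> carrier_mat 2 2"
  unfolding rotated_prod_def by (intro seq_prod_carrier mult_carrier_mat[OF rot_carrier(1) B])

lemma rotated_prod_det: "rotated_prod k x $$ (0,0) * rotated_prod k x $$ (1,1) - rotated_prod k x $$ (0,1) * rotated_prod k x $$ (1,0) = 1"
proof -
  have "det (rot x) = 1"
    by (subst det_2x2) (simp_all add: rot_index[unfolded One_nat_def] power2_eq_square[symmetric])
  hence "det (rotated_prod k x) = 1"
    unfolding rotated_prod_def by (subst det_seq_prod) (use detB mult_carrier_mat[OF rot_carrier(1) B] in \<open>simp_all add: det_mult[OF rot_carrier(1) B]\<close>)
  thus ?thesis using det_2x2[OF rotated_prod_carrier] by simp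
qed

lemma rotated_prod_Suc:
  fixes k j :: nat
  assumes "j < 2"
  defines "n0 \<equiv> \<lambda>x. B (Suc k) $$ (0,0) * rotated_prod k x $$ (0,j) + B (Suc k) $$ (0,1) * rotated_prod k x $$ (1,j)"
  defines "n1 \<equiv> \<lambda>x. B (Suc k) $$ (1,0) * rotated_prod k x $$ (0,j) + B (Suc k) $$ (1,1) * rotated_prod k x $$ (1,j)"
  shows "rotated_prod (Suc k) x $$ (0,j) = cos x * n0 x - sin x * n1 x"
    "rotated_prod (Suc k) x $$ (1,j) = sin x * n0 x + cos x * n1 x"
proof -
  have "rotated_prod (Suc k) x = rot x * (B (Suc k) * rotated_prod k x)"
    unfolding rotated_prod_def seq_prod.simps
    by (rule assoc_mult_mat) (use B rotated_prod_carrier[of k x] in \<open>auto simp: rotated_prod_def\<close>)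
  thus "rotated_prod (Suc k) x $$ (0,j) = cos x * n0 x - sin x * n1 x"
    "rotated_prod (Suc k) x $$ (1,j) = sin x * n0 x + cos x * n1 x"
    using assms(1) B rotated_prod_carrier[of k x]
    by (simp_all only: index_mult_2x2[OF rot_carrier(1)] index_mult_2x2[OF B rotated_prod_carrier] 
          mult_carrier_mat[OF B rotated_prod_carrier] rot_index n0_def n1_def)
qed

text \<open>Write \<open>M\<^sub>k\<close> for the rotated product and \<open>J\<close> for the derivative of \<open>rot\<close> at zero.  By the product rule
  \<open>M\<^sub>k' = M\<^sub>k Z\<^sub>k\<close>, where \<open>Z\<^sub>k\<close> is the sum of \<open>M\<^sub>i\<^bsup>-1\<^esup> J M\<^sub>i\<close> over \<open>1 \<le> i \<le> k\<close>.  Every summand is conjugate to \<open>J\<close> in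
  \<open>SL(2)\<close>, so that \<open>elliptic_trace_bound\<close> applies to each of them, with the same sign; the
  lower bounds add up to \<open>k\<close> times the bound for one summand.\<close>

lemma rotated_prod_derivative:
  "\<exists>p q r. 
     ((\<lambda>x. rotated_prod k x $$ (0,0)) has_real_derivative rotated_prod k x $$ (0,0) * p + rotated_prod k x $$ (0,1) * r) (at x) \<and>
     ((\<lambda>x. rotated_prod k x $$ (0,1)) has_real_derivative - rotated_prod k x $$ (0,0) * q - rotated_prod k x $$ (0,1) * p) (at x) \<and>
     ((\<lambda>x. rotated_prod k x $$ (1,0)) has_real_derivative rotated_prod k x $$ (1,0) * p + rotated_prod k x $$ (1,1) * r) (at x) \<and>
     ((\<lambda>x. rotated_prod k x $$ (1,1)) has_real_derivative - rotated_prod k x $$ (1,0) * q - rotated_prod k x $$ (1,1) * p) (at x) \<and>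
     (\<forall>a b c d. a * d - b * c = 1 \<and> (a + d)^2 < 4 \<and> c > 0 \<longrightarrow>
        c * q - b * r - (a - d) * p \<ge> real k * sqrt (4 - (a + d)^2))"
proof (induction k)
  case 0
  show ?case by (rule exI[of _ 0])+ (simp add: rotated_prod_def)
next
  case (Suc k)
  then obtain p q r where
    D: "((\<lambda>x. rotated_prod k x $$ (0,0)) has_real_derivative rotated_prod k x $$ (0,0) * p + rotated_prod k x $$ (0,1) * r) (at x)"
     "((\<lambda>x. rotated_prod k x $$ (0,1)) has_real_derivative - rotated_prod k x $$ (0,0) * q - rotated_prod k x $$ (0,1) * p) (at x)"
     "((\<lambda>x. rotated_prod k x $$ (1,0)) has_real_derivative rotated_prod k x $$ (1,0) * p + rotated_prod k x $$ (1,1) * r) (at x)"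
     "((\<lambda>x. rotated_prod k x $$ (1,1)) has_real_derivative - rotated_prod k x $$ (1,0) * q - rotated_prod k x $$ (1,1) * p) (at x)"
    and pos: "\<And>a b c d. a * d - b * c = 1 \<Longrightarrow> (a + d)^2 < 4 \<Longrightarrow> c > 0 \<Longrightarrow>
        c * q - b * r - (a - d) * p \<ge> real k * sqrt (4 - (a + d)^2)"
    by blast
  define \<alpha> \<beta> \<gamma> \<delta> where "\<alpha> = B (Suc k) $$ (0,0)" and "\<beta> = B (Suc k) $$ (0,1)"
    and "\<gamma> = B (Suc k) $$ (1,0)" and "\<delta> = B (Suc k) $$ (1,1)"
  define a b c d where "a = rotated_prod (Suc k) x $$ (0,0)" and "b = rotated_prod (Suc k) x $$ (0,1)"
    and "c = rotated_prod (Suc k) x $$ (1,0)" and "d = rotated_prod (Suc k) x $$ (1,1)"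
  define a0 b0 c0 d0 where "a0 = rotated_prod k x $$ (0,0)" and "b0 = rotated_prod k x $$ (0,1)"
    and "c0 = rotated_prod k x $$ (1,0)" and "d0 = rotated_prod k x $$ (1,1)"
  have det: "a * d - b * c = 1" unfolding a_def b_def c_def d_def by (rule rotated_prod_det)
  let ?p = "p - (a * b + c * d)" let ?q = "q + (b^2 + d^2)" let ?r = "r + (a^2 + c^2)"
  have e: "a = cos x * (\<alpha> * a0 + \<beta> * c0) - sin x * (\<gamma> * a0 + \<delta> * c0)"
    "c = sin x * (\<alpha> * a0 + \<beta> * c0) + cos x * (\<gamma> * a0 + \<delta> * c0)"
    "b = cos x * (\<alpha> * b0 + \<beta> * d0) - sin x * (\<gamma> * b0 + \<delta> * d0)"
    "d = sin x * (\<alpha> * b0 + \<beta> * d0) + cos x * (\<gamma> * b0 + \<delta> * d0)"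
    unfolding a_def b_def c_def d_def a0_def b0_def c0_def d0_def \<alpha>_def \<beta>_def \<gamma>_def \<delta>_def
    by (rule rotated_prod_Suc, simp)+
  \<comment> \<open>multiplying the new summand of \<open>Z\<close> by the new product \<open>M\<close> leaves \<open>J M\<close>, since \<open>M\<close> has determinant \<open>1\<close>\<close>
  have j: "a * (a * b + c * d) - b * (a^2 + c^2) = c" "a * (b^2 + d^2) - b * (a * b + c * d) = d"
     "d * (a^2 + c^2) - c * (a * b + c * d) = a" "d * (a * b + c * d) - c * (b^2 + d^2) = b"
  proof -
    have "a * (a * b + c * d) - b * (a^2 + c^2) = c * (a * d - b * c)"
      "a * (b^2 + d^2) - b * (a * b + c * d) = d * (a * d - b * c)"
      "d * (a^2 + c^2) - c * (a * b + c * d) = a * (a * d - b * c)"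
      "d * (a * b + c * d) - c * (b^2 + d^2) = b * (a * d - b * c)"
      by (simp_all add: power2_eq_square algebra_simps)
    thus "a * (a * b + c * d) - b * (a^2 + c^2) = c" "a * (b^2 + d^2) - b * (a * b + c * d) = d"
     "d * (a^2 + c^2) - c * (a * b + c * d) = a" "d * (a * b + c * d) - c * (b^2 + d^2) = b"
      unfolding det by simp_all
  qed
  have n: "a * ?p + b * ?r = a * p + b * r - c" "- a * ?q - b * ?p = - a * q - b * p - d"
    "c * ?p + d * ?r = c * p + d * r + a" "- c * ?q - d * ?p = - c * q - d * p + b"
    using j by (simp_all add: algebra_simps)
  have D1: "((\<lambda>x. rotated_prod (Suc k) x $$ (0,0)) has_real_derivative a * ?p + b * ?r) (at x)"
    unfolding n by (simp add: rotated_prod_Suc, (rule derivative_eq_intros D[unfolded One_nat_def] refl)+)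
      (simp add: e a0_def b0_def c0_def d0_def \<alpha>_def \<beta>_def \<gamma>_def \<delta>_def algebra_simps)
  have D2: "((\<lambda>x. rotated_prod (Suc k) x $$ (0,1)) has_real_derivative - a * ?q - b * ?p) (at x)"
    unfolding n by (simp add: rotated_prod_Suc, (rule derivative_eq_intros D[unfolded One_nat_def] refl)+)
      (simp add: e a0_def b0_def c0_def d0_def \<alpha>_def \<beta>_def \<gamma>_def \<delta>_def algebra_simps)
  have D3: "((\<lambda>x. rotated_prod (Suc k) x $$ (1,0)) has_real_derivative c * ?p + d * ?r) (at x)"
    unfolding n by (simp add: rotated_prod_Suc[unfolded One_nat_def], (rule derivative_eq_intros D[unfolded One_nat_def] refl)+)
      (simp add: e a0_def b0_def c0_def d0_def \<alpha>_def \<beta>_def \<gamma>_def \<delta>_def algebra_simps)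
  have D4: "((\<lambda>x. rotated_prod (Suc k) x $$ (1,1)) has_real_derivative - c * ?q - d * ?p) (at x)"
    unfolding n by (simp add: rotated_prod_Suc[unfolded One_nat_def], (rule derivative_eq_intros D[unfolded One_nat_def] refl)+)
      (simp add: e a0_def b0_def c0_def d0_def \<alpha>_def \<beta>_def \<gamma>_def \<delta>_def algebra_simps)
  have "c' * ?q - b' * ?r - (a' - d') * ?p \<ge> real (Suc k) * sqrt (4 - (a' + d')^2)"
    if "a' * d' - b' * c' = 1" "(a' + d')^2 < 4" "c' > 0" for a' b' c' d'
  proof -
    have "(b^2 + d^2) * (a^2 + c^2) - (- (a * b + c * d))^2 = (a * d - b * c)^2"
      by (simp add: power2_eq_square algebra_simps)
    hence 1: "(b^2 + d^2) * (a^2 + c^2) - (- (a * b + c * d))^2 = 1" using det by simp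
    have "b^2 + d^2 \<noteq> 0" using det by (auto simp: sum_power2_eq_zero_iff)
    hence "b^2 + d^2 > 0" by (metis add_nonneg_nonneg zero_le_power2 less_eq_real_def)
    from elliptic_trace_bound[OF 1 this that] pos[OF that] show ?thesis by (simp add: algebra_simps)
  qed
  with D1 D2 D3 D4 show ?case unfolding a_def b_def c_def d_def by blast
qed

definition rotated_trace :: "nat \<Rightarrow> real \<Rightarrow> real" where
  "rotated_trace k x = rotated_prod k x $$ (0,0) + rotated_prod k x $$ (1,1)"

lemma continuous_rotated_trace: "continuous_on S (rotated_trace k)"
proof (rule continuous_at_imp_continuous_on, rule ballI)
  fix x
  from rotated_prod_derivative[of k x] obtain D E where
    "((\<lambda>x. rotated_prod k x $$ (0,0)) has_real_derivative D) (at x)"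
    "((\<lambda>x. rotated_prod k x $$ (1,1)) has_real_derivative E) (at x)" by blast
  hence "(rotated_trace k has_real_derivative D + E) (at x)"
    unfolding rotated_trace_def[abs_def] by (rule DERIV_add)
  thus "isCont (rotated_trace k) x" by (rule DERIV_isCont)
qed

text \<open>The trace of \<open>M Z\<close> is bounded away from zero for \<open>c > 0\<close>; the case \<open>c < 0\<close> is that of \<open>- M\<close>, and \<open>c = 0\<close> is impossible
  for an elliptic matrix.\<close>

lemma rotated_trace_derivative_bound:
  assumes ell: "(rotated_trace k x)^2 < 4"
  obtains D where "(rotated_trace k has_real_derivative D) (at x)" "\<bar>D\<bar> \<ge> real k * sqrt (4 - (rotated_trace k x)^2)"
proof -
  define a b c d where "a = rotated_prod k x $$ (0,0)" and "b = rotated_prod k x $$ (0,1)"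
    and "c = rotated_prod k x $$ (1,0)" and "d = rotated_prod k x $$ (1,1)"
  from rotated_prod_derivative[of k x] obtain p q r where
    D: "((\<lambda>x. rotated_prod k x $$ (0,0)) has_real_derivative a * p + b * r) (at x)"
     "((\<lambda>x. rotated_prod k x $$ (1,1)) has_real_derivative - c * q - d * p) (at x)"
    and pos: "\<And>a b c d. a * d - b * c = 1 \<Longrightarrow> (a + d)^2 < 4 \<Longrightarrow> c > 0 \<Longrightarrow>
        c * q - b * r - (a - d) * p \<ge> real k * sqrt (4 - (a + d)^2)"
    unfolding a_def b_def c_def d_def by blast
  have det: "a * d - b * c = 1" unfolding a_def b_def c_def d_def by (rule rotated_prod_det)
  have ell': "(a + d)^2 < 4" using ell unfolding rotated_trace_def a_def d_def .
  have deriv: "(rotated_trace k has_real_derivative (a * p + b * r) + (- c * q - d * p)) (at x)"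
    unfolding rotated_trace_def[abs_def] by (rule DERIV_add[OF D])
  have "c \<noteq> 0"
  proof
    assume "c = 0"
    hence "(a + d)^2 = (a - d)^2 + 4" using det by (simp add: power2_eq_square algebra_simps)
    with ell' show False by (metis add_less_same_cancel2 linorder_not_less zero_le_power2)
  qed
  hence "\<bar>(a * p + b * r) + (- c * q - d * p)\<bar> \<ge> real k * sqrt (4 - (a + d)^2)"
  proof (cases "c > 0")
    case True
    from pos[OF det ell' True] show ?thesis by (simp add: algebra_simps)
  next
    case False
    with \<open>c \<noteq> 0\<close> have c: "- c > 0" by simp
    have "(- a) * (- d) - (- b) * (- c) = 1" "(- a + - d)^2 < 4"
      using det ell' by (simp_all add: power2_eq_square algebra_simps)
    from pos[OF this c] have "- c * q + b * r + (a - d) * p \<ge> real k * sqrt (4 - (- a + - d)^2)"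
      by (simp add: algebra_simps)
    moreover have "(- a + - d)^2 = (a + d)^2" by (simp add: power2_eq_square algebra_simps)
    ultimately show ?thesis by (simp add: algebra_simps)
  qed
  with that[OF deriv] show thesis unfolding rotated_trace_def a_def d_def by simp
qed

text \<open>While the product is elliptic, \<open>arccos (tr / 2)\<close> is its rotation angle, a number in \<open>(0, pi)\<close>.  The angle moves at
  speed at least \<open>l\<close>, so over an interval of length \<open>pi / l\<close> it would have to move by at least \<open>pi\<close>.\<close>

lemma rotation_reaches_real:
  assumes l: "l \<ge> 1"
  shows "\<exists>x \<in> {0..pi / l}. (rotated_trace l x)^2 \<ge> 4"
proof (rule ccontr)
  assume "\<not> ?thesis"
  hence neg: "\<forall>x \<in> {0..pi / l}. \<not> (rotated_trace l x)^2 \<ge> 4" by blast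
  have ell: "(rotated_trace l x)^2 < 4" if "0 \<le> x" "x \<le> pi / l" for x
    using bspec[OF neg, of x] that by (simp add: not_le)
  have bnd: "-1 < rotated_trace l x / 2" "rotated_trace l x / 2 < 1" if "0 \<le> x" "x \<le> pi / l" for x
  proof -
    have "\<bar>rotated_trace l x\<bar> < 2" using power2_less_imp_less[of "\<bar>rotated_trace l x\<bar>" 2] ell[OF that] by simp
    thus "-1 < rotated_trace l x / 2" "rotated_trace l x / 2 < 1" by auto
  qed
  define g where "g x = arccos (rotated_trace l x / 2)" for x
  have "\<exists>D. (g has_real_derivative D) (at x) \<and> \<bar>D\<bar> \<ge> real l" if x: "0 \<le> x" "x \<le> pi / l" for x
  proof -
    obtain D where D: "(rotated_trace l has_real_derivative D) (at x)"
      and Db: "\<bar>D\<bar> \<ge> real l * sqrt (4 - (rotated_trace l x)^2)"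
      by (rule rotated_trace_derivative_bound[OF ell[OF x]])
    define w where "w = sqrt (1 - (rotated_trace l x / 2)^2)"
    have "4 - (rotated_trace l x)^2 = 2^2 * (1 - (rotated_trace l x / 2)^2)" by (simp add: field_simps)
    hence w: "sqrt (4 - (rotated_trace l x)^2) = 2 * w" unfolding w_def by (simp only: real_sqrt_mult real_sqrt_abs abs_numeral)
    have "sqrt (4 - (rotated_trace l x)^2) > 0" using ell[OF x] by simp
    hence w0: "w > 0" unfolding w by simp
    have "((\<lambda>x. rotated_trace l x / 2) has_real_derivative D / 2) (at x)" by (rule DERIV_cdivide[OF D])
    from DERIV_chain2[OF DERIV_arccos[OF bnd[OF x]] this]
    have "(g has_real_derivative inverse (- w) * (D / 2)) (at x)"
      unfolding g_def[abs_def] w_def .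
    moreover have "\<bar>inverse (- w) * (D / 2)\<bar> \<ge> real l"
      using Db w0 unfolding w by (simp add: abs_mult field_simps)
    ultimately show ?thesis by blast
  qed
  then obtain g' where g': "\<And>x. 0 \<le> x \<Longrightarrow> x \<le> pi / l \<Longrightarrow> (g has_real_derivative g' x) (at x) \<and> \<bar>g' x\<bar> \<ge> real l"
    by metis
  have pl: "0 < pi / l" using l by simp
  obtain z where z: "0 < z" "z < pi / l" "g (pi / l) - g 0 = (pi / l - 0) * g' z"
    using MVT2[OF pl, of g g'] g' by blast
  have "\<bar>g (pi / l) - g 0\<bar> = pi / l * \<bar>g' z\<bar>" unfolding z(3) using pl by (simp add: abs_mult)
  also have "\<dots> \<ge> pi / l * real l" using g'[of z] z pl by (intro mult_left_mono) auto
  finally have "\<bar>g (pi / l) - g 0\<bar> \<ge> pi" using l by simp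
  moreover have "0 < g x \<and> g x < pi" if "0 \<le> x" "x \<le> pi / l" for x
    unfolding g_def using arccos_lt_bounded[OF bnd[OF that]] by simp
  from this[of 0] this[of "pi / l"] pl have "\<bar>g (pi / l) - g 0\<bar> < pi" by auto
  ultimately show False by simp
qed

text \<open>Stopping at the first angle with discriminant zero keeps the discriminant nonpositive on the way.\<close>

lemma first_real_rotation:
  assumes l: "l \<ge> 1" and ell: "(rotated_trace l 0)^2 < 4"
  obtains x where "0 \<le> x" "x \<le> pi / l" "(rotated_trace l x)^2 = 4" "\<And>y. 0 \<le> y \<Longrightarrow> y \<le> x \<Longrightarrow> (rotated_trace l y)^2 \<le> 4"
proof -
  define g where "g x = (rotated_trace l x)^2" for x
  have cont: "continuous_on S g" for S unfolding g_def[abs_def] by (intro continuous_on_power continuous_rotated_trace)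
  have hit: "\<exists>x. 0 \<le> x \<and> x \<le> y \<and> g x = 4" if "0 \<le> y" "g y \<ge> 4" for y
    using IVT'[of g 0 4 y] that ell cont unfolding g_def by auto
  obtain x1 where x1: "0 \<le> x1" "x1 \<le> pi / l" "g x1 \<ge> 4"
    using rotation_reaches_real[OF l] unfolding g_def by auto
  define S where "S = {0..x1} \<inter> g -` {4}"
  have "closed (g -` {4} \<inter> {0..x1})"
    using continuous_on_closed_vimage[of "{0..x1}" g] cont by simp
  hence "closed S" unfolding S_def by (simp add: Int_commute)
  moreover have "S = {0..x1} \<inter> S" unfolding S_def by auto
  ultimately have "compact S" by (metis compact_Icc compact_Int_closed)
  moreover have "S \<noteq> {}" using hit[OF x1(1,3)] unfolding S_def by auto
  ultimately obtain x where x: "x \<in> S" "\<And>y. y \<in> S \<Longrightarrow> x \<le> y" by (metis compact_attains_inf)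
  show thesis
  proof (rule that)
    show "0 \<le> x" "x \<le> pi / l" "(rotated_trace l x)^2 = 4" using x(1) x1 unfolding S_def g_def by auto
    fix y assume y: "0 \<le> y" "y \<le> x"
    show "(rotated_trace l y)^2 \<le> 4"
    proof (rule ccontr)
      assume "\<not> ?thesis"
      hence gy: "g y > 4" unfolding g_def by simp
      then obtain z where z: "0 \<le> z" "z \<le> y" "g z = 4" using hit[OF y(1)] by auto
      hence "z \<in> S" using x(1) y unfolding S_def by auto
      hence "z = x" using x(2) z y by force
      thus False using z y gy by auto
    qed
  qed
qed

end

lemma scalar_prod_self_nonneg: "(v :: real vec) \<bullet> v \<ge> 0"
  unfolding scalar_prod_def by (rule sum_nonneg) simp

text \<open>Special orthogonal matrices, \<open>\<delta>\<close>-Lipschitz in \<open>t\<close> and starting at the identity.  The Lipschitz condition is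
  imposed vectorwise because in this form it passes, with the same constant, to orthogonal conjugates
  and to block diagonal sums; it yields both continuity and smallness of the perturbation.\<close>

definition rotation_family :: "nat \<Rightarrow> real \<Rightarrow> (real \<Rightarrow> nat \<Rightarrow> real mat) \<Rightarrow> bool" where
  "rotation_family d \<delta> S \<longleftrightarrow> (\<forall>t k. S t k \<in> orth d \<and> det (S t k) = 1) \<and> (\<forall>k. S 0 k = 1\<^sub>m d) \<and>
     (\<forall>s t k. \<forall>v \<in> carrier_vec d.
        (S t k *\<^sub>v v - S s k *\<^sub>v v) \<bullet> (S t k *\<^sub>v v - S s k *\<^sub>v v) \<le> (\<delta> * (t - s))^2 * (v \<bullet> v))"

text \<open>The matrices \<open>S t k\<close> act from the left on the factors; the eigenvalue moduli of the product stay
  those of the unperturbed product.\<close>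

definition realifies :: "nat \<Rightarrow> nat \<Rightarrow> (nat \<Rightarrow> real mat) \<Rightarrow> (real \<Rightarrow> nat \<Rightarrow> real mat) \<Rightarrow> bool" where
  "realifies d l A S \<longleftrightarrow>
     (\<forall>t \<in> {0..1}. image_mset cmod (eigenvals (seq_prod d (\<lambda>k. S t k * A k) l))
        = image_mset cmod (eigenvals (seq_prod d A l))) \<and>
     (\<forall>z \<in># eigenvals (seq_prod d (\<lambda>k. S 1 k * A k) l). z \<in> \<real>)"

lemma rotation_family_one: "rotation_family d \<delta> (\<lambda>t k. 1\<^sub>m d)"
  unfolding rotation_family_def by (auto simp: one_orth scalar_prod_self_nonneg intro!: mult_nonneg_nonneg)

lemma realifies_one:
  assumes "\<And>k. A k \<in> carrier_mat d d" "\<And>z. z \<in># eigenvals (seq_prod d A l) \<Longrightarrow> z \<in> \<real>"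
  shows "realifies d l A (\<lambda>t k. 1\<^sub>m d)"
proof -
  have "(\<lambda>k. 1\<^sub>m d * A k) = A" using left_mult_one_mat[OF assms(1)] by auto
  thus ?thesis unfolding realifies_def using assms(2) by simp
qed

lemma mult_mat_vec_2x2:
  fixes A :: "real mat"
  assumes "A \<in> carrier_mat 2 2" "v \<in> carrier_vec 2"
  shows "(A *\<^sub>v v) $ 0 = A $$ (0,0) * v $ 0 + A $$ (0,1) * v $ 1"
    "(A *\<^sub>v v) $ 1 = A $$ (1,0) * v $ 0 + A $$ (1,1) * v $ 1"
  by (subst mult_mat_vec_index_sum[OF assms]; simp add: numeral_2_eq_2)+

lemma scalar_prod_2: "v \<in> carrier_vec 2 \<Longrightarrow> w \<in> carrier_vec 2 \<Longrightarrow> (v :: real vec) \<bullet> w = v $ 0 * w $ 0 + v $ 1 * w $ 1"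
  by (simp add: scalar_prod_def numeral_2_eq_2)

lemma rot_orth: "rot x \<in> orth 2" "det (rot x) = 1"
proof -
  have "(rot x)\<^sup>T * rot x = 1\<^sub>m 2"
    by (rule eq_2x2I)
      (auto simp: index_mult_2x2 rot_index[unfolded One_nat_def] power2_eq_square[symmetric] simp del: index_mult_mat(1))
  thus "rot x \<in> orth 2" unfolding orth_def by simp
  show "det (rot x) = 1"
    by (subst det_2x2) (simp_all add: rot_index[unfolded One_nat_def] power2_eq_square[symmetric])
qed

lemma rot_lipschitz:
  assumes v: "v \<in> carrier_vec 2"
  shows "(rot x *\<^sub>v v - rot y *\<^sub>v v) \<bullet> (rot x *\<^sub>v v - rot y *\<^sub>v v) \<le> (x - y)^2 * (v \<bullet> v)"
proof -
  have c: "rot x *\<^sub>v v \<in> carrier_vec 2" "rot y *\<^sub>v v \<in> carrier_vec 2" by (rule mult_mat_vec_carrier[OF rot_carrier(1) v])+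
  have expand: "(a * p + - b * q - (a' * p + - b' * q))^2 + (b * p + a * q - (b' * p + a' * q))^2
      = ((a - a')^2 + (b - b')^2) * (p * p + q * q)" for a b a' b' p q :: real
    by (simp add: power2_eq_square algebra_simps)
  have "(rot x *\<^sub>v v - rot y *\<^sub>v v) \<bullet> (rot x *\<^sub>v v - rot y *\<^sub>v v)
    = ((rot x *\<^sub>v v) $ 0 - (rot y *\<^sub>v v) $ 0)^2 + ((rot x *\<^sub>v v) $ 1 - (rot y *\<^sub>v v) $ 1)^2"
    using c by (simp add: scalar_prod_2 power2_eq_square)
  also have "\<dots> = ((cos x - cos y)^2 + (sin x - sin y)^2) * (v \<bullet> v)"
    unfolding mult_mat_vec_2x2[OF rot_carrier(1) v] rot_index expand scalar_prod_2[OF v v] ..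
  also have "(cos x - cos y)^2 + (sin x - sin y)^2 = 2 - 2 * cos (x - y)"
    by (simp add: cos_diff power2_diff) (simp add: sin_squared_eq algebra_simps)
  also have "\<dots> = (2 * sin ((x - y) / 2))^2"
  proof -
    have "cos (x - y) = 1 - 2 * (sin ((x - y) / 2))^2"
      using cos_double_sin[of "(x - y) / 2"] by (simp del: right_diff_distrib_numeral)
    thus ?thesis by (simp only: power_mult_distrib) simp
  qed
  also have "\<dots> \<le> (x - y)^2"
    using abs_sin_x_le_abs_x[of "(x - y) / 2"] by (subst abs_le_square_iff[symmetric]) (simp add: abs_mult)
  finally show ?thesis by (simp add: mult_right_mono scalar_prod_self_nonneg)
qed

lemma smult_smult_mat: "a \<cdot>\<^sub>m (b \<cdot>\<^sub>m A) = (a * b) \<cdot>\<^sub>m (A :: real mat)"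
  by (rule eq_matI) auto

text \<open>Let \<open>\<sigma> k\<close> be the sign of the determinant of the \<open>k\<close>-th partial product and \<open>D s = diag(1, s)\<close>.  Replacing \<open>A k\<close>
  by \<open>D (\<sigma> k) (A k) D (\<sigma> (k - 1))\<close>, scaled by \<open>1 / sqrt |det (A k)|\<close>, gives determinant \<open>1\<close>.  Since \<open>D s\<close> turns a rotation
  by \<open>x\<close> into a rotation by \<open>s x\<close>, the factor \<open>A k\<close> has to be rotated in the direction \<open>\<sigma> k\<close>.  The rotation stops
  as soon as the discriminant vanishes; before that the eigenvalues are conjugate, hence their
  modulus is determined by the determinant, which does not change.\<close>

lemma exists_realifying_rotations_2x2:
  assumes A: "\<And>k. A k \<in> carrier_mat 2 2" "\<And>k. det (A k) \<noteq> 0" and l: "l \<ge> 1" "pi \<le> \<delta> * real l"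
  shows "\<exists>S. rotation_family 2 \<delta> S \<and> realifies 2 l A S"
proof -
  define tr where "tr M = M $$ (0,0) + M $$ (1,1)" for M :: "real mat"
  have Pc: "seq_prod 2 A k \<in> carrier_mat 2 2" for k by (rule seq_prod_carrier[OF A(1)])
  show ?thesis
  proof (cases "(tr (seq_prod 2 A l))^2 \<ge> 4 * det (seq_prod 2 A l)")
    case True
    hence "realifies 2 l A (\<lambda>t k. 1\<^sub>m 2)"
      using eigenvals_2x2(2)[OF Pc] by (intro realifies_one A) (auto simp: tr_def det_2x2[OF Pc])
    with rotation_family_one show ?thesis by blast
  next
    case False
    hence dpos: "det (seq_prod 2 A l) > 0" by (smt (verit) zero_le_power2)
    define \<sigma> where "\<sigma> k = sgn (det (seq_prod 2 A k))" for k
    have detP: "det (seq_prod 2 A (Suc k)) = det (A (Suc k)) * det (seq_prod 2 A k)" for k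
      by (simp add: det_mult[OF A(1) Pc])
    have detP0: "det (seq_prod 2 A k) \<noteq> 0" for k
      by (induction k) (simp_all only: detP, simp_all add: A(2))
    have \<sigma>: "\<sigma> k = 1 \<or> \<sigma> k = -1" for k using detP0[of k] unfolding \<sigma>_def sgn_if by auto
    have \<sigma>2: "\<sigma> k * \<sigma> k = 1" for k using \<sigma>[of k] by auto
    have \<sigma>0: "\<sigma> 0 = 1" "\<sigma> l = 1" using dpos unfolding \<sigma>_def by auto
    define D where "D s = mat 2 2 (\<lambda>(i,j). if i = j then (if i = 0 then 1 else s) else 0)" for s :: real
    have D: "D s \<in> carrier_mat 2 2" "dim_row (D s) = 2" "dim_col (D s) = 2"
      "D s $$ (0,0) = 1" "D s $$ (0,1) = 0" "D s $$ (1,0) = 0" "D s $$ (1,1) = s" for s unfolding D_def by auto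
    note D' = D[unfolded One_nat_def]
    have detD: "det (D s) = s" for s by (simp add: det_2x2[OF D(1)] D')
    have D1: "D 1 = 1\<^sub>m 2" by (rule eq_2x2I) (auto simp: D')
    have DD: "D s * D s = 1\<^sub>m 2" if "s * s = 1" for s
      by (rule eq_2x2I) (use that in \<open>auto simp: index_mult_2x2 D' simp del: index_mult_mat(1)\<close>)
    have rotD: "rot (s * x) = D s * (rot x * D s)" if "s = 1 \<or> s = -1" for s x
      by (rule eq_2x2I) (use that in \<open>auto simp: index_mult_2x2[OF D(1) mult_carrier_mat[OF rot_carrier(1) D(1)]]
          index_mult_2x2[OF rot_carrier(1) D(1)] D' rot_index[unfolded One_nat_def] simp del: index_mult_mat(1)\<close>)
    define c where "c k = sqrt \<bar>det (A k)\<bar>" for k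
    have c: "c k > 0" "c k * c k = \<bar>det (A k)\<bar>" for k using A(2)[of k] unfolding c_def by auto
    \<comment> \<open>index \<open>0\<close> does not enter the product; the value there only has to have determinant \<open>1\<close>\<close>
    define B where "B k = (if k = 0 then 1\<^sub>m 2 else (1 / c k) \<cdot>\<^sub>m (D (\<sigma> k) * (A k * D (\<sigma> (k - 1)))))" for k
    have B: "B k \<in> carrier_mat 2 2" for k unfolding B_def using A(1)[of k] D by auto
    have detB: "det (B k) = 1" for k
    proof (cases k)
      case (Suc j)
      have "\<sigma> k = sgn (det (A k)) * \<sigma> j" unfolding \<sigma>_def Suc detP sgn_mult ..
      hence "det (A k) * \<sigma> j * \<sigma> k = det (A k) * sgn (det (A k)) * (\<sigma> j * \<sigma> j)" by simp
      hence "det (A k) * \<sigma> j * \<sigma> k = \<bar>det (A k)\<bar>" unfolding \<sigma>2 by (simp add: abs_sgn)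
      hence e: "\<sigma> k * (det (A k) * \<sigma> j) = c k * c k" unfolding c(2) by (simp add: ac_simps)
      have "det (B k) = 1 / c k * (1 / c k) * (\<sigma> k * (det (A k) * \<sigma> j))"
        using A(1)[of k] D(1)[of "\<sigma> k"] D(1)[of "\<sigma> j"] unfolding B_def Suc
        by (simp add: det_mult[of _ 2] detD D power2_eq_square)
      also have "\<dots> = 1" unfolding e using c(1)[of k] by simp
      finally show ?thesis .
    qed (simp add: B_def)
    define \<gamma> where "\<gamma> k = (\<Prod>i\<in>{1..k}. c i)" for k
    have \<gamma>: "\<gamma> k > 0" for k unfolding \<gamma>_def using c by (intro prod_pos) auto
    define R where "R = rotated_prod B"
    have R: "R k x \<in> carrier_mat 2 2" for k x unfolding R_def by (rule rotated_prod_carrier[OF B detB])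
    have RSuc: "R (Suc k) x = rot x * (B (Suc k) * R k x)" for k x
      unfolding R_def rotated_prod_def[OF B detB] seq_prod.simps
      by (rule assoc_mult_mat) (use B R[of k x] in \<open>auto simp: R_def rotated_prod_def[OF B detB]\<close>)
    \<comment> \<open>the reflections telescope, and they are trivial at both ends as \<open>\<sigma> 0 = \<sigma> l = 1\<close>\<close>
    have key: "seq_prod 2 (\<lambda>i. rot (\<sigma> i * x) * A i) k = \<gamma> k \<cdot>\<^sub>m (D (\<sigma> k) * R k x)" for k x
    proof (induction k)
      case 0
      have "(1 :: real) \<cdot>\<^sub>m 1\<^sub>m 2 = 1\<^sub>m 2" by (rule eq_matI) auto
      thus ?case by (simp add: \<gamma>_def \<sigma>0 D1 R_def rotated_prod_def[OF B detB])
    next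
      case (Suc k)
      let ?s = "\<sigma> (Suc k)"
      have "D ?s * A (Suc k) * D (\<sigma> k) = c (Suc k) \<cdot>\<^sub>m B (Suc k)"
        unfolding B_def using c(1)[of "Suc k"] A(1)[of "Suc k"] D(1)
        by (intro eq_matI) (auto simp: assoc_mult_mat[of _ 2 2 _ 2 _ 2])
      hence cB: "D ?s * (A (Suc k) * D (\<sigma> k)) = c (Suc k) \<cdot>\<^sub>m B (Suc k)"
        using A(1)[of "Suc k"] D(1) by (simp add: assoc_mult_mat[of _ 2 2 _ 2 _ 2])
      have "seq_prod 2 (\<lambda>i. rot (\<sigma> i * x) * A i) (Suc k)
        = (D ?s * (rot x * D ?s)) * A (Suc k) * (\<gamma> k \<cdot>\<^sub>m (D (\<sigma> k) * R k x))"
        using Suc rotD[OF \<sigma>] by simp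
      also have "\<dots> = \<gamma> k \<cdot>\<^sub>m ((D ?s * (rot x * D ?s)) * A (Suc k) * (D (\<sigma> k) * R k x))"
        by (rule mult_smult_distrib[OF mult_carrier_mat[OF mult_carrier_mat[OF D(1) mult_carrier_mat[OF rot_carrier(1) D(1)]] A(1)]
              mult_carrier_mat[OF D(1) R]])
      also have "(D ?s * (rot x * D ?s)) * A (Suc k) * (D (\<sigma> k) * R k x)
        = D ?s * (rot x * ((D ?s * (A (Suc k) * D (\<sigma> k))) * R k x))"
        using A(1)[of "Suc k"] D(1)[of ?s] D(1)[of "\<sigma> k"] R[of k x] rot_carrier(1)[of x]
        by (simp add: assoc_mult_mat[of _ 2 2 _ 2 _ 2] del: rot_carrier(1))
      also have "\<dots> = c (Suc k) \<cdot>\<^sub>m (D ?s * (rot x * (B (Suc k) * R k x)))"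
        unfolding cB using B[of "Suc k"] R[of k x] D(1)[of ?s] rot_carrier(1)[of x]
        by (simp add: mult_smult_assoc_mat[of _ 2 2 _ 2] mult_smult_distrib[of _ 2 2 _ 2] del: rot_carrier(1))
      also have "\<gamma> k \<cdot>\<^sub>m \<dots> = \<gamma> (Suc k) \<cdot>\<^sub>m (D ?s * R (Suc k) x)"
        unfolding RSuc \<gamma>_def by (simp add: smult_smult_mat mult.commute)
      finally show ?case .
    qed
    define Q where "Q x = seq_prod 2 (\<lambda>i. rot (\<sigma> i * x) * A i) l" for x
    have Q: "Q x = \<gamma> l \<cdot>\<^sub>m R l x" for x unfolding Q_def key \<sigma>0 D1 by (simp only: left_mult_one_mat[OF R])
    have Qc: "Q x \<in> carrier_mat 2 2" for x unfolding Q using R by simp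
    have trQ: "tr (Q x) = \<gamma> l * rotated_trace B l x" for x
      unfolding Q tr_def rotated_trace_def[OF B detB] R_def[symmetric] using R[of l x] by (simp add: algebra_simps)
    have dtQ: "Q x $$ (0,0) * Q x $$ (1,1) - Q x $$ (0,1) * Q x $$ (1,0) = (\<gamma> l)^2" for x
    proof -
      have "Q x $$ (0,0) * Q x $$ (1,1) - Q x $$ (0,1) * Q x $$ (1,0)
        = (\<gamma> l)^2 * (R l x $$ (0,0) * R l x $$ (1,1) - R l x $$ (0,1) * R l x $$ (1,0))"
        unfolding Q using R[of l x] by (simp add: power2_eq_square algebra_simps)
      thus ?thesis unfolding R_def rotated_prod_det[OF B detB] by simp
    qed
    have rot0: "rot 0 = 1\<^sub>m 2" by (rule eq_2x2I) (auto simp: rot_index[unfolded One_nat_def])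
    have Q0: "Q 0 = seq_prod 2 A l" unfolding Q_def using left_mult_one_mat[OF A(1)] by (simp add: rot0)
    have "(tr (Q 0))^2 < 4 * (\<gamma> l)^2"
      using False unfolding Q0[symmetric] det_2x2[OF Qc] dtQ by simp
    hence "(\<gamma> l)^2 * (rotated_trace B l 0)^2 < (\<gamma> l)^2 * 4" unfolding trQ by (simp add: power_mult_distrib)
    hence ell: "(rotated_trace B l 0)^2 < 4" using \<gamma>[of l] by (simp add: mult_less_cancel_left)
    obtain x where x: "0 \<le> x" "x \<le> pi / l" "(rotated_trace B l x)^2 = 4"
      "\<And>y. 0 \<le> y \<Longrightarrow> y \<le> x \<Longrightarrow> (rotated_trace B l y)^2 \<le> 4"
      using first_real_rotation[of B l, OF B detB l(1) ell] by blast
    have "x * real l \<le> pi" using x(2) l(1) by (simp add: field_simps)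
    hence "x * real l \<le> \<delta> * real l" using l(2) by (rule order_trans)
    hence x\<delta>: "x \<le> \<delta>" using l by (simp add: mult_le_cancel_right)
    define S where "S t k = rot (\<sigma> k * (t * x))" for t k
    have "rotation_family 2 \<delta> S" unfolding rotation_family_def
    proof (intro conjI allI ballI)
      show "S t k \<in> orth 2" "det (S t k) = 1" for t k unfolding S_def by (rule rot_orth)+
      show "S 0 k = 1\<^sub>m 2" for k unfolding S_def by (simp add: rot0)
      fix s t k and v :: "real vec" assume v: "v \<in> carrier_vec 2"
      have "(S t k *\<^sub>v v - S s k *\<^sub>v v) \<bullet> (S t k *\<^sub>v v - S s k *\<^sub>v v)
        \<le> (\<sigma> k * (t * x) - \<sigma> k * (s * x))^2 * (v \<bullet> v)" unfolding S_def by (rule rot_lipschitz[OF v])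
      also have "(\<sigma> k * (t * x) - \<sigma> k * (s * x))^2 = x^2 * (t - s)^2"
        using \<sigma>[of k] by (auto simp: power2_eq_square algebra_simps)
      also have "\<dots> * (v \<bullet> v) \<le> (\<delta> * (t - s))^2 * (v \<bullet> v)"
        unfolding power_mult_distrib using x(1) x\<delta>
        by (intro mult_right_mono power_mono scalar_prod_self_nonneg) auto
      finally show "(S t k *\<^sub>v v - S s k *\<^sub>v v) \<bullet> (S t k *\<^sub>v v - S s k *\<^sub>v v) \<le> (\<delta> * (t - s))^2 * (v \<bullet> v)" .
    qed
    moreover have "realifies 2 l A S"
    proof -
      have SQ: "seq_prod 2 (\<lambda>k. S t k * A k) l = Q (t * x)" for t unfolding S_def Q_def ..
      have moduli: "image_mset cmod (eigenvals (Q y)) = {#\<gamma> l, \<gamma> l#}" if "0 \<le> y" "y \<le> x" for y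
      proof -
        have "(tr (Q y))^2 \<le> 4 * (\<gamma> l)^2" unfolding trQ power_mult_distrib
          using mult_left_mono[OF x(4)[OF that], of "(\<gamma> l)^2"] by simp
        moreover from this have "cmod (Complex (tr (Q y) / 2) (sqrt (4 * (\<gamma> l)^2 - (tr (Q y))^2) / 2)) = \<gamma> l"
          "cmod (Complex (tr (Q y) / 2) (- sqrt (4 * (\<gamma> l)^2 - (tr (Q y))^2) / 2)) = \<gamma> l"
          using \<gamma>[of l] unfolding cmod_def by (simp_all add: power_divide field_simps)
        ultimately show ?thesis
          using eigenvals_2x2(1)[OF Qc, of y, unfolded dtQ, folded tr_def] by simp
      qed
      have "z \<in> \<real>" if "z \<in># eigenvals (Q x)" for z
      proof (rule eigenvals_2x2(2)[OF Qc _ that, unfolded dtQ, folded tr_def])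
        show "4 * (\<gamma> l)^2 \<le> (tr (Q x))^2" unfolding trQ power_mult_distrib x(3) by simp
      qed
      moreover have "t * x \<le> x" if "t \<le> 1" for t using mult_right_mono[OF that x(1)] by simp
      ultimately show ?thesis unfolding realifies_def SQ Q0[symmetric]
        using moduli x(1) by auto
    qed
    ultimately show ?thesis by blast
  qed
qed

section \<open>Gluing rotations along invariant flags\<close>

lemma exists_mat_inverse:
  fixes A :: "'a :: field mat"
  assumes A: "A \<in> carrier_mat n n" "det A \<noteq> 0"
  obtains B where "B \<in> carrier_mat n n" "A * B = 1\<^sub>m n" "B * A = 1\<^sub>m n"
proof -
  from det_non_zero_imp_unit[OF A, of undefined] have "A \<in> Units (ring_mat TYPE('a) n undefined)" .
  with that show thesis unfolding Units_def ring_mat_def by auto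
qed

lemma seq_prod_cong:
  "(\<And>k. 1 \<le> k \<Longrightarrow> k \<le> l \<Longrightarrow> A k = B k) \<Longrightarrow> seq_prod d A l = seq_prod d B l"
  by (induction l) auto

text \<open>Changing the basis of the \<open>k\<close>-th space by \<open>Q k\<close>, the intermediate base changes cancel.\<close>

lemma seq_prod_conj:
  assumes A: "\<And>k. A k \<in> carrier_mat d d" and S: "\<And>k. S k \<in> carrier_mat d d" and Q: "\<And>k. Q k \<in> orth d"
  shows "seq_prod d (\<lambda>k. (Q k * S k * (Q k)\<^sup>T) * A k) l
    = Q l * seq_prod d (\<lambda>k. S k * ((Q k)\<^sup>T * A k * Q (k - 1))) l * (Q 0)\<^sup>T"
proof (induction l)
  case 0
  show ?case using orthD[OF Q[of 0]] by simp
next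
  case (Suc l)
  let ?M = "seq_prod d (\<lambda>k. S k * ((Q k)\<^sup>T * A k * Q (k - 1))) l"
  have M: "?M \<in> carrier_mat d d"
    by (rule seq_prod_carrier[OF mult_carrier_mat[OF S mult_carrier_mat[OF mult_carrier_mat[OF orthD(2)[OF Q] A] orthD(1)[OF Q]]]])
  show ?case
    unfolding seq_prod.simps Suc
    using M A[of "Suc l"] S[of "Suc l"] orthD(1,2)[OF Q[of "Suc l"]] orthD(1,2)[OF Q[of l]] orthD(2)[OF Q[of 0]]
    by (simp add: assoc_mult_mat[of _ d d _ d _ d])
qed

lemma seq_prod_block_upper:
  assumes B: "\<And>k. B k \<in> carrier_mat p p" and X: "\<And>k. X k \<in> carrier_mat p q" and D: "\<And>k. D k \<in> carrier_mat q q"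
  shows "\<exists>Y \<in> carrier_mat p q. seq_prod (p + q) (\<lambda>k. four_block_mat (B k) (X k) (0\<^sub>m q p) (D k)) l
    = four_block_mat (seq_prod p B l) Y (0\<^sub>m q p) (seq_prod q D l)"
proof (induction l)
  case 0
  show ?case by (rule bexI[of _ "0\<^sub>m p q"]) auto
next
  case (Suc l)
  then obtain Y where Y: "Y \<in> carrier_mat p q" "seq_prod (p + q) (\<lambda>k. four_block_mat (B k) (X k) (0\<^sub>m q p) (D k)) l
    = four_block_mat (seq_prod p B l) Y (0\<^sub>m q p) (seq_prod q D l)" by blast
  have c: "seq_prod p B l \<in> carrier_mat p p" "seq_prod q D l \<in> carrier_mat q q"
    by (rule seq_prod_carrier[OF B], rule seq_prod_carrier[OF D])
  show ?case
    unfolding seq_prod.simps Y(2) mult_block_upper[OF B X D c(1) Y(1) c(2)]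
    by (rule bexI[of _ "B (Suc l) * Y + X (Suc l) * seq_prod q D l"])
      (simp, intro add_carrier_mat mult_carrier_mat[OF X c(2)])
qed

lemma rotation_familyD:
  assumes "rotation_family d \<delta> S"
  shows "S t k \<in> orth d" "det (S t k) = 1" "S 0 k = 1\<^sub>m d"
    "v \<in> carrier_vec d \<Longrightarrow> (S t k *\<^sub>v v - S s k *\<^sub>v v) \<bullet> (S t k *\<^sub>v v - S s k *\<^sub>v v) \<le> (\<delta> * (t - s))^2 * (v \<bullet> v)"
  using assms unfolding rotation_family_def by auto

text \<open>Orthogonal base changes preserve the Euclidean norm, hence the Lipschitz constant.\<close>

lemma rotation_family_conj:
  assumes S: "rotation_family d \<delta> S" and Q: "\<And>k. Q k \<in> orth d"
  shows "rotation_family d \<delta> (\<lambda>t k. Q k * S t k * (Q k)\<^sup>T)"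
  unfolding rotation_family_def
proof (intro conjI allI ballI)
  note s = rotation_familyD[OF S]
  show "Q k * S t k * (Q k)\<^sup>T \<in> orth d" for t k
    by (intro mult_orth transpose_orth Q s)
  show "det (Q k * S t k * (Q k)\<^sup>T) = 1" for t k
  proof -
    note q = orthD[OF Q[of k]]
    have "det (Q k * S t k * (Q k)\<^sup>T) = det (Q k) * det (S t k) * det ((Q k)\<^sup>T)"
      using q orthD(1)[OF s(1)] by (simp add: det_mult[of _ d])
    also have "\<dots> = det (Q k * (Q k)\<^sup>T)" using det_mult[OF q(1,2)] s(2) by simp
    finally show ?thesis using q(4) by simp
  qed
  show "Q k * S 0 k * (Q k)\<^sup>T = 1\<^sub>m d" for k
    using orthD[OF Q[of k]] s(3) by simp
  fix x t k and v :: "real vec" assume v: "v \<in> carrier_vec d"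
  note q = orthD[OF Q[of k]]
  define w where "w = (Q k)\<^sup>T *\<^sub>v v"
  have w: "w \<in> carrier_vec d" unfolding w_def using q v by auto
  have Sw: "S y k *\<^sub>v w \<in> carrier_vec d" for y
    by (rule mult_mat_vec_carrier[OF orthD(1)[OF s(1)] w])
  have "Q k * S y k * (Q k)\<^sup>T *\<^sub>v v = Q k *\<^sub>v (S y k *\<^sub>v w)" for y
    unfolding w_def
    using assoc_mult_mat_vec[OF mult_carrier_mat[OF q(1) orthD(1)[OF s(1)[of y k]]] q(2) v]
      assoc_mult_mat_vec[OF q(1) orthD(1)[OF s(1)[of y k]] w] unfolding w_def by simp
  hence "(Q k * S t k * (Q k)\<^sup>T *\<^sub>v v - Q k * S x k * (Q k)\<^sup>T *\<^sub>v v) = Q k *\<^sub>v (S t k *\<^sub>v w - S x k *\<^sub>v w)"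
    using mult_minus_distrib_mat_vec[OF q(1) Sw Sw] by simp
  moreover have "(Q k *\<^sub>v (S t k *\<^sub>v w - S x k *\<^sub>v w)) \<bullet> (Q k *\<^sub>v (S t k *\<^sub>v w - S x k *\<^sub>v w))
      \<le> (\<delta> * (t - x))^2 * (v \<bullet> v)"
    using s(4)[OF w, of t k x] norm_mult_orth[OF Q, of "S t k *\<^sub>v w - S x k *\<^sub>v w" k] Sw
      norm_mult_orth[OF transpose_orth[OF Q] v, of k] unfolding w_def[symmetric] by simp
  ultimately show "(Q k * S t k * (Q k)\<^sup>T *\<^sub>v v - Q k * S x k * (Q k)\<^sup>T *\<^sub>v v) \<bullet>
    (Q k * S t k * (Q k)\<^sup>T *\<^sub>v v - Q k * S x k * (Q k)\<^sup>T *\<^sub>v v) \<le> (\<delta> * (t - x))^2 * (v \<bullet> v)" by simp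
qed

lemma rotation_family_diag:
  assumes S: "rotation_family p \<delta> S" and S': "rotation_family q \<delta> S'"
  shows "rotation_family (p + q) \<delta> (\<lambda>t k. four_block_mat (S t k) (0\<^sub>m p q) (0\<^sub>m q p) (S' t k))"
  unfolding rotation_family_def
proof (intro conjI allI ballI)
  note s = rotation_familyD[OF S] and s' = rotation_familyD[OF S']
  show "four_block_mat (S t k) (0\<^sub>m p q) (0\<^sub>m q p) (S' t k) \<in> orth (p + q)" for t k
    by (rule diag_block_orth[OF s(1) s'(1)])
  show "det (four_block_mat (S t k) (0\<^sub>m p q) (0\<^sub>m q p) (S' t k)) = 1" for t k
    using det_four_block_mat_lower_left_zero[OF orthD(1)[OF s(1)] zero_carrier_mat refl orthD(1)[OF s'(1)]] s(2) s'(2)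
    by simp
  show "four_block_mat (S 0 k) (0\<^sub>m p q) (0\<^sub>m q p) (S' 0 k) = 1\<^sub>m (p + q)" for k
    by (simp add: s(3) s'(3))
  fix x t k and v :: "real vec" assume v: "v \<in> carrier_vec (p + q)"
  define a where "a = vec_first v p"
  define b where "b = vec_last v q"
  have ab: "v = a @\<^sub>v b" "a \<in> carrier_vec p" "b \<in> carrier_vec q"
    unfolding a_def b_def using v by auto
  have m: "four_block_mat (S y k) (0\<^sub>m p q) (0\<^sub>m q p) (S' y k) *\<^sub>v v = (S y k *\<^sub>v a) @\<^sub>v (S' y k *\<^sub>v b)" for y
    unfolding ab(1) by (rule mult_mat_vec_split[OF orthD(1)[OF s(1)] orthD(1)[OF s'(1)] ab(2,3)])
  have c: "S y k *\<^sub>v a \<in> carrier_vec p" "S' y k *\<^sub>v b \<in> carrier_vec q" for y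
    by (rule mult_mat_vec_carrier[OF orthD(1)[OF s(1)] ab(2)], rule mult_mat_vec_carrier[OF orthD(1)[OF s'(1)] ab(3)])
  define e where "e = S t k *\<^sub>v a - S x k *\<^sub>v a"
  define f where "f = S' t k *\<^sub>v b - S' x k *\<^sub>v b"
  have ef: "e \<in> carrier_vec p" "f \<in> carrier_vec q" unfolding e_def f_def using c by auto
  have "((S t k *\<^sub>v a) @\<^sub>v (S' t k *\<^sub>v b)) - ((S x k *\<^sub>v a) @\<^sub>v (S' x k *\<^sub>v b)) = e @\<^sub>v f"
    unfolding e_def f_def by (rule eq_vecI)
      (use carrier_matD(1)[OF orthD(1)[OF s(1)]] carrier_matD(1)[OF orthD(1)[OF s'(1)]] in auto)
  moreover have "(e @\<^sub>v f) \<bullet> (e @\<^sub>v f) \<le> (\<delta> * (t - x))^2 * (v \<bullet> v)"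
    unfolding ab(1) scalar_prod_append[OF ef ef] scalar_prod_append[OF ab(2,3) ab(2,3)]
    using s(4)[OF ab(2), of t k x] s'(4)[OF ab(3), of t k x] unfolding e_def f_def
    by (simp add: distrib_left)
  ultimately show "(four_block_mat (S t k) (0\<^sub>m p q) (0\<^sub>m q p) (S' t k) *\<^sub>v v - four_block_mat (S x k) (0\<^sub>m p q) (0\<^sub>m q p) (S' x k) *\<^sub>v v) \<bullet>
    (four_block_mat (S t k) (0\<^sub>m p q) (0\<^sub>m q p) (S' t k) *\<^sub>v v - four_block_mat (S x k) (0\<^sub>m p q) (0\<^sub>m q p) (S' x k) *\<^sub>v v)
      \<le> (\<delta> * (t - x))^2 * (v \<bullet> v)" unfolding m by simp
qed

text \<open>If \<open>V\<close> maps a subspace bijectively to a subspace and \<open>U V\<close> maps it into a third one, then \<open>U\<close> maps the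
  second subspace into the third.\<close>

lemma block_upper_cancel:
  assumes V: "block_upper p q V" "det V \<noteq> 0" and U: "U \<in> carrier_mat (p + q) (p + q)" and UV: "block_upper p q (U * V)"
  shows "block_upper p q U"
proof -
  obtain a b c e where sp: "split_block U p p = (a, b, c, e)" by (cases "split_block U p p") auto
  note u = split_block[OF sp, of q q]
  have u: "a \<in> carrier_mat p p" "b \<in> carrier_mat p q" "c \<in> carrier_mat q p" "e \<in> carrier_mat q q"
    "U = four_block_mat a b c e" using u U by auto
  from V(1) obtain B X D where v: "B \<in> carrier_mat p p" "X \<in> carrier_mat p q" "D \<in> carrier_mat q q"
    "V = four_block_mat B X (0\<^sub>m q p) D" by (rule block_upperE)
  have "det B \<noteq> 0" using V(2) unfolding v(4) det_four_block_mat_lower_left_zero[OF v(1,2) refl v(3)] by simp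
  then obtain B' where B': "B' \<in> carrier_mat p p" "B * B' = 1\<^sub>m p" by (rule exists_mat_inverse[OF v(1)])
  from UV obtain B2 X2 D2 where uv: "B2 \<in> carrier_mat p p" "X2 \<in> carrier_mat p q" "D2 \<in> carrier_mat q q"
    "U * V = four_block_mat B2 X2 (0\<^sub>m q p) D2" by (rule block_upperE)
  have cB: "c * B = 0\<^sub>m q p"
  proof (rule eq_matI)
    fix i j assume ij: "i < dim_row (0\<^sub>m q p :: real mat)" "j < dim_col (0\<^sub>m q p :: real mat)"
    have "U * V = four_block_mat (a * B + b * 0\<^sub>m q p) (a * X + b * D) (c * B + e * 0\<^sub>m q p) (c * X + e * D)"
      unfolding u(5) v(4) by (rule mult_four_block_mat) (use u v in auto)
    hence "(U * V) $$ (p + i, j) = (c * B + e * 0\<^sub>m q p) $$ (i, j)" using ij u v by simp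
    moreover have "(U * V) $$ (p + i, j) = 0" unfolding uv(4) using ij uv by simp
    moreover have "c * B + e * 0\<^sub>m q p = c * B" using u v by simp
    ultimately show "(c * B) $$ (i, j) = 0\<^sub>m q p $$ (i, j)" using ij by simp
  qed (use u v in auto)
  have "c = c * (B * B')" using B' u by simp
  also have "\<dots> = c * B * B'" by (rule assoc_mult_mat[OF u(3) v(1) B'(1), symmetric])
  also have "\<dots> = 0\<^sub>m q p" unfolding cB using B' by simp
  finally show ?thesis unfolding block_upper_def using u by blast
qed

lemma det_seq_prod_nonzero:
  assumes "\<And>k. A k \<in> carrier_mat d d" "\<And>k. det (A k) \<noteq> 0"
  shows "det (seq_prod d A l) \<noteq> 0"
  using assms(2) by (simp add: det_seq_prod[OF assms(1)])

text \<open>An invariant subspace of the product is transported along the cocycle; \<open>Q k\<close> are orthonormal frames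
  adapted to its images.  The frames are built one after the other, except that the last one is
  prescribed to be the initial one, which is legitimate because the subspace is invariant under the
  whole product.  The set \<open>\<Q>\<close> of admissible frames is either the orthogonal group or its symplectic
  part.\<close>

lemma orth_chain:
  assumes O: "\<Q> \<subseteq> orth (p + q)" and Q0: "Q0 \<in> \<Q>"
    and A: "\<And>k. A k \<in> carrier_mat (p + q) (p + q)" "\<And>k. det (A k) \<noteq> 0"
    and step: "\<And>k Q. Q \<in> \<Q> \<Longrightarrow> \<exists>Q' \<in> \<Q>. block_upper p q (Q'\<^sup>T * A k * Q)"
    and closed: "block_upper p q (Q0\<^sup>T * seq_prod (p + q) A l * Q0)" and l: "l \<ge> 1"
  obtains Q where "\<And>k. Q k \<in> \<Q>" "Q 0 = Q0" "Q l = Q0"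
    "\<And>k. 1 \<le> k \<Longrightarrow> k \<le> l \<Longrightarrow> block_upper p q ((Q k)\<^sup>T * A k * Q (k - 1))"
proof -
  let ?d = "p + q"
  define f where "f k Q = (SOME Q'. Q' \<in> \<Q> \<and> block_upper p q (Q'\<^sup>T * A k * Q))" for k Q
  have f: "f k Q \<in> \<Q> \<and> block_upper p q ((f k Q)\<^sup>T * A k * Q)" if "Q \<in> \<Q>" for k Q
    unfolding f_def by (rule someI_ex) (use step[OF that] in blast)
  define R where "R = rec_nat Q0 (\<lambda>k Q. f (Suc k) Q)"
  have R0: "R 0 = Q0" and RS: "R (Suc k) = f (Suc k) (R k)" for k unfolding R_def by simp_all
  have R: "R k \<in> \<Q>" for k by (induction k) (use Q0 f in \<open>auto simp: R0 RS\<close>)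
  have Rb: "block_upper p q ((R (Suc k))\<^sup>T * A (Suc k) * R k)" for k using f[OF R] unfolding RS by blast
  have Ro: "R k \<in> orth ?d" for k using R O by blast
  note r = orthD(1,2)[OF Ro]
  have P: "seq_prod ?d A k \<in> carrier_mat ?d ?d" for k by (rule seq_prod_carrier[OF A(1)])
  have V: "block_upper p q ((R k)\<^sup>T * seq_prod ?d A k * Q0)" for k
  proof (induction k)
    case 0
    have "(R 0)\<^sup>T * seq_prod ?d A 0 * Q0 = 1\<^sub>m ?d" using orthD[OF Ro[of 0]] by (simp add: R0)
    thus ?case by (simp add: block_upperI)
  next
    case (Suc k)
    have "((R (Suc k))\<^sup>T * A (Suc k) * R k) * ((R k)\<^sup>T * seq_prod ?d A k * Q0)
      = (R (Suc k))\<^sup>T * (A (Suc k) * (R k * ((R k)\<^sup>T * (seq_prod ?d A k * Q0))))"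
      using r[of k] r[of "Suc k"] A(1)[of "Suc k"] P[of k] r(1)[of 0] unfolding R0
      by (simp add: assoc_mult_mat[of _ ?d ?d _ ?d _ ?d])
    also have "R k * ((R k)\<^sup>T * (seq_prod ?d A k * Q0)) = seq_prod ?d A k * Q0"
      by (rule conj_orth_cancel(2)[OF Ro mult_carrier_mat[OF P r(1)[of 0, unfolded R0]]])
    also have "(R (Suc k))\<^sup>T * (A (Suc k) * (seq_prod ?d A k * Q0)) = (R (Suc k))\<^sup>T * seq_prod ?d A (Suc k) * Q0"
      using r[of "Suc k"] A(1)[of "Suc k"] P[of k] r(1)[of 0] unfolding R0
      by (simp add: assoc_mult_mat[of _ ?d ?d _ ?d _ ?d])
    finally have eq: "((R (Suc k))\<^sup>T * A (Suc k) * R k) * ((R k)\<^sup>T * seq_prod ?d A k * Q0)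
      = (R (Suc k))\<^sup>T * seq_prod ?d A (Suc k) * Q0" .
    show ?case using block_upper_mult[OF Rb[of k] Suc] unfolding eq .
  qed
  obtain m where m: "l = Suc m" using l by (cases l) auto
  have q0: "Q0 \<in> carrier_mat ?d ?d" "Q0\<^sup>T \<in> carrier_mat ?d ?d" using r[of 0] unfolding R0 by auto
  define U where "U = Q0\<^sup>T * A l * R m"
  have "U * ((R m)\<^sup>T * seq_prod ?d A m * Q0) = Q0\<^sup>T * (A l * (R m * ((R m)\<^sup>T * (seq_prod ?d A m * Q0))))"
    unfolding U_def using q0 r[of m] A(1)[of l] P[of m] by (simp add: assoc_mult_mat[of _ ?d ?d _ ?d _ ?d])
  also have "R m * ((R m)\<^sup>T * (seq_prod ?d A m * Q0)) = seq_prod ?d A m * Q0"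
    by (rule conj_orth_cancel(2)[OF Ro mult_carrier_mat[OF P q0(1)]])
  also have "Q0\<^sup>T * (A l * (seq_prod ?d A m * Q0)) = Q0\<^sup>T * seq_prod ?d A l * Q0"
    unfolding m using q0 A(1)[of "Suc m"] P[of m] by (simp add: assoc_mult_mat[of _ ?d ?d _ ?d _ ?d])
  finally have UV: "block_upper p q (U * ((R m)\<^sup>T * seq_prod ?d A m * Q0))" using closed by simp
  have "det ((R m)\<^sup>T * seq_prod ?d A m * Q0) \<noteq> 0"
    using det_orth_nonzero[OF Ro[of 0]] det_orth_nonzero[OF transpose_orth[OF Ro[of m]]]
      det_seq_prod_nonzero[OF A] q0 r[of m] P[of m] unfolding R0
    by (simp add: det_mult[of _ ?d])
  from block_upper_cancel[OF V this _ UV] have Ub: "block_upper p q U"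
    unfolding U_def using q0 r[of m] A(1)[of l] by auto
  define Q where "Q k = (if k = l then Q0 else R k)" for k
  show thesis
  proof (rule that)
    show "Q k \<in> \<Q>" for k unfolding Q_def using Q0 R by simp
    show "Q 0 = Q0" "Q l = Q0" unfolding Q_def R0 by simp_all
    show "block_upper p q ((Q k)\<^sup>T * A k * Q (k - 1))" if "1 \<le> k" "k \<le> l" for k
    proof (cases "k = l")
      case True
      thus ?thesis using Ub unfolding U_def Q_def m by simp
    next
      case False
      moreover have "k - 1 \<noteq> l" using that by simp
      ultimately show ?thesis using that Rb[of "k - 1"] unfolding Q_def by simp
    qed
  qed
qed

text \<open>Outside \<open>{1..l}\<close> identity blocks serve as default, so that all sequences consist of invertible
  matrices.\<close>

lemma block_upper_sequence:
  assumes U: "\<forall>k \<in> {1..l}. block_upper p q (U k)" and det: "\<And>k. det (U k) \<noteq> 0"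
  shows "\<exists>B X D. (\<forall>k. B k \<in> carrier_mat p p \<and> X k \<in> carrier_mat p q \<and> D k \<in> carrier_mat q q \<and>
      det (B k) \<noteq> 0 \<and> det (D k) \<noteq> 0) \<and>
    (\<forall>k \<in> {1..l}. U k = four_block_mat (B k) (X k) (0\<^sub>m q p) (D k))"
proof -
  have "\<exists>B X D. B \<in> carrier_mat p p \<and> X \<in> carrier_mat p q \<and> D \<in> carrier_mat q q \<and> det B \<noteq> 0 \<and> det D \<noteq> 0 \<and>
    (k \<in> {1..l} \<longrightarrow> U k = four_block_mat B X (0\<^sub>m q p) D)" for k
  proof (cases "k \<in> {1..l}")
    case True
    with U have "block_upper p q (U k)" by simp
    then obtain B X D where b: "B \<in> carrier_mat p p" "X \<in> carrier_mat p q" "D \<in> carrier_mat q q"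
      "U k = four_block_mat B X (0\<^sub>m q p) D" by (rule block_upperE)
    from det[of k] have "det B \<noteq> 0" "det D \<noteq> 0"
      unfolding b(4) det_four_block_mat_lower_left_zero[OF b(1,2) refl b(3)] by auto
    with b show ?thesis by blast
  next
    case False
    have "1\<^sub>m p \<in> carrier_mat p p" "0\<^sub>m p q \<in> carrier_mat p q" "1\<^sub>m q \<in> carrier_mat q q"
      "det (1\<^sub>m p :: real mat) \<noteq> 0" "det (1\<^sub>m q :: real mat) \<noteq> 0" by auto
    with False show ?thesis by blast
  qed
  thus ?thesis by metis
qed

text \<open>Rotations that preserve the invariant subspace and its orthogonal complement act separately on
  the restriction \<open>B\<close> and on the quotient \<open>D\<close>, regardless of the coupling \<open>X\<close>.\<close>

lemma eigenvals_block_cocycle: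
  assumes A: "\<And>k. A k \<in> carrier_mat (p + q) (p + q)" and Q: "\<And>k. Q k \<in> orth (p + q)" "Q l = Q 0"
    and U: "\<forall>k \<in> {1..l}. (Q k)\<^sup>T * A k * Q (k - 1) = four_block_mat (B k) (X k) (0\<^sub>m q p) (D k)"
    and c: "\<And>k. B k \<in> carrier_mat p p" "\<And>k. X k \<in> carrier_mat p q" "\<And>k. D k \<in> carrier_mat q q"
    and S: "\<And>k. S k \<in> carrier_mat p p" "\<And>k. S' k \<in> carrier_mat q q"
  shows "eigenvals (seq_prod (p + q) (\<lambda>k. (Q k * four_block_mat (S k) (0\<^sub>m p q) (0\<^sub>m q p) (S' k) * (Q k)\<^sup>T) * A k) l)
    = eigenvals (seq_prod p (\<lambda>k. S k * B k) l) + eigenvals (seq_prod q (\<lambda>k. S' k * D k) l)"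
proof -
  let ?d = "p + q"
  let ?F = "\<lambda>k. four_block_mat (S k) (0\<^sub>m p q) (0\<^sub>m q p) (S' k)"
  have F: "?F k \<in> carrier_mat ?d ?d" for k by (rule four_block_carrier_mat[OF S])
  have "seq_prod ?d (\<lambda>k. ?F k * ((Q k)\<^sup>T * A k * Q (k - 1))) l
    = seq_prod ?d (\<lambda>k. four_block_mat (S k * B k) (S k * X k) (0\<^sub>m q p) (S' k * D k)) l"
  proof (rule seq_prod_cong)
    fix k assume k: "1 \<le> k" "k \<le> l"
    have Uk: "(Q k)\<^sup>T * A k * Q (k - 1) = four_block_mat (B k) (X k) (0\<^sub>m q p) (D k)" using U k by simp
    have "?F k * ((Q k)\<^sup>T * A k * Q (k - 1)) = four_block_mat (S k * B k) (S k * X k + 0\<^sub>m p q * D k) (0\<^sub>m q p) (S' k * D k)"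
      unfolding Uk by (rule mult_block_upper[OF S(1) zero_carrier_mat S(2) c])
    thus "?F k * ((Q k)\<^sup>T * A k * Q (k - 1)) = four_block_mat (S k * B k) (S k * X k) (0\<^sub>m q p) (S' k * D k)"
      using left_add_zero_mat right_add_zero_mat[OF mult_carrier_mat[OF S(1) c(2)]] left_mult_zero_mat[OF c(3)] by simp
  qed
  moreover obtain Y where Y: "Y \<in> carrier_mat p q"
    "seq_prod ?d (\<lambda>k. four_block_mat (S k * B k) (S k * X k) (0\<^sub>m q p) (S' k * D k)) l
     = four_block_mat (seq_prod p (\<lambda>k. S k * B k) l) Y (0\<^sub>m q p) (seq_prod q (\<lambda>k. S' k * D k) l)"
    using seq_prod_block_upper[of "\<lambda>k. S k * B k" p "\<lambda>k. S k * X k" q "\<lambda>k. S' k * D k" l]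
      mult_carrier_mat[OF S(1) c(1)] mult_carrier_mat[OF S(1) c(2)] mult_carrier_mat[OF S(2) c(3)] by blast
  ultimately have eq: "seq_prod ?d (\<lambda>k. ?F k * ((Q k)\<^sup>T * A k * Q (k - 1))) l
     = four_block_mat (seq_prod p (\<lambda>k. S k * B k) l) Y (0\<^sub>m q p) (seq_prod q (\<lambda>k. S' k * D k) l)" by simp
  have pc: "seq_prod p (\<lambda>k. S k * B k) l \<in> carrier_mat p p" "seq_prod q (\<lambda>k. S' k * D k) l \<in> carrier_mat q q"
    by (rule seq_prod_carrier[OF mult_carrier_mat[OF S(1) c(1)]], rule seq_prod_carrier[OF mult_carrier_mat[OF S(2) c(3)]])
  have "seq_prod ?d (\<lambda>k. (Q k * ?F k * (Q k)\<^sup>T) * A k) l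
    = ((Q 0)\<^sup>T)\<^sup>T * four_block_mat (seq_prod p (\<lambda>k. S k * B k) l) Y (0\<^sub>m q p) (seq_prod q (\<lambda>k. S' k * D k) l) * (Q 0)\<^sup>T"
    using seq_prod_conj[of A ?d ?F Q l, OF A F Q(1)] unfolding eq Q(2) by simp
  thus ?thesis
    using eigenvals_conj_orth[OF transpose_orth[OF Q(1)[of 0]] four_block_carrier_mat[OF pc]] eigenvals_block_upper[OF pc(1) Y(1) pc(2)]
    by simp
qed

text \<open>Induction on the dimension: for a nonreal eigenvalue the corresponding invariant plane is
  transported along the cocycle, the planar result treats the restriction to it and the induction
  hypothesis the quotient.  The angle budget is the same in all dimensions, as the rotations act
  in orthogonal planes.\<close>

theorem exists_realifying_rotations:
  assumes "\<And>k. A k \<in> carrier_mat d d" "\<And>k. det (A k) \<noteq> 0" and l: "l \<ge> 1" "pi \<le> \<delta> * real l"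
  shows "\<exists>S. rotation_family d \<delta> S \<and> realifies d l A S"
  using assms(1,2)
proof (induction d arbitrary: A rule: less_induct)
  case (less d)
  note A = less.prems
  let ?M = "seq_prod d A l"
  have M: "?M \<in> carrier_mat d d" by (rule seq_prod_carrier[OF A(1)])
  show ?case
  proof (cases "\<forall>z \<in># eigenvals ?M. Im z = 0")
    case True
    hence "realifies d l A (\<lambda>t k. 1\<^sub>m d)" by (intro realifies_one A) (auto simp: complex_is_Real_iff)
    thus ?thesis using rotation_family_one by blast
  next
    case False
    then obtain z where z: "z \<in># eigenvals ?M" "Im z \<noteq> 0" by blast
    obtain Q0 B0 X0 D0 n where d: "d = 2 + n" and Q0: "Q0 \<in> orth d"
      and "Q0\<^sup>T * ?M * Q0 = four_block_mat B0 X0 (0\<^sub>m n 2) D0"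
      "B0 \<in> carrier_mat 2 2" "X0 \<in> carrier_mat 2 n" "D0 \<in> carrier_mat n n"
      by (rule split_nonreal_eigenvalue[OF M z])
    hence bu: "block_upper 2 n (Q0\<^sup>T * ?M * Q0)" unfolding block_upper_def by blast
    have step: "\<exists>Q' \<in> orth d. block_upper 2 n (Q'\<^sup>T * A k * Q)" if Q: "Q \<in> orth d" for k Q
    proof -
      have AQ: "A k * Q \<in> carrier_mat d d" using A(1)[of k] orthD(1)[OF Q] by simp
      from qr_decomposition[OF this] obtain Q' where Q': "Q' \<in> orth d" "upper_triangular (Q'\<^sup>T * (A k * Q))" by blast
      have "block_upper 2 n (Q'\<^sup>T * (A k * Q))"
        by (rule upper_triangular_block_upper) (use Q' AQ orthD(2)[OF Q'(1)] d in auto)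
      moreover have "Q'\<^sup>T * (A k * Q) = Q'\<^sup>T * A k * Q"
        by (rule assoc_mult_mat[symmetric, OF orthD(2)[OF Q'(1)] A(1) orthD(1)[OF Q]])
      ultimately show ?thesis using Q'(1) by auto
    qed
    obtain Q where Q: "\<And>k. Q k \<in> orth d" "Q 0 = Q0" "Q l = Q0"
      "\<And>k. 1 \<le> k \<Longrightarrow> k \<le> l \<Longrightarrow> block_upper 2 n ((Q k)\<^sup>T * A k * Q (k - 1))"
      by (rule orth_chain[of "orth d" 2 n Q0 A l]) (use Q0 A step bu l(1) d in auto)
    have dU: "det ((Q k)\<^sup>T * A k * Q (k - 1)) \<noteq> 0" for k
      using det_orth_nonzero[OF transpose_orth[OF Q(1)[of k]]] det_orth_nonzero[OF Q(1)[of "k - 1"]]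
        A[of k] orthD(1,2)[OF Q(1)[of k]] orthD(1)[OF Q(1)[of "k - 1"]] by (simp add: det_mult[of _ d])
    have bQ: "\<forall>k \<in> {1..l}. block_upper 2 n ((Q k)\<^sup>T * A k * Q (k - 1))" using Q(4) by simp
    obtain B X D where bb: "\<forall>k. B k \<in> carrier_mat 2 2 \<and> X k \<in> carrier_mat 2 n \<and> D k \<in> carrier_mat n n \<and>
        det (B k) \<noteq> 0 \<and> det (D k) \<noteq> 0"
      "\<forall>k \<in> {1..l}. (Q k)\<^sup>T * A k * Q (k - 1) = four_block_mat (B k) (X k) (0\<^sub>m n 2) (D k)"
      using block_upper_sequence[of l 2 n "\<lambda>k. (Q k)\<^sup>T * A k * Q (k - 1)", OF bQ dU] by blast
    have b: "B k \<in> carrier_mat 2 2" "X k \<in> carrier_mat 2 n" "D k \<in> carrier_mat n n" "det (B k) \<noteq> 0" "det (D k) \<noteq> 0" for k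
      using bb(1) by blast+
    obtain S1 where S1: "rotation_family 2 \<delta> S1" "realifies 2 l B S1" using exists_realifying_rotations_2x2[of B l \<delta>, OF b(1,4) l] by blast
    have "n < d" using d by simp
    from less.IH[of n D, OF this b(3,5)] obtain S2 where S2: "rotation_family n \<delta> S2" "realifies n l D S2" by blast
    define S where "S t k = Q k * four_block_mat (S1 t k) (0\<^sub>m 2 n) (0\<^sub>m n 2) (S2 t k) * (Q k)\<^sup>T" for t k
    have S: "rotation_family d \<delta> S"
      unfolding S_def[abs_def] using rotation_family_conj[OF rotation_family_diag[OF S1(1) S2(1)], of Q] Q(1) unfolding d by simp
    have cr: "eigenvals (seq_prod d (\<lambda>k. S t k * A k) l)
        = eigenvals (seq_prod 2 (\<lambda>k. S1 t k * B k) l) + eigenvals (seq_prod n (\<lambda>k. S2 t k * D k) l)" for t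
      unfolding S_def d
      by (rule eigenvals_block_cocycle[of A 2 n Q l B X D])
        (use A(1) Q(1) in \<open>simp_all add: Q(2,3) bb(2)[unfolded One_nat_def] b d orthD(1)[OF rotation_familyD(1)[OF S1(1)]]
          orthD(1)[OF rotation_familyD(1)[OF S2(1)]]\<close>)
    have z0: "(\<lambda>k. S 0 k * A k) = A" "(\<lambda>k. S1 0 k * B k) = B" "(\<lambda>k. S2 0 k * D k) = D"
      using rotation_familyD(3)[OF S] rotation_familyD(3)[OF S1(1)] rotation_familyD(3)[OF S2(1)]
        left_mult_one_mat[OF A(1)] left_mult_one_mat[OF b(1)] left_mult_one_mat[OF b(3)] by auto
    have cr0: "eigenvals (seq_prod d A l) = eigenvals (seq_prod 2 B l) + eigenvals (seq_prod n D l)" using cr[of 0] unfolding z0 .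
    have "realifies d l A S"
      using S1(2) S2(2) unfolding realifies_def cr cr0 by auto
    with S show ?thesis by blast
  qed
qed

section \<open>Symplectic cocycles\<close>

lemma mult_mat_index_sum:
  assumes "M \<in> carrier_mat n m" "N \<in> carrier_mat m r" "i < n" "j < r"
  shows "(M * N) $$ (i,j) = (\<Sum>k<m. M $$ (i,k) * N $$ (k,j))"
  using assms by (simp add: scalar_prod_def lessThan_atLeast0)

text \<open>In a complex basis in which \<open>B\<close> becomes an upper triangular \<open>U\<close>, the entry \<open>(i,j)\<close> of the equation expresses
  \<open>Z\<^sub>i\<^sub>j\<close> by \<open>U\<^sub>i\<^sub>i Z\<^sub>i\<^sub>j U\<^sub>j\<^sub>j\<close> and entries with smaller index sum.\<close>

lemma stein_equation_zero:
  assumes B: "B \<in> carrier_mat p p" and X: "X \<in> carrier_mat p p" and eq: "B\<^sup>T * X * B = X"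
    and ev: "\<And>a b. a \<in># eigenvals B \<Longrightarrow> b \<in># eigenvals B \<Longrightarrow> a * b \<noteq> 1"
  shows "X = 0\<^sub>m p p"
proof -
  let ?c = "map_mat complex_of_real"
  have Bc: "?c B \<in> carrier_mat p p" and Xc: "?c X \<in> carrier_mat p p" using B X by auto
  have BT: "(?c B)\<^sup>T = ?c (B\<^sup>T)" by (rule eq_matI) auto
  have BTc: "B\<^sup>T \<in> carrier_mat p p" "(?c B)\<^sup>T \<in> carrier_mat p p" using B by auto
  have eqc: "(?c B)\<^sup>T * ?c X * ?c B = ?c X"
    using arg_cong[OF eq, of ?c] unfolding BT
    by (simp add: of_real_hom.mat_hom_mult[OF mult_carrier_mat[OF BTc(1) X] B] of_real_hom.mat_hom_mult[OF BTc(1) X])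
  obtain as where "char_poly (?c B) = (\<Prod>a\<leftarrow>as. [:- a, 1:])"
    using char_poly_factorized[OF Bc] by blast
  from schur_decomposition_exists[OF Bc this] obtain U where U: "U \<in> carrier_mat p p" "upper_triangular U" "similar_mat (?c B) U"
    by blast
  then obtain P R where "similar_mat_wit (?c B) U P R" unfolding similar_mat_def by blast
  from similar_mat_witD2[OF Bc this] have PR: "P * R = 1\<^sub>m p" "R * P = 1\<^sub>m p" "?c B = P * U * R"
    "P \<in> carrier_mat p p" "R \<in> carrier_mat p p" by auto
  have diag: "U $$ (i,i) \<in># eigenvals B" if "i < p" for i
  proof -
    have "eigenvals B = proots (\<Prod>a\<leftarrow>diag_mat U. [:- a, 1:])"
      unfolding eigenvals_def char_poly_similar[OF U(3)] char_poly_upper_triangular[OF U(1,2)] ..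
    also have "\<dots> = mset (diag_mat U)"
    proof -
      have "proots (\<Prod>a\<leftarrow>as. [:- a, 1:]) = mset as" for as :: "complex list"
      proof (induction as)
        case (Cons a as)
        have "(\<Prod>a\<leftarrow>as. [:- a, 1:]) \<noteq> 0" by (auto simp: prod_list_zero_iff)
        thus ?case using Cons proots_mult[of "[:- a, 1:]" "\<Prod>a\<leftarrow>as. [:- a, 1:]"] by simp
      qed simp
      thus ?thesis .
    qed
    finally show ?thesis using that U(1) unfolding diag_mat_def by auto
  qed
  define Z where "Z = P\<^sup>T * ?c X * P"
  have PT: "P\<^sup>T \<in> carrier_mat p p" "U\<^sup>T \<in> carrier_mat p p" "R\<^sup>T \<in> carrier_mat p p" using PR U by auto
  have Z: "Z \<in> carrier_mat p p" unfolding Z_def using PR(4) PT Xc by auto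
  have PU: "P * U = ?c B * P"
  proof -
    have "?c B * P = P * U * (R * P)" unfolding PR(3) using PR(4,5) U(1) by (intro assoc_mult_mat) auto
    thus ?thesis using PR(2) PR(4) U(1) by simp
  qed
  have "U\<^sup>T * Z * U = (P * U)\<^sup>T * ?c X * (P * U)"
    unfolding Z_def transpose_mult[OF PR(4) U(1)] using PR(4) U(1) PT Xc
    by (simp add: assoc_mult_mat[of _ p p _ p _ p])
  also have "\<dots> = P\<^sup>T * ((?c B)\<^sup>T * ?c X * ?c B) * P"
    unfolding PU transpose_mult[OF Bc PR(4)] using PR(4) Bc BTc PT Xc
    by (simp add: assoc_mult_mat[of _ p p _ p _ p])
  finally have ZU: "U\<^sup>T * Z * U = Z" unfolding eqc Z_def .
  have Zsum: "Z $$ (i,j) = (\<Sum>k<p. \<Sum>m<p. U $$ (k,i) * Z $$ (k,m) * U $$ (m,j))" if ij: "i < p" "j < p" for i j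
  proof -
    have UZ: "U\<^sup>T * Z \<in> carrier_mat p p" using PT Z by auto
    have "Z $$ (i,j) = (\<Sum>m<p. (U\<^sup>T * Z) $$ (i,m) * U $$ (m,j))"
      using mult_mat_index_sum[OF UZ U(1) ij] unfolding ZU .
    also have "\<dots> = (\<Sum>m<p. (\<Sum>k<p. U $$ (k,i) * Z $$ (k,m)) * U $$ (m,j))"
      by (rule sum.cong) (use ij U Z in \<open>auto simp: scalar_prod_def lessThan_atLeast0\<close>)
    also have "\<dots> = (\<Sum>k<p. \<Sum>m<p. U $$ (k,i) * Z $$ (k,m) * U $$ (m,j))"
      unfolding sum_distrib_right by (rule sum.swap)
    finally show ?thesis .
  qed
  have Z0: "i < p \<Longrightarrow> j < p \<Longrightarrow> Z $$ (i,j) = 0" for i j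
  proof (induction "i + j" arbitrary: i j rule: less_induct)
    case less
    have entry: "U $$ (k,i) * Z $$ (k,m) * U $$ (m,j)
       = (if k = i then if m = j then U $$ (i,i) * Z $$ (i,j) * U $$ (j,j) else 0 else 0)" if "k < p" "m < p" for k m
    proof (cases "k \<le> i \<and> m \<le> j")
      case False
      hence "U $$ (k,i) = 0 \<or> U $$ (m,j) = 0"
        using upper_triangularD[OF U(2)] that U(1) by (metis carrier_matD(1) not_le)
      thus ?thesis using False by auto
    next
      case True
      show ?thesis
      proof (cases "k = i \<and> m = j")
        case False
        with True have "k + m < i + j" by auto
        thus ?thesis using less.hyps[of k m] that False by auto
      qed auto
    qed
    have "Z $$ (i,j) = (\<Sum>k<p. \<Sum>m<p. if k = i then if m = j then U $$ (i,i) * Z $$ (i,j) * U $$ (j,j) else 0 else 0)"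
      by (rule trans[OF Zsum[OF less.prems]], rule sum.cong[OF refl], rule sum.cong[OF refl], rule entry) auto
    also have "\<dots> = (\<Sum>k<p. if k = i then U $$ (i,i) * Z $$ (i,j) * U $$ (j,j) else 0)"
      by (rule sum.cong) (use less.prems in auto)
    also have "\<dots> = U $$ (i,i) * Z $$ (i,j) * U $$ (j,j)" using less.prems by simp
    finally have "Z $$ (i,j) * (1 - U $$ (i,i) * U $$ (j,j)) = 0" by (simp add: algebra_simps)
    thus ?case using ev[OF diag diag] less.prems by simp
  qed
  have "Z = 0\<^sub>m p p" by (rule eq_matI) (use Z Z0 in auto)
  moreover have "?c X = R\<^sup>T * Z * R"
  proof -
    have "R\<^sup>T * Z * R = (P * R)\<^sup>T * ?c X * (P * R)"
      unfolding Z_def transpose_mult[OF PR(4,5)] using PR(4,5) PT Xc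
      by (simp add: assoc_mult_mat[of _ p p _ p _ p])
    thus ?thesis unfolding PR(1) using Xc by simp
  qed
  ultimately have "?c X = 0\<^sub>m p p" using PT PR by simp
  thus ?thesis
  proof (intro eq_matI)
    fix i j assume c0: "?c X = 0\<^sub>m p p" and ij: "i < dim_row (0\<^sub>m p p :: real mat)" "j < dim_col (0\<^sub>m p p :: real mat)"
    from arg_cong[OF c0, of "\<lambda>M. M $$ (i,j)"] ij X show "X $$ (i,j) = 0\<^sub>m p p $$ (i,j)" by simp
  qed (use X in auto)
qed

text \<open>Here \<open>D\<^sup>T\<close> is the inverse of \<open>B\<close>, and \<open>det (x - D) det B = (- x)\<^sup>n det (1/x - B)\<close> for \<open>x \<noteq> 0\<close>.  Comparing the factorizations
  gives the eigenvalues with multiplicity.\<close>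

lemma eigenvals_inverse_transpose:
  assumes B: "B \<in> carrier_mat n n" and D: "D \<in> carrier_mat n n" and BD: "B\<^sup>T * D = 1\<^sub>m n"
  shows "eigenvals D = image_mset inverse (eigenvals B)"
proof -
  let ?c = "map_mat complex_of_real"
  define b where "b = ?c B"
  define e where "e = (?c D)\<^sup>T"
  have b: "b \<in> carrier_mat n n" and e: "e \<in> carrier_mat n n" unfolding b_def e_def using B D by auto
  have "D\<^sup>T * B = (B\<^sup>T * D)\<^sup>T" using B D by (simp add: transpose_mult[of _ n n _ n])
  hence DB: "D\<^sup>T * B = 1\<^sub>m n" unfolding BD by simp
  have "e = ?c (D\<^sup>T)" unfolding e_def by (rule eq_matI) auto
  hence "e * b = ?c (D\<^sup>T * B)" unfolding b_def
    using D by (simp add: of_real_hom.mat_hom_mult[OF _ B, of "D\<^sup>T" n])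
  hence eb: "e * b = 1\<^sub>m n" unfolding DB by (simp add: of_real_hom.mat_hom_one)
  define p where "p = char_poly b"
  define q where "q = char_poly e"
  have q: "q = char_poly (?c D)" unfolding q_def e_def using D by simp
  have detb: "det b \<noteq> 0" "det e * det b = 1" using det_mult[OF e b] unfolding eb by auto
  have crB: "eigenvals B = proots p" unfolding eigenvals_def p_def b_def ..
  have crD: "eigenvals D = proots q" unfolding eigenvals_def q ..
  have ev: "poly p x = det (x \<cdot>\<^sub>m 1\<^sub>m n - b)" "poly q x = det (x \<cdot>\<^sub>m 1\<^sub>m n - e)" for x
  proof -
    have "- (char_matrix b x) = x \<cdot>\<^sub>m 1\<^sub>m n - b" "- (char_matrix e x) = x \<cdot>\<^sub>m 1\<^sub>m n - e"
      using b e by (auto intro!: eq_matI simp: char_matrix_def)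
    thus "poly p x = det (x \<cdot>\<^sub>m 1\<^sub>m n - b)" "poly q x = det (x \<cdot>\<^sub>m 1\<^sub>m n - e)"
      unfolding p_def q_def char_poly_matrix[OF b] char_poly_matrix[OF e] by simp_all
  qed
  have rel: "poly q x * det b = (- x) ^ n * poly p (inverse x)" if x: "x \<noteq> 0" for x
  proof -
    have m: "x \<cdot>\<^sub>m 1\<^sub>m n - e \<in> carrier_mat n n" "inverse x \<cdot>\<^sub>m 1\<^sub>m n - b \<in> carrier_mat n n"
      by (rule minus_carrier_mat[OF e], rule minus_carrier_mat[OF b])
    have "(x \<cdot>\<^sub>m 1\<^sub>m n - e) * b = (x \<cdot>\<^sub>m 1\<^sub>m n) * b - e * b"
      by (rule minus_mult_distrib_mat) (use b e in auto)
    also have "(x \<cdot>\<^sub>m 1\<^sub>m n) * b = x \<cdot>\<^sub>m b"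
      using mult_smult_assoc_mat[OF one_carrier_mat b] left_mult_one_mat[OF b] by simp
    also have "x \<cdot>\<^sub>m b - e * b = (- x) \<cdot>\<^sub>m (inverse x \<cdot>\<^sub>m 1\<^sub>m n - b)"
      unfolding eb using b x by (intro eq_matI) (auto simp: algebra_simps)
    finally have "det (x \<cdot>\<^sub>m 1\<^sub>m n - e) * det b = det ((- x) \<cdot>\<^sub>m (inverse x \<cdot>\<^sub>m 1\<^sub>m n - b))"
      using det_mult[OF m(1) b] by simp
    thus ?thesis unfolding ev using m(2) b by simp
  qed
  have p1: "lead_coeff p = 1" "degree p = n" unfolding p_def using degree_monic_char_poly[OF b] by auto
  have pdec: "p = (\<Prod>a\<in>#proots p. [:- a, 1:])" using complex_poly_decompose_multiset[of p] p1 by simp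
  have sz: "size (proots p) = n" using size_proots_complex[of p] p1 by simp
  have a0: "a \<noteq> 0" if "a \<in># proots p" for a
  proof
    assume "a = 0"
    hence "poly p 0 = 0" using that char_poly_nonzero[OF b] unfolding p_def by simp
    moreover have "(0::complex) \<cdot>\<^sub>m 1\<^sub>m n - b = (- 1) \<cdot>\<^sub>m b" using b by (intro eq_matI) auto
    ultimately show False unfolding ev using detb by simp
  qed
  have fac: "(- x) ^ size M * poly (\<Prod>a\<in>#M. [:- a, 1:]) (inverse x)
      = (\<Prod>a\<in>#M. a) * poly (\<Prod>a\<in>#M. [:- inverse a, 1:]) x"
    if "x \<noteq> 0" "\<forall>a\<in>#M. a \<noteq> 0" for M and x :: complex
    using that(2)
  proof (induction M)
    case (add a M)
    have "(- x) * (inverse x - a) = a * (x - inverse a)" using that(1) add.prems by (simp add: field_simps)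
    thus ?case using add by (simp add: algebra_simps)
  qed simp
  define r where "r = Polynomial.smult ((\<Prod>a\<in>#proots p. a) * inverse (det b)) (\<Prod>a\<in>#proots p. [:- inverse a, 1:])"
  \<comment> \<open>the factor \<open>[:0, 1:]\<close> makes the two sides agree at \<open>0\<close> as well\<close>
  have "[:0, 1:] * q = [:0, 1:] * r"
  proof (rule poly_ext)
    fix x
    show "poly ([:0, 1:] * q) x = poly ([:0, 1:] * r) x"
    proof (cases "x = 0")
      case False
      have "poly q x * det b = (\<Prod>a\<in>#proots p. a) * poly (\<Prod>a\<in>#proots p. [:- inverse a, 1:]) x"
        using rel[OF False] fac[OF False, of "proots p"] a0 unfolding sz pdec[symmetric] by simp
      hence "poly q x = poly r x" unfolding r_def using detb(1) by (simp add: field_simps)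
      thus ?thesis by simp
    qed simp
  qed
  hence qr: "q = r" by simp
  have "(\<Prod>a\<in>#proots p. a) \<noteq> 0" using a0 by (auto simp: prod_mset_zero_iff)
  hence "proots q = proots (\<Prod>a\<in>#proots p. [:- inverse a, 1:])" unfolding qr r_def using detb(1) by simp
  also have "\<dots> = image_mset inverse (proots p)"
  proof -
    have "proots (\<Prod>a\<in>#M. [:- inverse a, 1:]) = image_mset inverse M" for M :: "complex multiset"
    proof (induction M)
      case (add a M)
      have "(\<Prod>a\<in>#M. [:- inverse a, 1:]) \<noteq> 0" by (auto simp: prod_mset_zero_iff)
      thus ?case using add proots_mult[of "[:- inverse a, 1:]" "\<Prod>a\<in>#M. [:- inverse a, 1:]"] by simp
    qed simp
    thus ?thesis .
  qed
  finally show ?thesis unfolding crB crD .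
qed

lemma four_block_mat_inj:
  assumes eq: "four_block_mat A B C D = four_block_mat A' B' C' D'"
    and c: "A \<in> carrier_mat n1 m1" "B \<in> carrier_mat n1 m2" "C \<in> carrier_mat n2 m1" "D \<in> carrier_mat n2 m2"
    "A' \<in> carrier_mat n1 m1" "B' \<in> carrier_mat n1 m2" "C' \<in> carrier_mat n2 m1" "D' \<in> carrier_mat n2 m2"
  shows "A = A'" "B = B'" "C = C'" "D = D'"
proof -
  have ix: "four_block_mat A B C D $$ (i,j) = four_block_mat A' B' C' D' $$ (i,j)" for i j using eq by simp
  show "A = A'"
  proof (rule eq_matI)
    fix i j assume "i < dim_row A'" "j < dim_col A'"
    thus "A $$ (i,j) = A' $$ (i,j)" using ix[of i j] c by simp
  qed (use c in auto)
  show "B = B'"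
  proof (rule eq_matI)
    fix i j assume "i < dim_row B'" "j < dim_col B'"
    thus "B $$ (i,j) = B' $$ (i,j)" using ix[of i "m1 + j"] c by simp
  qed (use c in auto)
  show "C = C'"
  proof (rule eq_matI)
    fix i j assume "i < dim_row C'" "j < dim_col C'"
    thus "C $$ (i,j) = C' $$ (i,j)" using ix[of "n1 + i" j] c by simp
  qed (use c in auto)
  show "D = D'"
  proof (rule eq_matI)
    fix i j assume "i < dim_row D'" "j < dim_col D'"
    thus "D $$ (i,j) = D' $$ (i,j)" using ix[of "n1 + i" "m1 + j"] c by simp
  qed (use c in auto)
qed

lemma transpose_block_upper:
  assumes "B \<in> carrier_mat p p" "X \<in> carrier_mat p q" "D \<in> carrier_mat q q"
  shows "(four_block_mat B X (0\<^sub>m q p) D)\<^sup>T = four_block_mat B\<^sup>T (0\<^sub>m p q) X\<^sup>T D\<^sup>T"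
  using transpose_four_block_mat[OF assms(1,2) zero_carrier_mat assms(3)] by simp

text \<open>With \<open>K\<close> the Gram matrix of a bilinear form, the first corner describes the form on the subspace
  preserved by the block triangular matrix.\<close>

lemma congruence_block_upper:
  fixes B :: "real mat"
  assumes G: "B \<in> carrier_mat p p" "X \<in> carrier_mat p q" "D \<in> carrier_mat q q"
    and K: "K1 \<in> carrier_mat p p" "K2 \<in> carrier_mat p q" "K3 \<in> carrier_mat q p" "K4 \<in> carrier_mat q q"
  obtains Y3 Y4 where "Y3 \<in> carrier_mat q p" "Y4 \<in> carrier_mat q q"
    "(four_block_mat B X (0\<^sub>m q p) D)\<^sup>T * four_block_mat K1 K2 K3 K4 * four_block_mat B X (0\<^sub>m q p) D
     = four_block_mat (B\<^sup>T * K1 * B) (B\<^sup>T * K1 * X + B\<^sup>T * K2 * D) Y3 Y4"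
proof -
  have GT: "B\<^sup>T \<in> carrier_mat p p" "X\<^sup>T \<in> carrier_mat q p" "D\<^sup>T \<in> carrier_mat q q" using G by auto
  define L3 where "L3 = X\<^sup>T * K1 + D\<^sup>T * K3"
  define L4 where "L4 = X\<^sup>T * K2 + D\<^sup>T * K4"
  have L: "L3 \<in> carrier_mat q p" "L4 \<in> carrier_mat q q"
    unfolding L3_def L4_def by (intro add_carrier_mat mult_carrier_mat[OF GT(3)] K)+
  have BK: "B\<^sup>T * K1 \<in> carrier_mat p p" "B\<^sup>T * K2 \<in> carrier_mat p q" using GT K by auto
  have "(four_block_mat B X (0\<^sub>m q p) D)\<^sup>T * four_block_mat K1 K2 K3 K4
    = four_block_mat (B\<^sup>T * K1 + 0\<^sub>m p q * K3) (B\<^sup>T * K2 + 0\<^sub>m p q * K4) L3 L4"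
    unfolding transpose_block_upper[OF G] L3_def L4_def
    by (rule mult_four_block_mat[OF GT(1) zero_carrier_mat GT(2,3) K])
  also have "\<dots> = four_block_mat (B\<^sup>T * K1) (B\<^sup>T * K2) L3 L4"
    using right_add_zero_mat[OF BK(1)] right_add_zero_mat[OF BK(2)] left_mult_zero_mat[OF K(3)] left_mult_zero_mat[OF K(4)] by simp
  finally have 1: "(four_block_mat B X (0\<^sub>m q p) D)\<^sup>T * four_block_mat K1 K2 K3 K4 = four_block_mat (B\<^sup>T * K1) (B\<^sup>T * K2) L3 L4" .
  have "four_block_mat (B\<^sup>T * K1) (B\<^sup>T * K2) L3 L4 * four_block_mat B X (0\<^sub>m q p) D
    = four_block_mat (B\<^sup>T * K1 * B + B\<^sup>T * K2 * 0\<^sub>m q p) (B\<^sup>T * K1 * X + B\<^sup>T * K2 * D) (L3 * B + L4 * 0\<^sub>m q p) (L3 * X + L4 * D)"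
    by (rule mult_four_block_mat[OF BK L G(1,2) zero_carrier_mat G(3)])
  also have "B\<^sup>T * K1 * B + B\<^sup>T * K2 * 0\<^sub>m q p = B\<^sup>T * K1 * B"
    using right_add_zero_mat[OF mult_carrier_mat[OF BK(1) G(1)]] right_mult_zero_mat[OF BK(2)] by simp
  finally have 2: "four_block_mat (B\<^sup>T * K1) (B\<^sup>T * K2) L3 L4 * four_block_mat B X (0\<^sub>m q p) D
    = four_block_mat (B\<^sup>T * K1 * B) (B\<^sup>T * K1 * X + B\<^sup>T * K2 * D) (L3 * B + L4 * 0\<^sub>m q p) (L3 * X + L4 * D)" .
  show thesis
  proof (rule that)
    show "L3 * B + L4 * 0\<^sub>m q p \<in> carrier_mat q p" "L3 * X + L4 * D \<in> carrier_mat q q"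
      using L G by (auto intro: add_carrier_mat)
  qed (simp only: 1 2)
qed

lemma uminus_zero_mat: "- 0\<^sub>m n m = (0\<^sub>m n m :: real mat)"
  by (rule eq_matI) auto

lemma symplectic_form_orth: "symplectic_form n \<in> orth (n + n)" "(symplectic_form n)\<^sup>T = - symplectic_form n"
proof -
  have m: "- (1\<^sub>m n :: real mat) \<in> carrier_mat n n" by simp
  have T: "(symplectic_form n)\<^sup>T = four_block_mat (0\<^sub>m n n) (- 1\<^sub>m n) (1\<^sub>m n) (0\<^sub>m n n)"
  proof -
    have "(- (1\<^sub>m n :: real mat))\<^sup>T = - 1\<^sub>m n" by (rule eq_matI) auto
    thus ?thesis unfolding symplectic_form_def
      using transpose_four_block_mat[OF zero_carrier_mat one_carrier_mat m zero_carrier_mat] by simp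
  qed
  have c: "symplectic_form n \<in> carrier_mat (n + n) (n + n)"
    unfolding symplectic_form_def by (rule four_block_carrier_mat) auto
  have mm: "- 1\<^sub>m n * - 1\<^sub>m n = (1\<^sub>m n :: real mat)" by simp
  have "(symplectic_form n)\<^sup>T * symplectic_form n = 1\<^sub>m (n + n)"
    unfolding T unfolding symplectic_form_def
    by (subst mult_four_block_mat[OF zero_carrier_mat m one_carrier_mat zero_carrier_mat zero_carrier_mat one_carrier_mat m zero_carrier_mat])
      (simp add: mm uminus_zero_mat)
  thus "symplectic_form n \<in> orth (n + n)" using c unfolding orth_def by simp
  show "(symplectic_form n)\<^sup>T = - symplectic_form n"
    unfolding T unfolding symplectic_form_def by (rule eq_matI) auto
qed

lemma Sp_iff: "A \<in> Sp (n + n) \<longleftrightarrow> A \<in> carrier_mat (n + n) (n + n) \<and> A\<^sup>T * symplectic_form n * A = symplectic_form n"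
proof -
  have "(n + n) div 2 = n" by simp
  thus ?thesis unfolding Sp_def by simp
qed

lemma Sp_carrier: "A \<in> Sp (n + n) \<Longrightarrow> A \<in> carrier_mat (n + n) (n + n)"
  unfolding Sp_iff by simp

lemma Sp_det_nonzero:
  assumes "A \<in> Sp (n + n)" shows "det A \<noteq> 0"
proof
  assume 0: "det A = 0"
  note A = assms[unfolded Sp_iff] and J = orthD(1)[OF symplectic_form_orth(1)[of n]]
  have "A\<^sup>T * symplectic_form n \<in> carrier_mat (n + n) (n + n)" using A by (intro mult_carrier_mat[OF _ J]) simp
  from det_mult[OF this, of A] have "det (A\<^sup>T * symplectic_form n * A) = 0" using A 0 by simp
  thus False using A det_orth_nonzero[OF symplectic_form_orth(1)[of n]] by simp
qed

lemma Sp_mult: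
  assumes "A \<in> Sp (n + n)" "B \<in> Sp (n + n)" shows "A * B \<in> Sp (n + n)"
proof -
  note A = assms(1)[unfolded Sp_iff] and B = assms(2)[unfolded Sp_iff] and J = orthD(1)[OF symplectic_form_orth(1)[of n]]
  have c: "A \<in> carrier_mat (n + n) (n + n)" "B \<in> carrier_mat (n + n) (n + n)"
    "A\<^sup>T \<in> carrier_mat (n + n) (n + n)" "B\<^sup>T \<in> carrier_mat (n + n) (n + n)" using A B by auto
  have "(A * B)\<^sup>T * symplectic_form n * (A * B) = B\<^sup>T * (A\<^sup>T * symplectic_form n * A) * B"
    unfolding transpose_mult[OF c(1,2)] using c J by (simp add: assoc_mult_mat[of _ "n+n" "n+n" _ "n+n" _ "n+n"])
  also have "\<dots> = symplectic_form n" using A B by simp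
  finally show ?thesis unfolding Sp_iff using mult_carrier_mat[OF c(1,2)] by simp
qed

lemma Sp_transpose_orth:
  assumes Q: "Q \<in> Sp (n + n)" "Q \<in> orth (n + n)" shows "Q\<^sup>T \<in> Sp (n + n)"
proof -
  let ?d = "n + n" and ?J = "symplectic_form n"
  note q = orthD[OF Q(2)] and J = orthD(1)[OF symplectic_form_orth(1)[of n]]
  have "Q * ?J * Q\<^sup>T = Q * (Q\<^sup>T * ?J * Q) * Q\<^sup>T" using Q(1) unfolding Sp_iff by simp
  also have "\<dots> = Q * (Q\<^sup>T * (?J * (Q * Q\<^sup>T)))"
    using q(1,2) J by (simp add: assoc_mult_mat[of _ ?d ?d _ ?d _ ?d])
  also have "\<dots> = ?J" using conj_orth_cancel(2)[OF Q(2) J] q(4) J by simp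
  finally show ?thesis unfolding Sp_iff using q by simp
qed

lemma diag_block_orth_Sp:
  assumes s: "s \<in> orth n"
  shows "four_block_mat s (0\<^sub>m n n) (0\<^sub>m n n) s \<in> Sp (n + n)"
proof -
  note q = orthD[OF s]
  have m: "- (1\<^sub>m n :: real mat) \<in> carrier_mat n n" by simp
  have T: "(four_block_mat s (0\<^sub>m n n) (0\<^sub>m n n) s)\<^sup>T = four_block_mat s\<^sup>T (0\<^sub>m n n) (0\<^sub>m n n) s\<^sup>T"
    using transpose_block_upper[OF q(1) zero_carrier_mat q(1)] by simp
  have sJ: "four_block_mat s\<^sup>T (0\<^sub>m n n) (0\<^sub>m n n) s\<^sup>T * symplectic_form n
     = four_block_mat (0\<^sub>m n n) s\<^sup>T (- (s\<^sup>T)) (0\<^sub>m n n)"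
    unfolding symplectic_form_def
    using mult_four_block_mat[OF q(2) zero_carrier_mat zero_carrier_mat q(2) zero_carrier_mat one_carrier_mat m zero_carrier_mat] q(2)
    by (simp add: uminus_zero_mat)
  have m': "- (s\<^sup>T) \<in> carrier_mat n n" using q(2) by simp
  have "- (s\<^sup>T) * s = - 1\<^sub>m n" using q by simp
  hence "four_block_mat (0\<^sub>m n n) s\<^sup>T (- (s\<^sup>T)) (0\<^sub>m n n) * four_block_mat s (0\<^sub>m n n) (0\<^sub>m n n) s = symplectic_form n"
    unfolding symplectic_form_def
    using mult_four_block_mat[OF zero_carrier_mat q(2) m' zero_carrier_mat q(1) zero_carrier_mat zero_carrier_mat q(1)] q
    by simp
  thus ?thesis unfolding Sp_iff T sJ using four_block_carrier_mat[OF q(1) q(1)] by simp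
qed

text \<open>The rows of \<open>K2\<close> are \<open>p\<close> orthonormal vectors of length \<open>q\<close>.  For a nondegenerate form, this is the fact
  that isotropic subspaces have at most half the dimension.\<close>

lemma orth_zero_corner:
  assumes K: "four_block_mat (0\<^sub>m p p) K2 K3 K4 \<in> orth (p + q)"
    and c: "K2 \<in> carrier_mat p q" "K3 \<in> carrier_mat q p" "K4 \<in> carrier_mat q q"
  shows "p \<le> q" "K2 * K2\<^sup>T = 1\<^sub>m p" "K2 * K4\<^sup>T = 0\<^sub>m p q"
proof -
  note k = orthD[OF K]
  have T: "(four_block_mat (0\<^sub>m p p) K2 K3 K4)\<^sup>T = four_block_mat (0\<^sub>m p p) K3\<^sup>T K2\<^sup>T K4\<^sup>T"
    using transpose_four_block_mat[OF zero_carrier_mat c] by simp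
  have cT: "K2\<^sup>T \<in> carrier_mat q p" "K3\<^sup>T \<in> carrier_mat p q" "K4\<^sup>T \<in> carrier_mat q q" using c by auto
  have e: "four_block_mat (0\<^sub>m p p * 0\<^sub>m p p + K2 * K2\<^sup>T) (0\<^sub>m p p * K3\<^sup>T + K2 * K4\<^sup>T)
      (K3 * 0\<^sub>m p p + K4 * K2\<^sup>T) (K3 * K3\<^sup>T + K4 * K4\<^sup>T) = four_block_mat (1\<^sub>m p) (0\<^sub>m p q) (0\<^sub>m q p) (1\<^sub>m q)"
    using k(4) mult_four_block_mat[OF zero_carrier_mat c zero_carrier_mat cT(2,1,3)] unfolding T by simp
  have "0\<^sub>m p p * 0\<^sub>m p p + K2 * K2\<^sup>T = 1\<^sub>m p" "0\<^sub>m p p * K3\<^sup>T + K2 * K4\<^sup>T = 0\<^sub>m p q"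
    by (rule four_block_mat_inj[OF e, of p p q q]; use c cT in \<open>auto intro: add_carrier_mat\<close>)+
  thus K22: "K2 * K2\<^sup>T = 1\<^sub>m p" and "K2 * K4\<^sup>T = 0\<^sub>m p q" using c cT by auto
  show "p \<le> q"
  proof (rule ccontr)
    assume "\<not> p \<le> q"
    hence pq: "q < p" by simp
    define M where "M = mat p p (\<lambda>(i,j). if j < q then K2 $$ (i,j) else 0)"
    have M: "M \<in> carrier_mat p p" "M\<^sup>T \<in> carrier_mat p p" unfolding M_def by auto
    have "M * M\<^sup>T = K2 * K2\<^sup>T"
    proof (rule eq_matI)
      fix i j assume "i < dim_row (K2 * K2\<^sup>T)" "j < dim_col (K2 * K2\<^sup>T)"
      hence ij: "i < p" "j < p" using c by auto
      have "(M * M\<^sup>T) $$ (i,j) = (\<Sum>k = 0..<p. if k < q then K2 $$ (i,k) * K2 $$ (j,k) else 0)"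
        using ij by (auto simp: M_def scalar_prod_def intro!: sum.cong)
      also have "\<dots> = (\<Sum>k = 0..<q. K2 $$ (i,k) * K2 $$ (j,k))"
        using pq by (intro sum.mono_neutral_cong_right) auto
      also have "\<dots> = (K2 * K2\<^sup>T) $$ (i,j)" using ij c by (simp add: scalar_prod_def)
      finally show "(M * M\<^sup>T) $$ (i,j) = (K2 * K2\<^sup>T) $$ (i,j)" .
    qed (use c in \<open>auto simp: M_def\<close>)
    hence "M\<^sup>T * M = 1\<^sub>m p" unfolding K22 using mat_mult_left_right_inverse[OF M] by simp
    hence "(M\<^sup>T * M) $$ (q,q) = 1" using pq by simp
    moreover have "(M\<^sup>T * M) $$ (q,q) = 0" using pq by (simp add: M_def scalar_prod_def)
    ultimately show False by simp
  qed
qed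

text \<open>If the first half of an orthonormal frame spans a Lagrangian subspace, then the Gram matrix of the
  symplectic form in this frame is orthogonal and skew with a zero corner.  This forces \<open>K4 = 0\<close>
  and \<open>K2\<close> orthogonal; turning the second half of the frame by \<open>K2\<^sup>T\<close> makes the frame symplectic.\<close>

lemma symplectic_completion:
  assumes Q: "Q \<in> orth (n + n)"
    and K: "Q\<^sup>T * symplectic_form n * Q = four_block_mat (0\<^sub>m n n) K2 K3 K4"
    and c: "K2 \<in> carrier_mat n n" "K3 \<in> carrier_mat n n" "K4 \<in> carrier_mat n n"
  obtains Y where "Y \<in> orth n" "Q * four_block_mat (1\<^sub>m n) (0\<^sub>m n n) (0\<^sub>m n n) Y \<in> orth (n + n) \<inter> Sp (n + n)"
proof -
  let ?d = "n + n" and ?J = "symplectic_form n"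
  let ?K = "four_block_mat (0\<^sub>m n n) K2 K3 K4"
  note q = orthD[OF Q] and J = orthD(1,2)[OF symplectic_form_orth(1)[of n]]
  have Ko: "?K \<in> orth ?d" unfolding K[symmetric]
    by (intro mult_orth transpose_orth Q symplectic_form_orth)
  have cT: "K2\<^sup>T \<in> carrier_mat n n" "K3\<^sup>T \<in> carrier_mat n n" "K4\<^sup>T \<in> carrier_mat n n" using c by auto
  note z = orth_zero_corner[OF Ko c]
  have "?K\<^sup>T = Q\<^sup>T * (?J\<^sup>T * Q)"
    unfolding K[symmetric] using q J by (simp add: transpose_mult[of _ ?d ?d _ ?d])
  also have "\<dots> = - (Q\<^sup>T * ?J * Q)"
    unfolding symplectic_form_orth(2) using q J
    by (simp add: assoc_mult_mat[of _ ?d ?d _ ?d _ ?d])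
  finally have skew: "?K\<^sup>T = - ?K" unfolding K .
  have "four_block_mat (0\<^sub>m n n) K3\<^sup>T K2\<^sup>T K4\<^sup>T = four_block_mat (- 0\<^sub>m n n) (- K2) (- K3) (- K4)"
  proof -
    have "- ?K = four_block_mat (- 0\<^sub>m n n) (- K2) (- K3) (- K4)" by (rule eq_matI) (use c in auto)
    thus ?thesis using skew transpose_four_block_mat[OF zero_carrier_mat c] by simp
  qed
  from four_block_mat_inj(3,4)[OF this, of n n n n] c cT
  have sk: "K2\<^sup>T = - K3" "K4\<^sup>T = - K4" by auto
  have K3: "K3 = - (K2\<^sup>T)" unfolding sk(1) by (rule eq_matI) auto
  have K22: "K2\<^sup>T * K2 = 1\<^sub>m n" by (rule mat_mult_left_right_inverse[OF c(1) cT(1) z(2)])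
  have "K4\<^sup>T = K2\<^sup>T * K2 * K4\<^sup>T" unfolding K22 using cT by simp
  also have "\<dots> = K2\<^sup>T * (K2 * K4\<^sup>T)" by (rule assoc_mult_mat[OF cT(1) c(1) cT(3)])
  also have "\<dots> = 0\<^sub>m n n" unfolding z(3) using cT by simp
  finally have "K4\<^sup>T = 0\<^sub>m n n" .
  hence "K4\<^sup>T\<^sup>T = (0\<^sub>m n n)\<^sup>T" by simp
  hence K4: "K4 = 0\<^sub>m n n" by simp
  define Y where "Y = K2\<^sup>T"
  have Y: "Y \<in> orth n" unfolding Y_def orth_def using z(2) cT by simp
  define E where "E = four_block_mat (1\<^sub>m n) (0\<^sub>m n n) (0\<^sub>m n n) Y"
  have E: "E \<in> orth ?d" unfolding E_def by (rule diag_block_orth[OF one_orth Y])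
  note e = orthD[OF E] and y = orthD[OF Y]
  have YT: "Y\<^sup>T = K2" unfolding Y_def by simp
  have ET: "E\<^sup>T = four_block_mat (1\<^sub>m n) (0\<^sub>m n n) (0\<^sub>m n n) K2"
    unfolding E_def using transpose_block_upper[OF one_carrier_mat zero_carrier_mat y(1)] YT by simp
  have "E\<^sup>T * ?K = four_block_mat (1\<^sub>m n * 0\<^sub>m n n + 0\<^sub>m n n * K3) (1\<^sub>m n * K2 + 0\<^sub>m n n * K4)
      (0\<^sub>m n n * 0\<^sub>m n n + K2 * K3) (0\<^sub>m n n * K2 + K2 * K4)"
    unfolding ET by (rule mult_four_block_mat[OF one_carrier_mat zero_carrier_mat zero_carrier_mat c(1) zero_carrier_mat c])
  also have "K2 * K3 = - 1\<^sub>m n" unfolding K3 using c cT z(2) by simp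
  finally have EK: "E\<^sup>T * ?K = four_block_mat (0\<^sub>m n n) K2 (- 1\<^sub>m n) (0\<^sub>m n n)"
    unfolding K4 using c by simp
  have m: "- (1\<^sub>m n :: real mat) \<in> carrier_mat n n" by simp
  have "E\<^sup>T * ?K * E = ?J"
    unfolding EK unfolding E_def symplectic_form_def
    using mult_four_block_mat[OF zero_carrier_mat c(1) m zero_carrier_mat one_carrier_mat zero_carrier_mat zero_carrier_mat y(1)] c y z(2)
    unfolding Y_def by simp
  moreover have "(Q * E)\<^sup>T * ?J * (Q * E) = E\<^sup>T * (Q\<^sup>T * ?J * Q) * E"
    unfolding transpose_mult[OF q(1) e(1)] using q e J by (simp add: assoc_mult_mat[of _ ?d ?d _ ?d _ ?d])
  ultimately have "(Q * E)\<^sup>T * ?J * (Q * E) = ?J" unfolding K by simp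
  hence "Q * E \<in> Sp ?d" using mult_carrier_mat[OF q(1) e(1)] unfolding Sp_iff by blast
  hence "Q * E \<in> orth ?d \<inter> Sp ?d" using mult_orth[OF Q E] by blast
  with Y show thesis using that unfolding E_def by blast
qed

lemma split_four_block:
  assumes "K \<in> carrier_mat (p + q) (p + q)"
  obtains K1 K2 K3 K4 where "K1 \<in> carrier_mat p p" "K2 \<in> carrier_mat p q" "K3 \<in> carrier_mat q p" "K4 \<in> carrier_mat q q"
    "K = four_block_mat K1 K2 K3 K4"
proof -
  obtain K1 K2 K3 K4 where "split_block K p p = (K1, K2, K3, K4)" by (cases "split_block K p p") auto
  from split_block[OF this, of q q] assms that show thesis by auto
qed

text \<open>The form restricted to the invariant subspace satisfies a Stein equation.\<close>

lemma isotropic_first_block: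
  assumes J: "J \<in> carrier_mat (p + q) (p + q)"
    and A: "A \<in> carrier_mat (p + q) (p + q)" "A\<^sup>T * J * A = J" and Q: "Q \<in> orth (p + q)"
    and G: "Q\<^sup>T * A * Q = four_block_mat B X (0\<^sub>m q p) D"
    and c: "B \<in> carrier_mat p p" "X \<in> carrier_mat p q" "D \<in> carrier_mat q q"
    and ev: "\<And>a b. a \<in># eigenvals B \<Longrightarrow> b \<in># eigenvals B \<Longrightarrow> a * b \<noteq> 1"
  obtains K2 K3 K4 where "K2 \<in> carrier_mat p q" "K3 \<in> carrier_mat q p" "K4 \<in> carrier_mat q q"
    "Q\<^sup>T * J * Q = four_block_mat (0\<^sub>m p p) K2 K3 K4"
proof -
  let ?d = "p + q"
  note q = orthD[OF Q]
  have AT: "A\<^sup>T \<in> carrier_mat ?d ?d" using A by simp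
  have "Q\<^sup>T * J * Q \<in> carrier_mat ?d ?d"
    by (rule mult_carrier_mat[OF mult_carrier_mat[OF q(2) J] q(1)])
  then obtain K1 K2 K3 K4 where K: "K1 \<in> carrier_mat p p" "K2 \<in> carrier_mat p q" "K3 \<in> carrier_mat q p" "K4 \<in> carrier_mat q q"
    "Q\<^sup>T * J * Q = four_block_mat K1 K2 K3 K4" by (rule split_four_block)
  have "(Q\<^sup>T * A * Q)\<^sup>T = Q\<^sup>T * (A\<^sup>T * Q)"
    using q A(1) by (simp add: transpose_mult[of _ ?d ?d _ ?d])
  hence "(Q\<^sup>T * A * Q)\<^sup>T * (Q\<^sup>T * J * Q) * (Q\<^sup>T * A * Q)
     = Q\<^sup>T * (A\<^sup>T * (Q * (Q\<^sup>T * (J * (Q * (Q\<^sup>T * (A * Q)))))))"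
    using q(1,2) A(1) AT J by (simp add: assoc_mult_mat[of _ ?d ?d _ ?d _ ?d])
  also have "Q * (Q\<^sup>T * (A * Q)) = A * Q"
    by (rule conj_orth_cancel(2)[OF Q mult_carrier_mat[OF A(1) q(1)]])
  also have "Q * (Q\<^sup>T * (J * (A * Q))) = J * (A * Q)"
    by (rule conj_orth_cancel(2)[OF Q mult_carrier_mat[OF J mult_carrier_mat[OF A(1) q(1)]]])
  also have "Q\<^sup>T * (A\<^sup>T * (J * (A * Q))) = Q\<^sup>T * (A\<^sup>T * J * A) * Q"
    using q(1,2) A(1) AT J by (simp add: assoc_mult_mat[of _ ?d ?d _ ?d _ ?d])
  also have "\<dots> = Q\<^sup>T * J * Q" unfolding A(2) ..
  finally have inv: "(four_block_mat B X (0\<^sub>m q p) D)\<^sup>T * four_block_mat K1 K2 K3 K4 * four_block_mat B X (0\<^sub>m q p) D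
     = four_block_mat K1 K2 K3 K4" unfolding G K(5) .
  obtain Y3 Y4 where Y: "Y3 \<in> carrier_mat q p" "Y4 \<in> carrier_mat q q"
    "(four_block_mat B X (0\<^sub>m q p) D)\<^sup>T * four_block_mat K1 K2 K3 K4 * four_block_mat B X (0\<^sub>m q p) D
     = four_block_mat (B\<^sup>T * K1 * B) (B\<^sup>T * K1 * X + B\<^sup>T * K2 * D) Y3 Y4"
    by (rule congruence_block_upper[OF c K(1-4)])
  have BT: "B\<^sup>T \<in> carrier_mat p p" using c by simp
  have "B\<^sup>T * K1 * B = K1"
    by (rule four_block_mat_inj(1)[OF Y(3)[unfolded inv, symmetric], of p p q q])
      (use c K Y BT in \<open>auto intro!: add_carrier_mat mult_carrier_mat[OF _ c(3)] mult_carrier_mat[OF _ c(1)] mult_carrier_mat[OF BT]\<close>)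
  hence "K1 = 0\<^sub>m p p" by (rule stein_equation_zero[OF c(1) K(1) _ ev])
  thus thesis using that[OF K(2-4)] K(5) by simp
qed

text \<open>A symplectic map sends a Lagrangian subspace to a Lagrangian subspace, and the QR decomposition
  provides an orthonormal frame adapted to the image, which is completed to a symplectic one.\<close>

lemma exists_symplectic_triangularizer:
  assumes A: "A \<in> Sp (n + n)" and Q: "Q \<in> orth (n + n) \<inter> Sp (n + n)"
  shows "\<exists>Q' \<in> orth (n + n) \<inter> Sp (n + n). block_upper n n (Q'\<^sup>T * A * Q)"
proof -
  let ?d = "n + n" and ?J = "symplectic_form n"
  note J = orthD(1)[OF symplectic_form_orth(1)[of n]]
  have N: "A * Q \<in> Sp ?d" using Sp_mult[OF A] Q by blast
  note Nc = Sp_carrier[OF N]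
  from qr_decomposition[OF Nc] obtain P where P: "P \<in> orth ?d" "upper_triangular (P\<^sup>T * (A * Q))" by blast
  note p = orthD[OF P(1)]
  define R where "R = P\<^sup>T * (A * Q)"
  have Rc: "R \<in> carrier_mat ?d ?d" unfolding R_def by (rule mult_carrier_mat[OF p(2) Nc])
  have "block_upper n n R" by (rule upper_triangular_block_upper[OF Rc]) (use P R_def in simp)
  then obtain B X D where b: "B \<in> carrier_mat n n" "X \<in> carrier_mat n n" "D \<in> carrier_mat n n"
    "R = four_block_mat B X (0\<^sub>m n n) D" by (rule block_upperE)
  have "det R \<noteq> 0"
    unfolding R_def det_mult[OF p(2) Nc] using Sp_det_nonzero[OF N] det_orth_nonzero[OF transpose_orth[OF P(1)]] by simp
  hence "det B \<noteq> 0" unfolding b(4) det_four_block_mat_lower_left_zero[OF b(1,2) refl b(3)] by simp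
  then obtain B' where B': "B' \<in> carrier_mat n n" "B * B' = 1\<^sub>m n" by (rule exists_mat_inverse[OF b(1)])
  have "P\<^sup>T * ?J * P \<in> carrier_mat ?d ?d"
    by (rule mult_carrier_mat[OF mult_carrier_mat[OF p(2) J] p(1)])
  then obtain K1 K2 K3 K4 where K: "K1 \<in> carrier_mat n n" "K2 \<in> carrier_mat n n" "K3 \<in> carrier_mat n n" "K4 \<in> carrier_mat n n"
    "P\<^sup>T * ?J * P = four_block_mat K1 K2 K3 K4" by (rule split_four_block)
  have NP: "P * R = A * Q" unfolding R_def by (rule conj_orth_cancel(2)[OF P(1) Nc])
  have RT: "R\<^sup>T \<in> carrier_mat ?d ?d" using Rc by simp
  have "R\<^sup>T * (P\<^sup>T * ?J * P) * R = (P * R)\<^sup>T * ?J * (P * R)"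
    unfolding transpose_mult[OF p(1) Rc] using p(1,2) Rc RT J by (simp add: assoc_mult_mat[of _ ?d ?d _ ?d _ ?d])
  also have "\<dots> = ?J" using N unfolding NP Sp_iff by simp
  finally have inv: "(four_block_mat B X (0\<^sub>m n n) D)\<^sup>T * four_block_mat K1 K2 K3 K4 * four_block_mat B X (0\<^sub>m n n) D = ?J"
    unfolding K(5) b(4) .
  obtain Y3 Y4 where Y: "Y3 \<in> carrier_mat n n" "Y4 \<in> carrier_mat n n"
    "(four_block_mat B X (0\<^sub>m n n) D)\<^sup>T * four_block_mat K1 K2 K3 K4 * four_block_mat B X (0\<^sub>m n n) D
     = four_block_mat (B\<^sup>T * K1 * B) (B\<^sup>T * K1 * X + B\<^sup>T * K2 * D) Y3 Y4"
    by (rule congruence_block_upper[OF b(1-3) K(1-4)])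
  have BT: "B\<^sup>T \<in> carrier_mat n n" "B'\<^sup>T \<in> carrier_mat n n" using b B' by auto
  have z: "B\<^sup>T * K1 * B = 0\<^sub>m n n"
    by (rule four_block_mat_inj(1)[OF Y(3)[unfolded inv symplectic_form_def, symmetric], of n n n n])
      (use b K Y BT in \<open>auto intro!: add_carrier_mat mult_carrier_mat[OF _ b(3)] mult_carrier_mat[OF _ b(1)] mult_carrier_mat[OF BT(1)]\<close>)
  have "K1 = (B * B')\<^sup>T * K1 * (B * B')" unfolding B'(2) using K by simp
  also have "\<dots> = B'\<^sup>T * (B\<^sup>T * K1 * B) * B'"
    unfolding transpose_mult[OF b(1) B'(1)] using K(1) b(1) B'(1) BT by (simp add: assoc_mult_mat[of _ n n _ n _ n])
  also have "\<dots> = 0\<^sub>m n n" unfolding z using BT B' by simp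
  finally have K1: "K1 = 0\<^sub>m n n" .
  obtain Y where Y: "Y \<in> orth n" "P * four_block_mat (1\<^sub>m n) (0\<^sub>m n n) (0\<^sub>m n n) Y \<in> orth ?d \<inter> Sp ?d"
    by (rule symplectic_completion[OF P(1) K(5)[unfolded K1] K(2-4)])
  define E where "E = four_block_mat (1\<^sub>m n) (0\<^sub>m n n) (0\<^sub>m n n) Y"
  note y = orthD[OF Y(1)]
  have E: "E \<in> carrier_mat ?d ?d" unfolding E_def by (rule four_block_carrier_mat[OF one_carrier_mat y(1)])
  have ET: "E\<^sup>T = four_block_mat (1\<^sub>m n) (0\<^sub>m n n) (0\<^sub>m n n) Y\<^sup>T"
    unfolding E_def using transpose_block_upper[OF one_carrier_mat zero_carrier_mat y(1)] by simp
  have "block_upper n n E\<^sup>T" unfolding ET by (rule block_upper_four_block[OF one_carrier_mat zero_carrier_mat y(2)])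
  from block_upper_mult[OF this \<open>block_upper n n R\<close>] have "block_upper n n (E\<^sup>T * R)" .
  moreover have "(P * E)\<^sup>T * A * Q = E\<^sup>T * R"
    unfolding R_def transpose_mult[OF p(1) E] using E p(1,2) Sp_carrier[OF A] Sp_carrier[of Q n] Q
    by (simp add: assoc_mult_mat[of _ ?d ?d _ ?d _ ?d])
  ultimately have "block_upper n n ((P * E)\<^sup>T * A * Q)" by simp
  thus ?thesis by (rule bexI[OF _ Y(2)[folded E_def]])
qed

text \<open>The generalized eigenspace for eigenvalues with property \<open>P\<close> is isotropic if no two such eigenvalues
  have product \<open>1\<close>, hence it has at most half the dimension.\<close>

lemma ordered_schur_symplectic:
  assumes cnj: "\<And>z. P z \<Longrightarrow> P (cnj z)" and A: "A \<in> Sp (n + n)"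
    and ev: "\<And>a b. a \<in># eigenvals A \<Longrightarrow> b \<in># eigenvals A \<Longrightarrow> P a \<Longrightarrow> P b \<Longrightarrow> a * b \<noteq> 1"
  obtains p q Q B X D K2 K3 K4 where "n + n = p + q" "p \<le> q" "p = size (filter_mset P (eigenvals A))" "Q \<in> orth (p + q)"
    "Q\<^sup>T * A * Q = four_block_mat B X (0\<^sub>m q p) D"
    "B \<in> carrier_mat p p" "X \<in> carrier_mat p q" "D \<in> carrier_mat q q"
    "K2 \<in> carrier_mat p q" "K3 \<in> carrier_mat q p" "K4 \<in> carrier_mat q q"
    "Q\<^sup>T * symplectic_form n * Q = four_block_mat (0\<^sub>m p p) K2 K3 K4"
proof -
  obtain p q Q B X D where s: "n + n = p + q" "Q \<in> orth (n + n)" "Q\<^sup>T * A * Q = four_block_mat B X (0\<^sub>m q p) D"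
    "B \<in> carrier_mat p p" "X \<in> carrier_mat p q" "D \<in> carrier_mat q q"
    "\<forall>z \<in># eigenvals B. P z" "\<forall>z \<in># eigenvals D. \<not> P z"
    using ordered_schur[of P, OF cnj Sp_carrier[OF A]] by blast
  have cr: "eigenvals A = eigenvals B + eigenvals D"
    using eigenvals_conj_orth[OF s(2) Sp_carrier[OF A]] unfolding s(3) eigenvals_block_upper[OF s(4-6)] by simp
  have "filter_mset P (eigenvals B) = eigenvals B" using s(7) by (simp add: filter_mset_eq_conv)
  moreover have "filter_mset P (eigenvals D) = {#}" using filter_mset_cong[of "eigenvals D" "eigenvals D" P "\<lambda>_. False"] s(8) by simp
  ultimately have p: "p = size (filter_mset P (eigenvals A))" unfolding cr using size_eigenvals[OF s(4)] by simp
  have Ac: "A \<in> carrier_mat (p + q) (p + q)" "A\<^sup>T * symplectic_form n * A = symplectic_form n"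
    using Sp_carrier[OF A] s(1) A[unfolded Sp_iff] by (simp_all only:)
  have J: "symplectic_form n \<in> orth (p + q)" using symplectic_form_orth(1)[of n] unfolding s(1) .
  have Qo: "Q \<in> orth (p + q)" using s(1,2) by simp
  have evB: "a * b \<noteq> 1" if "a \<in># eigenvals B" "b \<in># eigenvals B" for a b
    using ev[of a b] that s(7) unfolding cr by simp
  obtain K2 K3 K4 where K: "K2 \<in> carrier_mat p q" "K3 \<in> carrier_mat q p" "K4 \<in> carrier_mat q q"
    "Q\<^sup>T * symplectic_form n * Q = four_block_mat (0\<^sub>m p p) K2 K3 K4"
    by (rule isotropic_first_block[OF orthD(1)[OF J] Ac Qo s(3-6) evB])
  have "four_block_mat (0\<^sub>m p p) K2 K3 K4 \<in> orth (p + q)"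
    unfolding K(4)[symmetric] by (intro mult_orth transpose_orth Qo J)
  hence "p \<le> q" by (rule orth_zero_corner(1)[OF _ K(1-3)])
  show thesis by (rule that[OF s(1) \<open>p \<le> q\<close> p Qo s(3-6) K])
qed

text \<open>The stable and the unstable subspace are both isotropic and their dimensions add up to \<open>2n\<close>, so the
  stable subspace is Lagrangian.\<close>

lemma hyperbolic_symplectic_split:
  assumes A: "A \<in> Sp (n + n)" and hyp: "\<And>z. z \<in># eigenvals A \<Longrightarrow> cmod z \<noteq> 1"
  shows "\<exists>Q \<in> orth (n + n) \<inter> Sp (n + n). block_upper n n (Q\<^sup>T * A * Q)"
proof -
  let ?s = "\<lambda>z. cmod z < 1"
  have ev1: "a * b \<noteq> 1" if "cmod a < 1" "cmod b < 1" for a b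
  proof
    assume "a * b = 1"
    hence "cmod a * cmod b = 1" by (metis norm_mult norm_one)
    moreover have "cmod a * cmod b < 1 * 1" using that by (intro mult_strict_mono') auto
    ultimately show False by simp
  qed
  have ev2: "a * b \<noteq> 1" if "a \<in># eigenvals A" "b \<in># eigenvals A" "\<not> cmod a < 1" "\<not> cmod b < 1" for a b
  proof
    assume "a * b = 1"
    hence "cmod a * cmod b = 1" by (metis norm_mult norm_one)
    moreover have "1 * 1 < cmod a * cmod b" using that hyp[of a] hyp[of b] by (intro mult_strict_mono') auto
    ultimately show False by simp
  qed
  obtain p q Q B X D K2 K3 K4 where s: "n + n = p + q" "p \<le> q" "p = size (filter_mset ?s (eigenvals A))" "Q \<in> orth (p + q)"
    "Q\<^sup>T * A * Q = four_block_mat B X (0\<^sub>m q p) D"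
    "B \<in> carrier_mat p p" "X \<in> carrier_mat p q" "D \<in> carrier_mat q q"
    "K2 \<in> carrier_mat p q" "K3 \<in> carrier_mat q p" "K4 \<in> carrier_mat q q"
    "Q\<^sup>T * symplectic_form n * Q = four_block_mat (0\<^sub>m p p) K2 K3 K4"
    by (rule ordered_schur_symplectic[of ?s, OF _ A]) (use ev1 in auto)
  obtain p' q' where s': "n + n = p' + q'" "p' \<le> q'" "p' = size (filter_mset (\<lambda>z. \<not> ?s z) (eigenvals A))"
    by (rule ordered_schur_symplectic[of "\<lambda>z. \<not> ?s z", OF _ A]) (use ev2 in auto)
  have "p + p' = n + n"
    unfolding s(3) s'(3) size_union[symmetric] multiset_partition[symmetric] by (rule size_eigenvals[OF Sp_carrier[OF A]])
  hence pq: "p = n" "q = n" using s(1,2) s'(1,2) by linarith+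
  obtain Y where Y: "Y \<in> orth n" "Q * four_block_mat (1\<^sub>m n) (0\<^sub>m n n) (0\<^sub>m n n) Y \<in> orth (n + n) \<inter> Sp (n + n)"
    by (rule symplectic_completion[OF s(4)[unfolded pq] s(12)[unfolded pq] s(9-11)[unfolded pq]])
  define E where "E = four_block_mat (1\<^sub>m n) (0\<^sub>m n n) (0\<^sub>m n n) Y"
  let ?d = "n + n"
  note y = orthD[OF Y(1)] and q = orthD[OF s(4)[unfolded pq]]
  have E: "E \<in> carrier_mat ?d ?d" unfolding E_def by (rule four_block_carrier_mat[OF one_carrier_mat y(1)])
  have ET: "E\<^sup>T = four_block_mat (1\<^sub>m n) (0\<^sub>m n n) (0\<^sub>m n n) Y\<^sup>T"
    unfolding E_def using transpose_block_upper[OF one_carrier_mat zero_carrier_mat y(1)] by simp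
  have "block_upper n n E" unfolding E_def by (rule block_upper_four_block[OF one_carrier_mat zero_carrier_mat y(1)])
  moreover have "block_upper n n E\<^sup>T" unfolding ET by (rule block_upper_four_block[OF one_carrier_mat zero_carrier_mat y(2)])
  moreover have "block_upper n n (Q\<^sup>T * A * Q)" unfolding s(5)[unfolded pq] by (rule block_upper_four_block[OF s(6-8)[unfolded pq]])
  ultimately have "block_upper n n (E\<^sup>T * (Q\<^sup>T * A * Q) * E)" using block_upper_mult by blast
  moreover have "(Q * E)\<^sup>T * A * (Q * E) = E\<^sup>T * (Q\<^sup>T * A * Q) * E"
    unfolding transpose_mult[OF q(1) E] using E q(1,2) Sp_carrier[OF A]
    by (simp add: assoc_mult_mat[of _ ?d ?d _ ?d _ ?d])
  ultimately have "block_upper n n ((Q * E)\<^sup>T * A * (Q * E))" by simp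
  thus ?thesis by (rule bexI[OF _ Y(2)[folded E_def]])
qed

text \<open>The symplectic form identifies the quotient by a Lagrangian subspace with the dual of that subspace.\<close>

lemma Sp_block_upper_dual:
  assumes "four_block_mat B X (0\<^sub>m n n) D \<in> Sp (n + n)"
    and c: "B \<in> carrier_mat n n" "X \<in> carrier_mat n n" "D \<in> carrier_mat n n"
  shows "B\<^sup>T * D = 1\<^sub>m n"
proof -
  have m: "- (1\<^sub>m n :: real mat) \<in> carrier_mat n n" by simp
  have BT: "B\<^sup>T \<in> carrier_mat n n" using c by simp
  obtain Y3 Y4 where Y: "Y3 \<in> carrier_mat n n" "Y4 \<in> carrier_mat n n"
    "(four_block_mat B X (0\<^sub>m n n) D)\<^sup>T * symplectic_form n * four_block_mat B X (0\<^sub>m n n) D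
     = four_block_mat (B\<^sup>T * 0\<^sub>m n n * B) (B\<^sup>T * 0\<^sub>m n n * X + B\<^sup>T * 1\<^sub>m n * D) Y3 Y4"
    unfolding symplectic_form_def by (rule congruence_block_upper[OF c zero_carrier_mat one_carrier_mat m zero_carrier_mat])
  have "four_block_mat (B\<^sup>T * 0\<^sub>m n n * B) (B\<^sup>T * 0\<^sub>m n n * X + B\<^sup>T * 1\<^sub>m n * D) Y3 Y4 = symplectic_form n"
    unfolding Y(3)[symmetric] using assms(1) unfolding Sp_iff by simp
  from four_block_mat_inj(2)[OF this[unfolded symplectic_form_def], of n n n n]
  have "B\<^sup>T * 0\<^sub>m n n * X + B\<^sup>T * 1\<^sub>m n * D = 1\<^sub>m n" using c BT Y by auto
  thus ?thesis using c BT by simp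
qed

text \<open>Orthogonal matrices equal their inverse transposes, so rotating \<open>B k\<close> and \<open>D k\<close> by the same \<open>s k\<close> preserves
  the duality between the two products.\<close>

lemma seq_prod_dual:
  assumes c: "\<And>k. B k \<in> carrier_mat n n" "\<And>k. D k \<in> carrier_mat n n" and s: "\<And>k. s k \<in> orth n"
    and dual: "\<forall>k \<in> {1..l}. (B k)\<^sup>T * D k = 1\<^sub>m n"
  shows "(seq_prod n (\<lambda>k. s k * B k) l)\<^sup>T * seq_prod n (\<lambda>k. s k * D k) l = 1\<^sub>m n"
  using dual
proof (induction l)
  case (Suc l)
  let ?p = "seq_prod n (\<lambda>k. s k * B k) l" and ?q = "seq_prod n (\<lambda>k. s k * D k) l"
  let ?b = "B (Suc l)" and ?e = "D (Suc l)" and ?s = "s (Suc l)"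
  have pq: "?p \<in> carrier_mat n n" "?q \<in> carrier_mat n n"
    by (rule seq_prod_carrier[OF mult_carrier_mat[OF orthD(1)[OF s] c(1)]],
        rule seq_prod_carrier[OF mult_carrier_mat[OF orthD(1)[OF s] c(2)]])
  note q = orthD[OF s[of "Suc l"]] and be = c(1)[of "Suc l"] c(2)[of "Suc l"]
  have T: "?p\<^sup>T \<in> carrier_mat n n" "?b\<^sup>T \<in> carrier_mat n n" using pq be by auto
  have "(?s * ?b * ?p)\<^sup>T = ?p\<^sup>T * (?b\<^sup>T * ?s\<^sup>T)"
    using pq be q(1) by (simp add: transpose_mult[of _ n n _ n])
  hence "(?s * ?b * ?p)\<^sup>T * (?s * ?e * ?q) = ?p\<^sup>T * (?b\<^sup>T * (?s\<^sup>T * (?s * (?e * ?q))))"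
    using T pq be q(1,2) by (simp add: assoc_mult_mat[of _ n n _ n _ n])
  also have "?s\<^sup>T * (?s * (?e * ?q)) = ?e * ?q"
    by (rule conj_orth_cancel(1)[OF s mult_carrier_mat[OF be(2) pq(2)]])
  also have "?b\<^sup>T * (?e * ?q) = ?b\<^sup>T * ?e * ?q" by (rule assoc_mult_mat[symmetric, OF T(2) be(2) pq(2)])
  also have "?b\<^sup>T * ?e = 1\<^sub>m n" using Suc.prems by simp
  finally show ?case using Suc pq by simp
qed simp

text \<open>The stable subspace of the product is Lagrangian.  In orthonormal symplectic frames adapted to its
  images, the realifying rotations \<open>s\<close> of the stable cocycle \<open>B\<close> are applied simultaneously to the dual
  cocycle \<open>D\<close>; the block matrices \<open>diag(s, s)\<close> are symplectic.  The eigenvalues of the product of \<open>D\<close> are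
  the inverses of those of the product of \<open>B\<close>.\<close>

theorem exists_realifying_symplectic_rotations:
  assumes A: "\<And>k. A k \<in> Sp (n + n)" and hyp: "\<And>z. z \<in># eigenvals (seq_prod (n + n) A l) \<Longrightarrow> cmod z \<noteq> 1"
    and l: "l \<ge> 1" "pi \<le> \<delta> * real l"
  shows "\<exists>S. rotation_family (n + n) \<delta> S \<and> realifies (n + n) l A S \<and> (\<forall>t k. S t k \<in> Sp (n + n))"
proof -
  let ?d = "n + n"
  have Ac: "A k \<in> carrier_mat ?d ?d" "det (A k) \<noteq> 0" for k
    using Sp_carrier[OF A] Sp_det_nonzero[OF A] by auto
  have one: "1\<^sub>m ?d \<in> Sp ?d" unfolding Sp_iff using orthD(1)[OF symplectic_form_orth(1)[of n]] by simp
  have "seq_prod ?d A k \<in> Sp ?d" for k by (induction k) (use one Sp_mult[OF A] in auto)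
  from hyperbolic_symplectic_split[OF this hyp]
  obtain Q0 where Q0: "Q0 \<in> orth ?d \<inter> Sp ?d" "block_upper n n (Q0\<^sup>T * seq_prod ?d A l * Q0)" by blast
  obtain Q where Q: "\<And>k. Q k \<in> orth ?d \<inter> Sp ?d" "Q 0 = Q0" "Q l = Q0"
    "\<And>k. 1 \<le> k \<Longrightarrow> k \<le> l \<Longrightarrow> block_upper n n ((Q k)\<^sup>T * A k * Q (k - 1))"
    by (rule orth_chain[of "orth ?d \<inter> Sp ?d" n n Q0 A l])
      (use Q0 Ac exists_symplectic_triangularizer[OF A] l(1) in auto)
  have Qo: "Q k \<in> orth ?d" "Q k \<in> Sp ?d" for k using Q(1) by auto
  have QS: "(Q k)\<^sup>T * A k * Q (k - 1) \<in> Sp ?d" for k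
    by (intro Sp_mult Sp_transpose_orth Qo A)
  have bQ: "\<forall>k \<in> {1..l}. block_upper n n ((Q k)\<^sup>T * A k * Q (k - 1))" using Q(4) by simp
  obtain B X D where bb: "\<forall>k. B k \<in> carrier_mat n n \<and> X k \<in> carrier_mat n n \<and> D k \<in> carrier_mat n n \<and>
        det (B k) \<noteq> 0 \<and> det (D k) \<noteq> 0"
      "\<forall>k \<in> {1..l}. (Q k)\<^sup>T * A k * Q (k - 1) = four_block_mat (B k) (X k) (0\<^sub>m n n) (D k)"
    using block_upper_sequence[of l n n "\<lambda>k. (Q k)\<^sup>T * A k * Q (k - 1)", OF bQ Sp_det_nonzero[OF QS]] by blast
  have b: "B k \<in> carrier_mat n n" "X k \<in> carrier_mat n n" "D k \<in> carrier_mat n n" "det (B k) \<noteq> 0" for k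
    using bb(1) by blast+
  have dual: "\<forall>k \<in> {1..l}. (B k)\<^sup>T * D k = 1\<^sub>m n"
  proof
    fix k assume "k \<in> {1..l}"
    hence "four_block_mat (B k) (X k) (0\<^sub>m n n) (D k) \<in> Sp ?d" using QS[of k] bb(2) by simp
    thus "(B k)\<^sup>T * D k = 1\<^sub>m n" by (rule Sp_block_upper_dual[OF _ b(1-3)])
  qed
  obtain s where s: "rotation_family n \<delta> s" "realifies n l B s" using exists_realifying_rotations[of B n l \<delta>, OF b(1,4) l] by blast
  note so = rotation_familyD(1)[OF s(1)]
  define S where "S t k = Q k * four_block_mat (s t k) (0\<^sub>m n n) (0\<^sub>m n n) (s t k) * (Q k)\<^sup>T" for t k
  have S: "rotation_family ?d \<delta> S"
    unfolding S_def[abs_def] using rotation_family_conj[OF rotation_family_diag[OF s(1) s(1)], of Q] Qo(1) by simp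
  have SSp: "S t k \<in> Sp ?d" for t k
    unfolding S_def by (intro Sp_mult Sp_transpose_orth Qo diag_block_orth_Sp so)
  have cr: "eigenvals (seq_prod ?d (\<lambda>k. S t k * A k) l)
      = eigenvals (seq_prod n (\<lambda>k. s t k * B k) l) + image_mset inverse (eigenvals (seq_prod n (\<lambda>k. s t k * B k) l))" for t
  proof -
    have "eigenvals (seq_prod ?d (\<lambda>k. S t k * A k) l)
      = eigenvals (seq_prod n (\<lambda>k. s t k * B k) l) + eigenvals (seq_prod n (\<lambda>k. s t k * D k) l)"
      unfolding S_def
      by (rule eigenvals_block_cocycle[of A n n Q l B X D])
        (use Ac(1) Qo(1) in \<open>simp_all add: Q(2,3) bb(2)[unfolded One_nat_def] b orthD(1)[OF so]\<close>)
    also have "eigenvals (seq_prod n (\<lambda>k. s t k * D k) l) = image_mset inverse (eigenvals (seq_prod n (\<lambda>k. s t k * B k) l))"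
      by (rule eigenvals_inverse_transpose[OF seq_prod_carrier[OF mult_carrier_mat[OF orthD(1)[OF so] b(1)]]
            seq_prod_carrier[OF mult_carrier_mat[OF orthD(1)[OF so] b(3)]] seq_prod_dual[OF b(1,3) so dual]])
    finally show ?thesis .
  qed
  have z0: "(\<lambda>k. S 0 k * A k) = A" "(\<lambda>k. s 0 k * B k) = B"
    using rotation_familyD(3)[OF S] rotation_familyD(3)[OF s(1)] left_mult_one_mat[OF Ac(1)] left_mult_one_mat[OF b(1)] by auto
  have cr0: "eigenvals (seq_prod ?d A l) = eigenvals (seq_prod n B l) + image_mset inverse (eigenvals (seq_prod n B l))"
    using cr[of 0] unfolding z0 .
  have inv: "image_mset cmod (image_mset inverse M) = image_mset inverse (image_mset cmod M)" for M
    by (simp add: image_mset.compositionality o_def norm_inverse)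
  have "realifies ?d l A S"
    using s(2) unfolding realifies_def cr cr0 image_mset_union inv by auto
  with S SSp show ?thesis by blast
qed

section \<open>Operator norms and perturbation paths\<close>

lemma eucl_norm_nonneg: "0 \<le> eucl_norm v"
  unfolding eucl_norm_def by (simp add: scalar_prod_self_nonneg)

lemma eucl_norm_smult: "eucl_norm (c \<cdot>\<^sub>v v) = \<bar>c\<bar> * eucl_norm v"
  unfolding eucl_norm_def by (simp add: real_sqrt_mult mult.assoc[symmetric])

lemma abs_index_le_eucl_norm:
  assumes v: "v \<in> carrier_vec d" and i: "i < d"
  shows "\<bar>v $ i\<bar> \<le> eucl_norm v"
proof -
  have "(v $ i)^2 \<le> (\<Sum>k = 0..<d. (v $ k)^2)"
    by (rule member_le_sum) (use i in auto)
  also have "\<dots> = v \<bullet> v" using v by (simp add: scalar_prod_def power2_eq_square)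
  finally have "sqrt ((v $ i)^2) \<le> sqrt (v \<bullet> v)" by (rule real_sqrt_le_mono)
  thus ?thesis unfolding eucl_norm_def by simp
qed

text \<open>A bounded set is needed for the supremum in \<open>op_norm\<close> to be meaningful; the entries of \<open>A v\<close> are bounded by
  the absolute row sums of \<open>A\<close>.\<close>

lemma op_norm_bdd:
  assumes A: "A \<in> carrier_mat d d"
  shows "bdd_above ((\<lambda>v. eucl_norm (A *\<^sub>v v)) ` {v \<in> carrier_vec d. eucl_norm v \<le> 1})"
proof (rule bdd_aboveI2)
  fix v assume "v \<in> {v \<in> carrier_vec d. eucl_norm v \<le> 1}"
  hence v: "v \<in> carrier_vec d" and v1: "eucl_norm v \<le> 1" by auto
  have Av: "A *\<^sub>v v \<in> carrier_vec d" using A v by auto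
  have "((A *\<^sub>v v) $ i)^2 \<le> (\<Sum>k<d. \<bar>A $$ (i,k)\<bar>)^2" if i: "i < d" for i
  proof -
    have "\<bar>(A *\<^sub>v v) $ i\<bar> \<le> (\<Sum>k<d. \<bar>A $$ (i,k) * v $ k\<bar>)"
      unfolding mult_mat_vec_index_sum[OF A v i] by (rule sum_abs)
    also have "\<dots> \<le> (\<Sum>k<d. \<bar>A $$ (i,k)\<bar>)"
    proof (rule sum_mono)
      fix k assume "k \<in> {..<d}"
      hence "\<bar>v $ k\<bar> \<le> 1" using abs_index_le_eucl_norm[OF v, of k] v1 by simp
      thus "\<bar>A $$ (i,k) * v $ k\<bar> \<le> \<bar>A $$ (i,k)\<bar>"
        unfolding abs_mult by (rule mult_left_le) simp
    qed
    finally have "\<bar>(A *\<^sub>v v) $ i\<bar>^2 \<le> (\<Sum>k<d. \<bar>A $$ (i,k)\<bar>)^2" by (rule power_mono) simp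
    thus ?thesis by simp
  qed
  hence "(A *\<^sub>v v) \<bullet> (A *\<^sub>v v) \<le> (\<Sum>i = 0..<d. (\<Sum>k<d. \<bar>A $$ (i,k)\<bar>)^2)"
    unfolding scalar_prod_def carrier_vecD[OF Av] by (intro sum_mono) (simp add: power2_eq_square)
  thus "eucl_norm (A *\<^sub>v v) \<le> sqrt (\<Sum>i = 0..<d. (\<Sum>k<d. \<bar>A $$ (i,k)\<bar>)^2)"
    unfolding eucl_norm_def by (rule real_sqrt_le_mono)
qed

lemma eucl_norm_mult_le:
  assumes A: "A \<in> carrier_mat d d" and v: "v \<in> carrier_vec d"
  shows "eucl_norm (A *\<^sub>v v) \<le> op_norm A * eucl_norm v"
proof (cases "eucl_norm v = 0")
  case True
  hence "v \<bullet> v = 0" unfolding eucl_norm_def by simp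
  hence "v = 0\<^sub>v d" by (rule scalar_prod_self_zero[OF v])
  hence "A *\<^sub>v v = 0\<^sub>v d" using A by auto
  thus ?thesis using True by (simp add: eucl_norm_def)
next
  case False
  hence pos: "eucl_norm v > 0" using eucl_norm_nonneg[of v] by simp
  define w where "w = (1 / eucl_norm v) \<cdot>\<^sub>v v"
  have w: "w \<in> carrier_vec d" "eucl_norm w \<le> 1" unfolding w_def eucl_norm_smult using v pos by auto
  have "v = eucl_norm v \<cdot>\<^sub>v w" unfolding w_def using pos by (simp add: smult_smult_assoc)
  hence "A *\<^sub>v v = eucl_norm v \<cdot>\<^sub>v (A *\<^sub>v w)" using mult_mat_vec[OF A w(1)] by metis
  hence "eucl_norm (A *\<^sub>v v) = eucl_norm v * eucl_norm (A *\<^sub>v w)"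
    using pos by (simp add: eucl_norm_smult)
  also have "eucl_norm (A *\<^sub>v w) \<le> op_norm A"
    unfolding op_norm_def using A op_norm_bdd[OF A] w by (intro cSUP_upper) auto
  finally show ?thesis using pos by (simp add: mult.commute)
qed

lemma op_norm_le:
  assumes A: "A \<in> carrier_mat d d" and c: "c \<ge> 0"
    and le: "\<And>v. v \<in> carrier_vec d \<Longrightarrow> eucl_norm (A *\<^sub>v v) \<le> c * eucl_norm v"
  shows "op_norm A \<le> c"
  unfolding op_norm_def
proof (rule cSUP_least)
  show "{v \<in> carrier_vec (dim_col A). eucl_norm v \<le> 1} \<noteq> {}"
    by (auto intro!: exI[of _ "0\<^sub>v (dim_col A)"] simp: eucl_norm_def)
  fix v assume "v \<in> {v \<in> carrier_vec (dim_col A). eucl_norm v \<le> 1}"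
  hence "v \<in> carrier_vec d" "eucl_norm v \<le> 1" using A by auto
  thus "eucl_norm (A *\<^sub>v v) \<le> c" using le[of v] mult_left_mono[of "eucl_norm v" 1 c] c by simp
qed

lemma op_norm_nonneg:
  assumes A: "A \<in> carrier_mat d d" shows "op_norm A \<ge> 0"
proof -
  have "0 \<le> eucl_norm (A *\<^sub>v 0\<^sub>v d)" by (rule eucl_norm_nonneg)
  also have "\<dots> \<le> op_norm A"
    unfolding op_norm_def using A op_norm_bdd[OF A] by (intro cSUP_upper) (auto simp: eucl_norm_def)
  finally show ?thesis .
qed

lemma mat_inv_props:
  assumes A: "A \<in> carrier_mat d d" "det A \<noteq> 0"
  shows "mat_inv A \<in> carrier_mat d d" "A * mat_inv A = 1\<^sub>m d" "mat_inv A * A = 1\<^sub>m d"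
proof -
  have "A \<in> Units (ring_mat TYPE(real) d undefined)" by (rule det_non_zero_imp_unit[OF A])
  then obtain B where "mat_inverse A = Some B"
    using mat_inverse(1)[OF A(1), of undefined] by (cases "mat_inverse A") auto
  thus "mat_inv A \<in> carrier_mat d d" "A * mat_inv A = 1\<^sub>m d" "mat_inv A * A = 1\<^sub>m d"
    using mat_inverse(2)[OF A(1)] unfolding mat_inv_def by auto
qed

lemma mat_inv_orth_mult:
  assumes A: "A \<in> carrier_mat d d" "det A \<noteq> 0" and S: "S \<in> orth d"
  shows "mat_inv (S * A) = mat_inv A * S\<^sup>T"
proof -
  note i = mat_inv_props[OF A] and s = orthD[OF S]
  have SA: "S * A \<in> carrier_mat d d" "det (S * A) \<noteq> 0"
    using A s det_orth_nonzero[OF S] by (auto simp: det_mult[of _ d])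
  note j = mat_inv_props[OF SA]
  have AS: "mat_inv A * S\<^sup>T \<in> carrier_mat d d" using i s by auto
  have "(mat_inv A * S\<^sup>T) * (S * A) = mat_inv A * (S\<^sup>T * (S * A))"
    by (rule assoc_mult_mat) (use i s SA in auto)
  hence l: "(mat_inv A * S\<^sup>T) * (S * A) = 1\<^sub>m d" using conj_orth_cancel(1)[OF S A(1)] i by simp
  have "mat_inv A * S\<^sup>T = (mat_inv A * S\<^sup>T) * ((S * A) * mat_inv (S * A))"
    unfolding j(2) using right_mult_one_mat[OF AS] by simp
  also have "\<dots> = ((mat_inv A * S\<^sup>T) * (S * A)) * mat_inv (S * A)"
    by (rule assoc_mult_mat[symmetric, OF AS SA(1) j(1)])
  also have "\<dots> = mat_inv (S * A)" unfolding l using j by simp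
  finally show ?thesis by simp
qed

lemma rotation_family_eucl_norm:
  assumes S: "rotation_family d \<delta> S" and \<delta>: "\<delta> \<ge> 0" and v: "v \<in> carrier_vec d"
  shows "eucl_norm (S t k *\<^sub>v v - S s k *\<^sub>v v) \<le> \<delta> * \<bar>t - s\<bar> * eucl_norm v"
proof -
  have "eucl_norm (S t k *\<^sub>v v - S s k *\<^sub>v v) \<le> sqrt ((\<delta> * (t - s))^2 * (v \<bullet> v))"
    unfolding eucl_norm_def by (rule real_sqrt_le_mono[OF rotation_familyD(4)[OF S v]])
  also have "\<dots> = \<delta> * \<bar>t - s\<bar> * eucl_norm v"
    using \<delta> unfolding eucl_norm_def by (simp add: real_sqrt_mult abs_mult)
  finally show ?thesis .
qed

lemma op_norm_rotation_diff:
  assumes S: "rotation_family d \<delta> S" and \<delta>: "\<delta> \<ge> 0" and A: "A \<in> carrier_mat d d"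
  shows "op_norm (S t k * A - S s k * A) \<le> \<delta> * \<bar>t - s\<bar> * op_norm A"
proof (rule op_norm_le)
  note c = orthD(1)[OF rotation_familyD(1)[OF S]]
  show "S t k * A - S s k * A \<in> carrier_mat d d" by (rule minus_carrier_mat[OF mult_carrier_mat[OF c A]])
  show "0 \<le> \<delta> * \<bar>t - s\<bar> * op_norm A" using \<delta> op_norm_nonneg[OF A] by simp
  fix v :: "real vec" assume v: "v \<in> carrier_vec d"
  have Av: "A *\<^sub>v v \<in> carrier_vec d" using A v by auto
  have "(S t k * A - S s k * A) *\<^sub>v v = S t k *\<^sub>v (A *\<^sub>v v) - S s k *\<^sub>v (A *\<^sub>v v)"
    using minus_mult_distrib_mat_vec[OF mult_carrier_mat[OF c A] mult_carrier_mat[OF c A] v]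
      assoc_mult_mat_vec[OF c A v] by simp
  hence "eucl_norm ((S t k * A - S s k * A) *\<^sub>v v) \<le> \<delta> * \<bar>t - s\<bar> * eucl_norm (A *\<^sub>v v)"
    using rotation_family_eucl_norm[OF S \<delta> Av] by simp
  also have "\<dots> \<le> \<delta> * \<bar>t - s\<bar> * (op_norm A * eucl_norm v)"
    by (rule mult_left_mono[OF eucl_norm_mult_le[OF A v]]) (use \<delta> in simp)
  finally show "eucl_norm ((S t k * A - S s k * A) *\<^sub>v v) \<le> \<delta> * \<bar>t - s\<bar> * op_norm A * eucl_norm v"
    by (simp add: mult.assoc)
qed

text \<open>The difference sends \<open>v\<close> to \<open>A\<^bsup>-1\<^esup> w\<close> with \<open>w = v - S\<^sup>T v\<close>, and \<open>|w| = |S w| = |S v - v|\<close>.\<close>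

lemma op_norm_inv_rotation_diff:
  assumes S: "rotation_family d \<delta> S" and \<delta>: "\<delta> \<ge> 0" and A: "A \<in> carrier_mat d d" "det A \<noteq> 0"
  shows "op_norm (mat_inv A - mat_inv (S t k * A)) \<le> \<delta> * \<bar>t\<bar> * op_norm (mat_inv A)"
proof (rule op_norm_le)
  note o = rotation_familyD(1)[OF S, of t k]
  note c = orthD[OF o] and i = mat_inv_props[OF A]
  have eq: "mat_inv (S t k * A) = mat_inv A * (S t k)\<^sup>T" by (rule mat_inv_orth_mult[OF A o])
  have ci: "mat_inv A * (S t k)\<^sup>T \<in> carrier_mat d d" using c i by auto
  show "mat_inv A - mat_inv (S t k * A) \<in> carrier_mat d d" unfolding eq by (rule minus_carrier_mat[OF ci])
  show "0 \<le> \<delta> * \<bar>t\<bar> * op_norm (mat_inv A)" using \<delta> op_norm_nonneg[OF i(1)] by simp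
  fix v :: "real vec" assume v: "v \<in> carrier_vec d"
  have Sv: "S t k *\<^sub>v v \<in> carrier_vec d" "(S t k)\<^sup>T *\<^sub>v v \<in> carrier_vec d" using c v by auto
  define w where "w = v - (S t k)\<^sup>T *\<^sub>v v"
  have w: "w \<in> carrier_vec d" unfolding w_def using v Sv by auto
  have "S t k *\<^sub>v ((S t k)\<^sup>T *\<^sub>v v) = v" using assoc_mult_mat_vec[OF c(1,2) v] c v by simp
  hence "S t k *\<^sub>v w = S t k *\<^sub>v v - v"
    unfolding w_def using mult_minus_distrib_mat_vec[OF c(1) v Sv(2)] by simp
  moreover have "eucl_norm (S t k *\<^sub>v w) = eucl_norm w"
    unfolding eucl_norm_def norm_mult_orth[OF o w] ..
  moreover have "eucl_norm (S t k *\<^sub>v v - v) \<le> \<delta> * \<bar>t\<bar> * eucl_norm v"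
    using rotation_family_eucl_norm[OF S \<delta> v, of t k 0] rotation_familyD(3)[OF S] v by simp
  ultimately have wv: "eucl_norm w \<le> \<delta> * \<bar>t\<bar> * eucl_norm v" by simp
  have "(mat_inv A - mat_inv (S t k * A)) *\<^sub>v v = mat_inv A *\<^sub>v w"
    unfolding eq w_def using minus_mult_distrib_mat_vec[OF i(1) ci v]
      mult_minus_distrib_mat_vec[OF i(1) v Sv(2)] assoc_mult_mat_vec[OF i(1) c(2) v] by simp
  hence "eucl_norm ((mat_inv A - mat_inv (S t k * A)) *\<^sub>v v) \<le> op_norm (mat_inv A) * eucl_norm w"
    using eucl_norm_mult_le[OF i(1) w] by simp
  also have "\<dots> \<le> op_norm (mat_inv A) * (\<delta> * \<bar>t\<bar> * eucl_norm v)"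
    by (rule mult_left_mono[OF wv op_norm_nonneg[OF i(1)]])
  finally show "eucl_norm ((mat_inv A - mat_inv (S t k * A)) *\<^sub>v v) \<le> \<delta> * \<bar>t\<bar> * op_norm (mat_inv A) * eucl_norm v"
    by (simp add: ac_simps)
qed

text \<open>The representative of \<open>i\<close> modulo \<open>l\<close> in \<open>{1..l}\<close>, the range of indices in \<open>cocycle_prod\<close>.\<close>

definition cyclic_index :: "nat \<Rightarrow> int \<Rightarrow> nat" where
  "cyclic_index l i = Suc (nat ((i - 1) mod int l))"

lemma cyclic_index_shift: "cyclic_index l (i + int l) = cyclic_index l i"
proof -
  have "(i + int l - 1) mod int l = (i - 1) mod int l"
    using mod_add_self2[of "i - 1" "int l"] by (simp add: algebra_simps)
  thus ?thesis unfolding cyclic_index_def by simp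
qed

lemma cyclic_index_id:
  assumes "1 \<le> k" "k \<le> l" shows "cyclic_index l (int k) = k"
proof -
  have "(int k - 1) mod int l = int k - 1" using assms by (intro mod_pos_pos_trivial) auto
  thus ?thesis unfolding cyclic_index_def using assms by simp
qed

lemma cocycle_prod_eq_seq_prod: "cocycle_prod d A l = seq_prod d (\<lambda>k. A (int k)) l"
  by (induction l) auto

text \<open>The rotations, extended periodically, change each \<open>A i\<close> and its inverse by at most \<open>\<delta>\<close> times their norm.\<close>

lemma perturbation_path_of_rotations:
  assumes per: "periodic_cocycle G l A" and bnd: "cocycle_bounded C A"
    and G: "\<And>M. M \<in> G \<Longrightarrow> M \<in> carrier_mat d d \<and> det M \<noteq> 0"
    and S: "rotation_family d \<delta> S" and \<delta>: "\<delta> \<ge> 0" "\<delta> * C < \<epsilon>"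
    and SG: "\<And>t k i. S t k * A i \<in> G"
    and R: "realifies d l (\<lambda>k. A (int k)) S"
  shows "\<exists>P. perturbation_path G l \<epsilon> A P \<and>
      (\<forall>s\<in>{0..1}. \<forall>t\<in>{0..1}. eigenvalue_moduli (cocycle_prod d (P s) l) = eigenvalue_moduli (cocycle_prod d (P t) l)) \<and>
      (\<forall>z. complex_eigenvalue (cocycle_prod d (P 1) l) z \<longrightarrow> z \<in> \<real>)"
proof -
  have l: "l \<ge> 1" and A: "\<And>i. A i \<in> G" and Aper: "\<And>i. A (i + int l) = A i"
    using per unfolding periodic_cocycle_def by auto
  have Ac: "A i \<in> carrier_mat d d" "det (A i) \<noteq> 0" for i using G[OF A[of i]] by auto
  have AC: "op_norm (A i) \<le> C" "op_norm (mat_inv (A i)) \<le> C" for i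
    using bnd unfolding cocycle_bounded_def by (simp_all add: max.bounded_iff)
  define P where "P t i = S t (cyclic_index l i) * A i" for t i
  note c = orthD(1)[OF rotation_familyD(1)[OF S]]
  have P0: "P 0 i = A i" for i unfolding P_def using rotation_familyD(3)[OF S] left_mult_one_mat[OF Ac(1)] by simp
  have Pc: "P t i \<in> carrier_mat d d" for t i unfolding P_def by (rule mult_carrier_mat[OF c Ac(1)])
  have "perturbation_path G l \<epsilon> A P"
    unfolding perturbation_path_def
  proof (intro conjI ballI allI)
    show "periodic_cocycle G l (P t)" for t
      unfolding periodic_cocycle_def P_def using l SG Aper by (simp add: cyclic_index_shift)
    show "P 0 i = A i" for i by (rule P0)
    show "((\<lambda>t. op_norm (P t i - P s i)) \<longlongrightarrow> 0) (at s within {0..1})" for i s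
    proof (rule tendsto_sandwich)
      show "\<forall>\<^sub>F t in at s within {0..1}. 0 \<le> op_norm (P t i - P s i)"
        using op_norm_nonneg[of "P t i - P s i" d for t] Pc by (simp add: minus_carrier_mat)
      show "\<forall>\<^sub>F t in at s within {0..1}. op_norm (P t i - P s i) \<le> \<delta> * \<bar>t - s\<bar> * op_norm (A i)"
        unfolding P_def using op_norm_rotation_diff[OF S \<delta>(1) Ac(1)] by simp
      show "((\<lambda>t. \<delta> * \<bar>t - s\<bar> * op_norm (A i)) \<longlongrightarrow> 0) (at s within {0..1})"
        by (auto intro!: tendsto_eq_intros)
    qed simp
    fix i and t :: real assume t: "t \<in> {0..1}"
    have small: "\<delta> * \<bar>t\<bar> * x < \<epsilon>" if "0 \<le> x" "x \<le> C" for x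
    proof -
      have "\<delta> * \<bar>t\<bar> * x \<le> \<delta> * 1 * C" by (intro mult_mono) (use that t \<delta> in auto)
      thus ?thesis using \<delta> by simp
    qed
    have "op_norm (A i - P t i) \<le> \<delta> * \<bar>t\<bar> * op_norm (A i)"
      using op_norm_rotation_diff[OF S \<delta>(1) Ac(1), of 0 "cyclic_index l i" i t] unfolding P_def[symmetric] P0 by simp
    hence 1: "op_norm (A i - P t i) < \<epsilon>"
      using small[OF op_norm_nonneg[OF Ac(1)] AC(1), of i] by simp
    have "op_norm (mat_inv (A i) - mat_inv (P t i)) \<le> \<delta> * \<bar>t\<bar> * op_norm (mat_inv (A i))"
      unfolding P_def by (rule op_norm_inv_rotation_diff[OF S \<delta>(1) Ac])
    hence 2: "op_norm (mat_inv (A i) - mat_inv (P t i)) < \<epsilon>"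
      using small[OF op_norm_nonneg[OF mat_inv_props(1)[OF Ac]] AC(2), of i] by simp
    show "max (op_norm (A i - P t i)) (op_norm (mat_inv (A i) - mat_inv (P t i))) < \<epsilon>"
      using 1 2 by simp
  qed
  moreover have prod: "cocycle_prod d (P t) l = seq_prod d (\<lambda>k. S t k * A (int k)) l" for t
    unfolding cocycle_prod_eq_seq_prod P_def by (rule seq_prod_cong) (simp add: cyclic_index_id)
  have "cocycle_prod d (P 1) l \<in> carrier_mat d d"
    unfolding cocycle_prod_eq_seq_prod by (rule seq_prod_carrier[OF Pc])
  note ev = complex_eigenvalue_iff[OF this]
  have "eigenvalue_moduli (cocycle_prod d (P s) l) = eigenvalue_moduli (cocycle_prod d (P t) l)"
    if "s \<in> {0..1}" "t \<in> {0..1}" for s t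
    using R that unfolding realifies_def eigenvalue_moduli_eigenvals prod by simp
  moreover have "\<forall>z. complex_eigenvalue (cocycle_prod d (P 1) l) z \<longrightarrow> z \<in> \<real>"
    using R unfolding ev unfolding realifies_def prod by simp
  ultimately show ?thesis by blast
qed

lemma GL_iff: "M \<in> GL d \<longleftrightarrow> M \<in> carrier_mat d d \<and> det M \<noteq> 0"
proof
  assume "M \<in> GL d"
  then obtain B where M: "M \<in> carrier_mat d d" and B: "M * B = 1\<^sub>m d" "B * M = 1\<^sub>m (dim_row B)"
    unfolding GL_def invertible_mat_def inverts_mat_def by auto
  have "dim_col B = d" using arg_cong[OF B(1), of dim_col] by simp
  moreover have "dim_row B = d" using arg_cong[OF B(2), of dim_col] M by simp
  ultimately have "B \<in> carrier_mat d d" by auto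
  from det_mult[OF M this] show "M \<in> carrier_mat d d \<and> det M \<noteq> 0" using B M by auto
next
  assume M: "M \<in> carrier_mat d d \<and> det M \<noteq> 0"
  then obtain B where "B \<in> carrier_mat d d" "M * B = 1\<^sub>m d" "B * M = 1\<^sub>m d"
    using exists_mat_inverse by blast
  with M show "M \<in> GL d" unfolding GL_def invertible_mat_def inverts_mat_def by (auto intro!: exI[of _ B])
qed

section \<open>The perturbation theorem\<close>

text \<open>The period at which the angles \<open>\<delta>\<close> available at the single steps add up to \<open>pi\<close>.\<close>

lemma rotation_angle_threshold:
  assumes \<delta>: "\<delta> > 0" and l: "l \<ge> max 1 (nat \<lceil>pi / \<delta>\<rceil>)"
  shows "l \<ge> 1" "pi \<le> \<delta> * real l"
proof -
  show "l \<ge> 1" using l by simp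
  have "pi / \<delta> \<le> real (nat \<lceil>pi / \<delta>\<rceil>)" by (rule real_nat_ceiling_ge)
  also have "\<dots> \<le> real l" using l by simp
  finally show "pi \<le> \<delta> * real l" using \<delta> by (simp add: pos_divide_le_eq mult.commute)
qed

theorem proposition4p2:
  fixes d :: nat and C \<epsilon> :: real
  assumes "d \<ge> 1" and "C > 1" and "\<epsilon> > 0"
  shows
    "(\<exists>T::nat. T \<ge> 1 \<and>
       (\<forall>G \<in> {GL d, SL d}. \<forall>l \<ge> T. \<forall>A.
          periodic_cocycle G l A \<and> cocycle_bounded C A \<longrightarrow>
          (\<exists>P. perturbation_path G l \<epsilon> A P \<and>
             (\<forall>s\<in>{0..1}. \<forall>t\<in>{0..1}.
                eigenvalue_moduli (cocycle_prod d (P s) l)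
                = eigenvalue_moduli (cocycle_prod d (P t) l)) \<and>
             (\<forall>z. complex_eigenvalue (cocycle_prod d (P 1) l) z \<longrightarrow> z \<in> \<real>))))
     \<and>
     (even d \<longrightarrow>
      (\<exists>T::nat. T \<ge> 1 \<and>
       (\<forall>l \<ge> T. \<forall>A.
          periodic_cocycle (Sp d) l A \<and> cocycle_bounded C A \<and> hyperbolic_cocycle d l A \<longrightarrow>
          (\<exists>P. perturbation_path (Sp d) l \<epsilon> A P \<and>
             (\<forall>s\<in>{0..1}. \<forall>t\<in>{0..1}.
                eigenvalue_moduli (cocycle_prod d (P s) l)
                = eigenvalue_moduli (cocycle_prod d (P t) l)) \<and>
             (\<forall>z. complex_eigenvalue (cocycle_prod d (P 1) l) z \<longrightarrow> z \<in> \<real>)))))"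
proof -
  \<comment> \<open>rotating by angles at most \<open>\<delta>\<close> moves \<open>A i\<close> and its inverse by at most \<open>\<delta> C = \<epsilon> / 2\<close>\<close>
  define \<delta> where "\<delta> = \<epsilon> / (2 * C)"
  have \<delta>: "\<delta> > 0" "\<delta> * C < \<epsilon>" using assms(2,3) unfolding \<delta>_def by auto
  define T where "T = max 1 (nat \<lceil>pi / \<delta>\<rceil>)"
  have T1: "T \<ge> 1" unfolding T_def by simp
  note long = rotation_angle_threshold[OF \<delta>(1), folded T_def]
  show ?thesis
  proof (intro conjI impI exI[of _ T] T1 ballI allI)
    fix G l A
    assume G: "G \<in> {GL d, SL d}" and l: "T \<le> l" and A: "periodic_cocycle G l A \<and> cocycle_bounded C A"
    have Gd: "M \<in> carrier_mat d d \<and> det M \<noteq> 0" if "M \<in> G" for M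
      using G that by (auto simp: GL_iff SL_def)
    have Ai: "A i \<in> G" for i using A unfolding periodic_cocycle_def by blast
    have Ac: "A i \<in> carrier_mat d d" "det (A i) \<noteq> 0" for i using Gd[OF Ai[of i]] by auto
    obtain S where S: "rotation_family d \<delta> S" "realifies d l (\<lambda>k. A (int k)) S"
      using exists_realifying_rotations[of "\<lambda>k. A (int k)" d l \<delta>, OF Ac long[OF l]] by blast
    have SG: "S t k * A i \<in> G" for t k i
    proof -
      note s = orthD(1)[OF rotation_familyD(1)[OF S(1), of t k]]
      have "S t k * A i \<in> carrier_mat d d" by (rule mult_carrier_mat[OF s Ac(1)])
      moreover have "det (S t k * A i) = det (A i)"
        unfolding det_mult[OF s Ac(1)] rotation_familyD(2)[OF S(1)] by simp
      ultimately show ?thesis using G Ai[of i] by (auto simp: GL_iff SL_def)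
    qed
    show "\<exists>P. perturbation_path G l \<epsilon> A P \<and>
             (\<forall>s\<in>{0..1}. \<forall>t\<in>{0..1}.
                eigenvalue_moduli (cocycle_prod d (P s) l)
                = eigenvalue_moduli (cocycle_prod d (P t) l)) \<and>
             (\<forall>z. complex_eigenvalue (cocycle_prod d (P 1) l) z \<longrightarrow> z \<in> \<real>)"
      by (rule perturbation_path_of_rotations[OF _ _ Gd S(1) _ \<delta>(2) SG S(2)]) (use A \<delta> in auto)
  next
    fix l A
    assume "even d" and l: "T \<le> l"
      and A: "periodic_cocycle (Sp d) l A \<and> cocycle_bounded C A \<and> hyperbolic_cocycle d l A"
    obtain n where d: "d = n + n" using \<open>even d\<close> by (metis evenE mult_2)
    have Ai: "A i \<in> Sp (n + n)" for i using A unfolding periodic_cocycle_def d by blast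
    have Gd: "M \<in> carrier_mat d d \<and> det M \<noteq> 0" if "M \<in> Sp d" for M
      using Sp_carrier[of M n] Sp_det_nonzero[of M n] that unfolding d by simp
    have Mc: "seq_prod (n + n) (\<lambda>k. A (int k)) l \<in> carrier_mat (n + n) (n + n)"
      by (rule seq_prod_carrier[OF Sp_carrier[OF Ai]])
    have hyp: "cmod z \<noteq> 1" if "z \<in># eigenvals (seq_prod (n + n) (\<lambda>k. A (int k)) l)" for z
      using A that unfolding hyperbolic_cocycle_def d cocycle_prod_eq_seq_prod complex_eigenvalue_iff[OF Mc] by blast
    obtain S where S: "rotation_family (n + n) \<delta> S" "realifies (n + n) l (\<lambda>k. A (int k)) S"
      "\<forall>t k. S t k \<in> Sp (n + n)"
      using exists_realifying_symplectic_rotations[of "\<lambda>k. A (int k)" n l \<delta>, OF Ai hyp long[OF l]] by blast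
    have SG: "S t k * A i \<in> Sp d" for t k i unfolding d by (rule Sp_mult[OF _ Ai]) (use S(3) in blast)
    show "\<exists>P. perturbation_path (Sp d) l \<epsilon> A P \<and>
             (\<forall>s\<in>{0..1}. \<forall>t\<in>{0..1}.
                eigenvalue_moduli (cocycle_prod d (P s) l)
                = eigenvalue_moduli (cocycle_prod d (P t) l)) \<and>
             (\<forall>z. complex_eigenvalue (cocycle_prod d (P 1) l) z \<longrightarrow> z \<in> \<real>)"
      by (rule perturbation_path_of_rotations[OF _ _ Gd S(1)[folded d] _ \<delta>(2) SG S(2)[folded d]]) (use A \<delta> in auto)
  qed
qed

end
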